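(* The first singular homology groups $H_1(Z)$ and $H_1(Y)$ of the Hawaiian Earring $Z=H(p_1,p_2,\dots)$ and of Griffiths' space $Y=G(p_1,q_1,p_2,q_2,\dots)$ contain subgroups isomorphic to $\bigoplus_{2^{\aleph_0}}\mathbb Q$. Furthermore, the fundamental group $\pi_1(Y)$ of Griffiths' space contains a subgroup isomorphic to $\mathbb Q$.
   Context: The Hawaiian Earring $H(p_1,p_2,\dots)$ is the union of circles $p_n$ of radii $1/n$ ($n\ge1$) in the Euclidean plane, pairwise meeting only in one common base point (all on the same side of a common tangent), with the subspace topology. Griffiths' space $G(p_1,q_1,p_2,q_2,\dots)$ is the one-point union of the cone over the Hawaiian Earring $H(p_1,p_2,\dots)$ and the cone over a second Hawaiian Earring $H(q_1,q_2,\dots)$, glued at the base points of the two Earrings. $\bigoplus_{2^{\aleph_0}}\mathbb Q$ is the direct sum of $2^{\aleph_0}$ copies of the additive group $\mathbb Q$. *)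

theory Defs
  imports "HOL-Homology.Homology"
begin

definition hawaiian_earring :: "complex set" where
  "hawaiian_earring = (\<Union>n\<in>{1::nat..}. sphere (complex_of_real (1 / real n)) (1 / real n))"

text \<open>The quotient of \<^term>\<open>X\<close> by an equivalence relation \<^term>\<open>r\<close> on its points;
  the points of the quotient are the equivalence classes.\<close>

definition quotient_topology :: "'a topology \<Rightarrow> ('a \<times> 'a) set \<Rightarrow> 'a set topology" where
  "quotient_topology X r =
     topology (\<lambda>U. U \<subseteq> topspace X // r \<and> openin X {x \<in> topspace X. r `` {x} \<in> U})"

lemma openin_quotient_topology:
  "openin (quotient_topology X r) U \<longleftrightarrow>
     U \<subseteq> topspace X // r \<and> openin X {x \<in> topspace X. r `` {x} \<in> U}"
proof -
  have "istopology (\<lambda>U. U \<subseteq> topspace X // r \<and> openin X {x \<in> topspace X. r `` {x} \<in> U})"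
    unfolding istopology_def
  proof (intro conjI allI impI)
    fix S T
    assume "S \<subseteq> topspace X // r \<and> openin X {x \<in> topspace X. r `` {x} \<in> S}"
      and "T \<subseteq> topspace X // r \<and> openin X {x \<in> topspace X. r `` {x} \<in> T}"
    moreover have "{x \<in> topspace X. r `` {x} \<in> S \<inter> T} =
      {x \<in> topspace X. r `` {x} \<in> S} \<inter> {x \<in> topspace X. r `` {x} \<in> T}"
      by auto
    ultimately show "S \<inter> T \<subseteq> topspace X // r" "openin X {x \<in> topspace X. r `` {x} \<in> S \<inter> T}"
      by auto
  next
    fix K
    assume K: "\<forall>S\<in>K. S \<subseteq> topspace X // r \<and> openin X {x \<in> topspace X. r `` {x} \<in> S}"
    then show "\<Union>K \<subseteq> topspace X // r" by auto
    have "{x \<in> topspace X. r `` {x} \<in> \<Union>K} = (\<Union>S\<in>K. {x \<in> topspace X. r `` {x} \<in> S})"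
      by auto
    then show "openin X {x \<in> topspace X. r `` {x} \<in> \<Union>K}"
      using K by (auto intro!: openin_Union)
  qed
  then show ?thesis
    by (simp add: quotient_topology_def topology_inverse')
qed

lemma topspace_quotient_topology [simp]:
  "topspace (quotient_topology X r) = topspace X // r"
proof
  show "topspace (quotient_topology X r) \<subseteq> topspace X // r"
    using openin_quotient_topology openin_topspace by blast
  have "{x \<in> topspace X. r `` {x} \<in> topspace X // r} = topspace X"
    by (auto simp: quotient_def)
  then have "openin (quotient_topology X r) (topspace X // r)"
    by (simp add: openin_quotient_topology)
  then show "topspace X // r \<subseteq> topspace (quotient_topology X r)"
    by (rule openin_subset)
qed

lemma quotient_map_quotient_topology:
  "quotient_map X (quotient_topology X r) (\<lambda>x. r `` {x})"
  unfolding quotient_map_def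
  by (auto simp: openin_quotient_topology quotient_def)

definition collapse_rel :: "'a topology \<Rightarrow> 'a set \<Rightarrow> ('a \<times> 'a) set" where
  "collapse_rel X A = Id_on (topspace X) \<union> A \<times> A"

lemma equiv_collapse_rel:
  "A \<subseteq> topspace X \<Longrightarrow> equiv (topspace X) (collapse_rel X A)"
  by (rule equivI) (auto simp: collapse_rel_def intro!: refl_onI symI transI)

definition cone_rel :: "'a topology \<Rightarrow> (('a \<times> real) \<times> ('a \<times> real)) set" where
  "cone_rel X = collapse_rel (prod_topology X (top_of_set {0..1})) (topspace X \<times> {1})"

definition cone :: "'a topology \<Rightarrow> ('a \<times> real) set topology" where
  "cone X = quotient_topology (prod_topology X (top_of_set {0..1})) (cone_rel X)"

text \<open>The canonical embedding of \<^term>\<open>X\<close> as the base of its cone (the apex is at height 1).\<close>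

definition cone_base :: "'a topology \<Rightarrow> 'a \<Rightarrow> ('a \<times> real) set" where
  "cone_base X x = cone_rel X `` {(x, 0)}"

definition one_point_union ::
    "'a topology \<Rightarrow> 'a \<Rightarrow> 'a topology \<Rightarrow> 'a \<Rightarrow> (bool \<times> 'a) set topology" where
  "one_point_union X a Y b =
     (let S = sum_topology (\<lambda>i. if i then Y else X) UNIV
      in quotient_topology S (collapse_rel S {(False, a), (True, b)}))"

text \<open>The two cones are glued at the common point 0 of the circles of each earring,
  which lies in the base of the cone, not at the apex.\<close>

definition griffiths_space :: "(bool \<times> (complex \<times> real) set) set topology" where
  "griffiths_space =
     (let H = top_of_set hawaiian_earring
      in one_point_union (cone H) (cone_base H 0) (cone H) (cone_base H 0))"

definition loops :: "'a topology \<Rightarrow> 'a \<Rightarrow> (real \<Rightarrow> 'a) set" where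
  "loops X a = {p. pathin X p \<and> p 0 = a \<and> p 1 = a}"

text \<open>Homotopy of loops relative to the end points. A loop is a function on all of
  \<^typ>\<open>real\<close>, but loops that agree on the unit interval are homotopic.\<close>

definition loop_homotopy :: "'a topology \<Rightarrow> 'a \<Rightarrow> ((real \<Rightarrow> 'a) \<times> (real \<Rightarrow> 'a)) set" where
  "loop_homotopy X a =
     {(p, q). homotopic_with (\<lambda>r. r 0 = a \<and> r 1 = a) (top_of_set {0..1}) X p q}"

lemma equiv_loop_homotopy: "equiv (loops X a) (loop_homotopy X a)"
proof (rule equivI)
  show "loop_homotopy X a \<subseteq> loops X a \<times> loops X a"
    unfolding loop_homotopy_def loops_def pathin_def
    by (auto dest: homotopic_with_imp_continuous_maps homotopic_with_imp_property)
  show "refl_on (loops X a) (loop_homotopy X a)"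
    by (auto simp: refl_on_def loop_homotopy_def loops_def pathin_def)
  show "sym (loop_homotopy X a)"
    by (rule symI) (auto simp: loop_homotopy_def intro: homotopic_with_symD)
  show "trans (loop_homotopy X a)"
    by (rule transI) (auto simp: loop_homotopy_def intro: homotopic_with_trans)
qed

definition join_loops :: "(real \<Rightarrow> 'a) \<Rightarrow> (real \<Rightarrow> 'a) \<Rightarrow> real \<Rightarrow> 'a" where
  "join_loops p q = (\<lambda>t. if t \<le> 1/2 then p (2 * t) else q (2 * t - 1))"

definition fundamental_group :: "'a topology \<Rightarrow> 'a \<Rightarrow> (real \<Rightarrow> 'a) set monoid" where
  "fundamental_group X a =
     \<lparr>carrier = loops X a // loop_homotopy X a,
      monoid.mult = (\<lambda>P Q. \<Union>p\<in>P. \<Union>q\<in>Q. loop_homotopy X a `` {join_loops p q}),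
      one = loop_homotopy X a `` {\<lambda>t. a}\<rparr>"

definition rat_group :: "rat monoid" where
  "rat_group = \<lparr>carrier = UNIV, monoid.mult = (+), one = 0\<rparr>"

lemma group_rat_group: "group rat_group"
  unfolding rat_group_def
proof (rule groupI; simp)
  show "\<exists>y. y + x = 0" for x :: rat
    by (rule exI[of _ "- x"]) simp
qed

definition contains_copy_of :: "('a, 'c) monoid_scheme \<Rightarrow> ('b, 'd) monoid_scheme \<Rightarrow> bool" where
  "contains_copy_of G K \<longleftrightarrow> (\<exists>S. subgroup S G \<and> G\<lparr>carrier := S\<rparr> \<cong> K)"

text \<open>The direct sum of copies of the rationals indexed by the sets of natural numbers,
  that is, of continuum many copies.\<close>

definition continuum_sum_rat :: "(nat set \<Rightarrow> rat) monoid" where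
  "continuum_sum_rat = sum_group (UNIV :: nat set set) (\<lambda>_. rat_group)"

end

theory Submission
  imports Defs "HOL-Analysis.Uniform_Limit"
begin

text \<open>
  Let \<open>p\<^sub>n\<close> and \<open>q\<^sub>n\<close> be the circles of radii \<open>1/(2n+1)\<close> and \<open>1/(2n+2)\<close>. For every set \<open>A\<close> of
  natural numbers there are loops \<open>x\<^sub>0, x\<^sub>1, \<dots>\<close> in the earring such that \<open>x\<^sub>n\<close> runs first through the
  commutator \<open>[p\<^sub>n, q\<^sub>n]\<close> (or rests, if \<open>n\<close> is not selected by \<open>A\<close>) and then \<open>n + 1\<close> times through
  \<open>x\<^sub>n\<^sub>+\<^sub>1\<close>. This infinite nesting converges because the circles shrink (\<open>tower_loop_rec\<close>). A commutator
  vanishes in homology, so the class of \<open>x\<^sub>n\<close> is \<open>n + 1\<close> times that of \<open>x\<^sub>n\<^sub>+\<^sub>1\<close>, and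
  \<open>1/n! \<mapsto> x\<^sub>n\<close> defines a homomorphism from the rationals (\<open>root_tower_hom\<close>). Griffiths' space is
  entered by sending the circles \<open>p\<^sub>n\<close> to one cone and the circles \<open>q\<^sub>n\<close> to the other. There the
  single circles contract, hence the same loops are roots of each other already in the fundamental
  group (\<open>tower_loop_root\<close>).

  The point is that integral combinations of the loops \<open>x\<^sub>0\<close> that belong to different sets \<open>A\<close> do not
  bound in Griffiths' space (\<open>tower_chains_independent\<close>); the injectivity of all three
  homomorphisms follows from this. Divisible elements are invisible to homomorphisms into the
  integers, but not to functionals that are additive only up to a bounded error. Consider the wedge of
  two circles and the bundle over it with fibre the real line and holonomies \<open>a\<close> and \<open>b\<close>, two
  increasing homeomorphisms that commute with the translation by \<open>1\<close>. Transporting the point \<open>0\<close>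
  along a path gives a real number \<open>\<phi>\<close>, which depends only on the homotopy class of the path, and
  whose alternating sum over the sides of a triangle is at most \<open>1\<close> in absolute value
  (\<open>transport_triangle\<close>, \<open>transport_defect\<close>). The maps \<open>a\<close> and \<open>b\<close> are chosen with fixed
  points, so that \<open>\<phi>\<close> is bounded by \<open>1\<close> on paths in a single circle, and such that their commutator
  maps \<open>1/8\<close> to \<open>9/8\<close>, so that \<open>\<phi>\<close> grows linearly on its powers (\<open>stretch_commutator_power\<close>).

  Suppose now that a combination \<open>x\<close> of the loops bounds. By excision it is the sum of a chain \<open>z\<close>
  away from the bases and the apexes of the cones and the boundary of a chain \<open>u\<close> away from the apexes
  (\<open>boundary_in_open_union\<close>). Away from the apexes Griffiths' space maps to the wedge in such a way
  that \<open>p\<^sub>n\<close> and \<open>q\<^sub>n\<close> become the two circles and the other circles collapse, and the paths in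
  \<open>z\<close> are mapped to paths in single circles. Therefore the value of \<open>\<phi>\<close> on \<open>x\<close> is bounded in terms of \<open>z\<close> and \<open>u\<close>, independently
  of \<open>n\<close>. But \<open>x\<^sub>0\<close> passes \<open>n!\<close> times through \<open>[p\<^sub>n, q\<^sub>n]\<close> if \<open>A\<close> selects \<open>n\<close>, and collapses
  otherwise. The sets of selected numbers are infinite and almost disjoint, so that infinitely many \<open>n\<close> see
  only one of the loops, whose coefficient must then be zero.
\<close>

section \<open>Copies of the rationals in groups\<close>

lemma contains_copy_of_if_inj_hom:
  assumes "group G" "group K" "h \<in> hom K G" "inj_on h (carrier K)"
  shows "contains_copy_of G K"
proof -
  interpret group_hom K G h
    using assms by (simp add: group_hom_def group_hom_axioms_def)
  have S: "subgroup (h ` carrier K) G"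
    by (rule img_is_subgroup)
  have "h \<in> iso K (G\<lparr>carrier := h ` carrier K\<rparr>)"
    using assms(3,4) by (auto simp: iso_def hom_def bij_betw_def)
  then have "K \<cong> G\<lparr>carrier := h ` carrier K\<rparr>"
    by (auto simp: is_iso_def)
  then have "G\<lparr>carrier := h ` carrier K\<rparr> \<cong> K"
    using assms(2) by (simp add: group.iso_sym)
  with S show ?thesis
    by (auto simp: contains_copy_of_def)
qed

lemma group_rat_group_simps [simp]:
  "carrier rat_group = UNIV" "monoid.mult rat_group = (+)" "\<one>\<^bsub>rat_group\<^esub> = 0"
  by (simp_all add: rat_group_def)


lemma (in group) root_tower:
  assumes x: "\<And>n. x n \<in> carrier G" and root: "\<And>n. x n = x (Suc n) [^] Suc n"
    and "n \<le> m"
  shows "\<exists>r::nat. x n = x m [^] r \<and> fact m = r * (fact n :: nat)"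
  using \<open>n \<le> m\<close>
proof (induction m rule: dec_induct)
  case base
  show ?case by (rule exI[of _ 1]) (simp add: x)
next
  case (step m)
  then obtain r where r: "x n = x m [^] (r::nat)" "fact m = r * (fact n :: nat)" by blast
  have "x n = x (Suc m) [^] (Suc m * r)"
    using r(1) root[of m] x by (metis nat_pow_pow)
  moreover have "fact (Suc m) = (Suc m * r) * (fact n :: nat)"
    using r(2) by (simp add: algebra_simps)
  ultimately show ?case by blast
qed

text \<open>A compatible sequence of roots \<open>x n = x (n + 1)\<^sup>n\<^sup>+\<^sup>1\<close> is the image of the
  sequence \<open>1 / n!\<close>, which generates the rationals; only powers of single elements are compared,
  so that the group need not be abelian.\<close>

lemma (in group) root_tower_hom:
  assumes x: "\<And>n. x n \<in> carrier G" and root: "\<And>n. x n = x (Suc n) [^] Suc n"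
  obtains h where "h \<in> hom rat_group G" "\<And>n k. h (of_int k / fact n) = x n [^] (k::int)"
proof -
  have wd: "x n [^] k = x m [^] l"
    if "of_int k / fact n = (of_int l / fact m :: rat)" for n m :: nat and k l :: int
  proof -
    obtain r where r: "x n = x (max n m) [^] (r::nat)" "fact (max n m) = r * (fact n :: nat)"
      using root_tower[of x n "max n m", OF x root] by auto
    obtain s where s: "x m = x (max n m) [^] (s::nat)" "fact (max n m) = s * (fact m :: nat)"
      using root_tower[of x m "max n m", OF x root] by auto
    have "of_int (k * int r) = (of_int k / fact n) * (of_nat (fact (max n m)) :: rat)"
      unfolding r(2) by simp
    also have "\<dots> = of_int (l * int s)"
      unfolding that s(2) by simp
    finally have kl: "k * int r = l * int s"
      by (simp only: of_int_eq_iff)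
    have "x n [^] k = x (max n m) [^] (int r * k)"
      by (simp add: r(1) x int_pow_pow flip: int_pow_int)
    also have "\<dots> = x (max n m) [^] (int s * l)"
      using kl by (simp add: mult.commute)
    also have "\<dots> = x m [^] l"
      by (simp add: s(1) x int_pow_pow flip: int_pow_int)
    finally show ?thesis .
  qed
  have ex: "\<exists>n k. q = of_int k / fact n" for q :: rat
  proof -
    obtain a b where ab: "quotient_of q = (a, b)" by fastforce
    have b: "b > 0" and q: "q = of_int a / of_int b"
      using quotient_of_denom_pos[OF ab] quotient_of_div[OF ab] by auto
    have "nat b dvd (fact (nat b) :: nat)" using b by (intro dvd_fact) auto
    then obtain c where c: "fact (nat b) = nat b * (c::nat)" by blast
    then have "(fact (nat b) :: rat) = of_int b * of_nat c"
      by (metis b int_nat_eq less_imp_le of_int_of_nat_eq of_nat_fact of_nat_mult)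
    moreover have "c \<noteq> 0" using c by (metis fact_nonzero mult_0_right)
    ultimately have "q = of_int (a * int c) / fact (nat b)"
      using b q by simp
    then show ?thesis by blast
  qed
  define h where "h q = (SOME y. \<exists>n k. q = of_int k / fact n \<and> y = x n [^] (k::int))" for q :: rat
  have h: "h (of_int k / fact n) = x n [^] k" for n and k :: int
    unfolding h_def
  proof (rule someI2)
    show "\<exists>n' k'. of_int k / fact n = (of_int k' / fact n' :: rat) \<and> x n [^] k = x n' [^] (k'::int)"
      by blast
  qed (use wd in metis)
  have "h \<in> hom rat_group G"
  proof (rule homI)
    fix q :: rat assume "q \<in> carrier rat_group"
    obtain n k where "q = of_int k / fact n" using ex by blast
    then show "h q \<in> carrier G" by (simp add: h x)
  next
    fix p q :: rat
    obtain n k where p: "p = of_int k / fact n" using ex by blast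
    obtain m l where q: "q = of_int l / fact m" using ex by blast
    have common: "\<exists>k'. of_int k / fact n = (of_int k' / fact (n + m) :: rat)" for n m :: nat and k :: int
    proof -
      obtain c where c: "fact (n + m) = (fact n :: nat) * c"
        using fact_dvd[of n "n + m"] by auto
      then have "(fact (n + m) :: rat) = fact n * of_nat c"
        by (metis of_nat_fact of_nat_mult)
      moreover have "c \<noteq> 0" using c by (metis fact_nonzero mult_0_right)
      ultimately have "of_int k / fact n = (of_int (k * int c) / fact (n + m) :: rat)"
        by (simp add: field_simps)
      then show ?thesis by blast
    qed
    obtain k' where k': "p = of_int k' / fact (n + m)" using common p by blast
    obtain l' where l': "q = of_int l' / fact (n + m)"
      using common[of l m n] q by (auto simp: add.commute)
    have "p + q = of_int (k' + l') / fact (n + m)"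
      by (simp add: k' l' add_divide_distrib)
    then have "h (p + q) = x (n + m) [^] (k' + l')" using h by metis
    also have "\<dots> = h p \<otimes> h q" by (simp add: k' l' h x int_pow_mult)
    finally show "h (p \<otimes>\<^bsub>rat_group\<^esub> q) = h p \<otimes> h q" by simp
  qed
  with h that show thesis by blast
qed

lemma (in group) contains_copy_of_rat_group:
  assumes x: "\<And>n. x n \<in> carrier G" and root: "\<And>n. x n = x (Suc n) [^] Suc n"
    and inf: "\<And>k::nat. x 0 [^] k = \<one> \<Longrightarrow> k = 0"
  shows "contains_copy_of G rat_group"
proof -
  obtain h where h: "h \<in> hom rat_group G" "\<And>n k. h (of_int k / fact n) = x n [^] (k::int)"
    using root_tower_hom[OF x root] by blast
  interpret h: group_hom rat_group G h
    using h(1) by (simp add: group_hom_def group_hom_axioms_def group_rat_group)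
  have "q = 0" if q: "h q = \<one>" for q
  proof -
    obtain a b where ab: "quotient_of q = (a, b)" by fastforce
    have b: "b > 0" and qab: "q = of_int a / of_int b"
      using quotient_of_denom_pos[OF ab] quotient_of_div[OF ab] by auto
    have mult: "h (of_nat k * q) = \<one>" for k :: nat
    proof (induction k)
      case 0 then show ?case using h.hom_one by simp
    next
      case (Suc k)
      then show ?case
        using h.hom_mult[of "of_nat k * q" q] q by (simp add: algebra_simps)
    qed
    have "x 0 [^] a = \<one>"
      using mult[of "nat b"] b h(2)[of a 0] by (simp add: qab)
    then have "x 0 [^] \<bar>a\<bar> = \<one>"
      using x by (cases "a \<ge> 0") (auto simp: int_pow_neg)
    then have "x 0 [^] nat \<bar>a\<bar> = \<one>"
      by (simp flip: int_pow_int)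
    then have "nat \<bar>a\<bar> = 0" by (rule inf)
    then have "a = 0" by simp
    then show ?thesis using qab by simp
  qed
  then have "inj_on h (carrier rat_group)"
    by (intro h.inj_on_one_iff[THEN iffD2]) auto
  then show ?thesis
    using h(1) group_rat_group by (intro contains_copy_of_if_inj_hom) auto
qed

lemma carrier_continuum_sum_rat: "carrier continuum_sum_rat = {f. finite {A. f A \<noteq> 0}}"
  by (auto simp: continuum_sum_rat_def carrier_sum_group group_rat_group)

lemma mult_continuum_sum_rat: "monoid.mult continuum_sum_rat = (\<lambda>f g A. f A + g A)"
  by (auto simp: continuum_sum_rat_def fun_eq_iff)

lemma one_continuum_sum_rat: "\<one>\<^bsub>continuum_sum_rat\<^esub> = (\<lambda>A. 0)"
  by (auto simp: continuum_sum_rat_def)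

text \<open>For injectivity a relation between the images is multiplied by a common denominator, after which it
  involves only the elements \<open>x A 0\<close>.\<close>

lemma (in comm_group) contains_copy_of_continuum_sum_rat:
  fixes x :: "nat set \<Rightarrow> nat \<Rightarrow> 'a"
  assumes x: "\<And>A n. x A n \<in> carrier G" and root: "\<And>A n. x A n = x A (Suc n) [^] Suc n"
    and indep: "\<And>F k. finite F \<Longrightarrow> (\<Otimes>A\<in>F. x A 0 [^] (k A :: int)) = \<one> \<Longrightarrow> (\<And>A. A \<in> F \<Longrightarrow> k A = 0)"
  shows "contains_copy_of G continuum_sum_rat"
proof -
  have "\<exists>h. h \<in> hom rat_group G \<and> (\<forall>n k. h (of_int k / fact n) = x A n [^] (k::int))" for A
  proof -
    have "x A n = x A (Suc n) [^] Suc n" for n by (rule root)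
    then obtain g where "g \<in> hom rat_group G" "\<And>n k. g (of_int k / fact n) = x A n [^] (k::int)"
      using root_tower_hom[of "x A"] x by metis
    then show ?thesis by blast
  qed
  then obtain h where h: "\<And>A. h A \<in> hom rat_group G"
    and hx: "\<And>A n k. h A (of_int k / fact n) = x A n [^] (k::int)"
    by metis
  interpret h: group_hom rat_group G "h A" for A
    using h by (simp add: group_hom_def group_hom_axioms_def group_rat_group)
  have hone: "h A 0 = \<one>" for A using h.hom_one[of A] by simp
  have hcl: "h A q \<in> carrier G" for A q using h.hom_closed[of q A] by simp
  define H where "H f = gfinprod G (\<lambda>A. h A (f A)) UNIV" for f :: "nat set \<Rightarrow> rat"
  have H: "H f = (\<Otimes>A\<in>F. h A (f A))" if F: "finite F" "{A. f A \<noteq> 0} \<subseteq> F" for f F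
  proof -
    have "h A (f A) = \<one>" if "A \<notin> F" for A
    proof -
      have "f A = 0" using F(2) that by blast
      then show ?thesis using hone by simp
    qed
    then have "gfinprod G (\<lambda>A. h A (f A)) F = H f"
      unfolding H_def by (intro gfinprod_mono_neutral_cong_left) auto
    then show ?thesis using gfinprod_eq_finprod[OF F(1)] hcl by fastforce
  qed
  have Hhom: "H \<in> hom continuum_sum_rat G"
    unfolding continuum_sum_rat_def H_def by (rule hom_group_sum) (use h group_rat_group in auto)
  have grp: "group continuum_sum_rat"
    unfolding continuum_sum_rat_def by (rule sum_group) (rule group_rat_group)
  interpret H: group_hom continuum_sum_rat G H
    using Hhom grp by (simp add: group_hom_def group_hom_axioms_def)
  have "f = \<one>\<^bsub>continuum_sum_rat\<^esub>" if f: "f \<in> carrier continuum_sum_rat" "H f = \<one>" for f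
  proof -
    let ?F = "{A. f A \<noteq> 0}"
    have fin: "finite ?F" using f by (simp add: carrier_continuum_sum_rat)
    \<comment> \<open>multiply by a common denominator of the values of \<open>f\<close>\<close>
    define D where "D = (\<Prod>A\<in>?F. snd (quotient_of (f A)))"
    have D: "D > 0" unfolding D_def by (intro prod_pos) (simp add: quotient_of_denom_pos')
    have "\<exists>k. of_int D * f A = of_int k" for A
    proof (cases "A \<in> ?F")
      case True
      obtain a b where ab: "quotient_of (f A) = (a, b)" by fastforce
      have b: "b > 0" "f A = of_int a / of_int b"
        using quotient_of_denom_pos[OF ab] quotient_of_div[OF ab] by auto
      have "b dvd D" unfolding D_def
        using dvd_prodI[OF fin True, of "\<lambda>A. snd (quotient_of (f A))"] ab by simp
      then obtain c where "D = b * c" by blast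
      then have "of_int D * f A = of_int (a * c)" using b by simp
      then show ?thesis by blast
    qed (auto intro: exI[of _ 0])
    then obtain k where k: "\<And>A. of_int D * f A = of_int (k A)" by metis
    have mult: "H (\<lambda>A. of_nat n * f A) = \<one>" for n :: nat
    proof (induction n)
      case 0 then show ?case using H.hom_one by (simp add: one_continuum_sum_rat)
    next
      case (Suc n)
      have "(\<lambda>A. of_nat n * f A) \<in> carrier continuum_sum_rat"
        using f(1) by (auto simp: carrier_continuum_sum_rat elim: rev_finite_subset)
      from H.hom_mult[OF this f(1)] show ?case
        using Suc f(2) by (simp add: mult_continuum_sum_rat algebra_simps)
    qed
    have "\<one> = H (\<lambda>A. of_int (k A))"
      using mult[of "nat D"] D k by simp
    also have "\<dots> = (\<Otimes>A\<in>?F. h A (of_int (k A)))"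
      by (rule H[OF fin]) (use D in \<open>auto simp flip: k\<close>)
    also have "\<dots> = (\<Otimes>A\<in>?F. x A 0 [^] k A)"
      using hx[of _ _ 0] by (intro finprod_cong') (auto simp: x)
    finally have "(\<Otimes>A\<in>?F. x A 0 [^] k A) = \<one>" by (rule sym)
    then have "\<And>A. A \<in> ?F \<Longrightarrow> k A = 0" by (rule indep[OF fin])
    then have "f A = 0" for A using k[of A] D by (cases "f A = 0") auto
    then show ?thesis by (auto simp: one_continuum_sum_rat)
  qed
  then have "inj_on H (carrier continuum_sum_rat)"
    using H.inj_on_one_iff by auto
  then show ?thesis
    using Hhom grp by (intro contains_copy_of_if_inj_hom) auto
qed

section \<open>Lifts of circle homeomorphisms with a commutator of rotation number one\<close>

text \<open>A piecewise linear lift of a circle homeomorphism with slopes \<open>3\<close> and \<open>1/3\<close>: modulo one it has the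
  repelling fixed point \<open>0\<close> and the attracting fixed point \<open>1/2\<close>. Together with its conjugate by a quarter
  turn, whose fixed points are interlaced with these, it behaves like the holonomy of a once punctured
  torus with a hyperbolic structure.\<close>

definition stretch :: "real \<Rightarrow> real" where
  "stretch s = (let u = frac s in of_int \<lfloor>s\<rfloor> +
     (if u \<le> 1/8 then 3 * u else if u \<le> 7/8 then 3/8 + (u - 1/8) / 3 else 5/8 + 3 * (u - 7/8)))"

definition unstretch :: "real \<Rightarrow> real" where
  "unstretch s = (let u = frac s in of_int \<lfloor>s\<rfloor> +
     (if u \<le> 3/8 then u / 3 else if u \<le> 5/8 then 1/8 + 3 * (u - 3/8) else 7/8 + (u - 5/8) / 3))"

lemma stretch_of_int_add:
  assumes "0 \<le> u" "u < 1"
  shows "stretch (of_int n + u) = of_int n + (if u \<le> 1/8 then 3 * u else if u \<le> 7/8 then 3/8 + (u - 1/8) / 3 else 5/8 + 3 * (u - 7/8))"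
proof -
  have "\<lfloor>of_int n + u\<rfloor> = n" "frac (of_int n + u) = u"
    using assms by (auto simp: frac_unique_iff floor_unique)
  then show ?thesis by (simp add: stretch_def)
qed

lemma unstretch_of_int_add:
  assumes "0 \<le> u" "u < 1"
  shows "unstretch (of_int n + u) = of_int n + (if u \<le> 3/8 then u / 3 else if u \<le> 5/8 then 1/8 + 3 * (u - 3/8) else 7/8 + (u - 5/8) / 3)"
proof -
  have "\<lfloor>of_int n + u\<rfloor> = n" "frac (of_int n + u) = u"
    using assms by (auto simp: frac_unique_iff floor_unique)
  then show ?thesis by (simp add: unstretch_def)
qed

lemma int_frac_cases:
  obtains n u where "s = of_int n + u" "0 \<le> u" "u < (1::real)"
  by (rule that[of "\<lfloor>s\<rfloor>" "frac s"]) (simp_all add: frac_lt_1, simp add: frac_def)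

lemma unstretch_stretch: "unstretch (stretch s) = s"
proof -
  obtain n u where s: "s = of_int n + u" "0 \<le> u" "u < 1" by (rule int_frac_cases)
  let ?v = "if u \<le> 1/8 then 3 * u else if u \<le> 7/8 then 3/8 + (u - 1/8) / 3 else 5/8 + 3 * (u - 7/8)"
  have "0 \<le> ?v" "?v < 1" using s(2,3) by (auto simp: field_simps)
  then show ?thesis
    using s(2,3) unfolding s(1) stretch_of_int_add[OF s(2,3)]
    by (subst unstretch_of_int_add) (auto simp: field_simps)
qed

lemma stretch_unstretch: "stretch (unstretch s) = s"
proof -
  obtain n u where s: "s = of_int n + u" "0 \<le> u" "u < 1" by (rule int_frac_cases)
  let ?v = "if u \<le> 3/8 then u / 3 else if u \<le> 5/8 then 1/8 + 3 * (u - 3/8) else 7/8 + (u - 5/8) / 3"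
  have "0 \<le> ?v" "?v < 1" using s(2,3) by (auto simp: field_simps)
  then show ?thesis
    using s(2,3) unfolding s(1) unstretch_of_int_add[OF s(2,3)]
    by (subst stretch_of_int_add) (auto simp: field_simps)
qed

lemma stretch_add_1: "stretch (s + 1) = stretch s + 1"
  by (simp add: stretch_def Let_def frac_def)

lemma stretch_strict_mono: "s < t \<Longrightarrow> stretch s < stretch t"
proof -
  assume "s < t"
  obtain n u where s: "s = of_int n + u" "0 \<le> u" "u < 1" by (rule int_frac_cases)
  obtain m v where t: "t = of_int m + v" "0 \<le> v" "v < 1" by (rule int_frac_cases)
  have "n < m \<or> n = m \<and> u < v"
  proof (rule ccontr)
    assume "\<not> ?thesis"
    then have "n > m \<or> n = m \<and> u \<ge> v" by auto
    then have "of_int n \<ge> of_int m + (1::real) \<or> n = m \<and> u \<ge> v"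
      by (metis int_less_real_le of_int_1 of_int_add)
    then show False using s t \<open>s < t\<close> by auto
  qed
  moreover have "stretch s < of_int n + 1" "stretch t \<ge> of_int m"
    unfolding s(1) t(1) stretch_of_int_add[OF s(2,3)] stretch_of_int_add[OF t(2,3)]
    using s(2,3) t(2,3) by (auto simp: field_simps)
  ultimately show ?thesis
  proof (elim disjE)
    assume "n < m"
    then have "of_int n + (1::real) \<le> of_int m" by (metis int_less_real_le)
    then show ?thesis using \<open>stretch s < of_int n + 1\<close> \<open>stretch t \<ge> of_int m\<close> by linarith
  next
    assume "n = m \<and> u < v"
    then show ?thesis
      unfolding s(1) t(1) stretch_of_int_add[OF s(2,3)] stretch_of_int_add[OF t(2,3)]
      using s(2,3) t(2,3) by (auto simp: field_simps)
  qed
qed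

text \<open>The increasing homeomorphisms of the line that commute with the translation by \<open>1\<close>,
  that is, the lifts of the orientation preserving homeomorphisms of the circle.\<close>

definition circle_lift :: "(real \<Rightarrow> real) \<Rightarrow> bool" where
  "circle_lift f \<longleftrightarrow> strict_mono f \<and> (\<forall>s. f (s + 1) = f s + 1)"

lemma circle_lift_id [simp]: "circle_lift id"
  by (auto simp: circle_lift_def strict_mono_def)

lemma circle_lift_comp: "circle_lift f \<Longrightarrow> circle_lift g \<Longrightarrow> circle_lift (f \<circ> g)"
  by (auto simp: circle_lift_def strict_mono_def)

lemma circle_lift_inverse:
  assumes f: "circle_lift f" and g: "\<And>s. g (f s) = s" "\<And>s. f (g s) = s"
  shows "circle_lift g"
  unfolding circle_lift_def
proof (intro conjI allI)
  show "strict_mono g"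
    using f g(2) unfolding circle_lift_def strict_mono_def
    by (metis f circle_lift_def strict_mono_less)
  show "g (s + 1) = g s + 1" for s
    using f g unfolding circle_lift_def by metis
qed

lemma circle_lift_stretch: "circle_lift stretch"
  unfolding circle_lift_def strict_mono_def
  using stretch_strict_mono stretch_add_1 by auto

lemma circle_lift_unstretch: "circle_lift unstretch"
  using circle_lift_stretch unstretch_stretch stretch_unstretch by (rule circle_lift_inverse)

definition stretch' :: "real \<Rightarrow> real" where
  "stretch' s = stretch (s - 1/4) + 1/4"

definition unstretch' :: "real \<Rightarrow> real" where
  "unstretch' s = unstretch (s - 1/4) + 1/4"

lemma unstretch'_stretch': "unstretch' (stretch' s) = s"
  by (simp add: stretch'_def unstretch'_def unstretch_stretch)

lemma stretch'_unstretch': "stretch' (unstretch' s) = s"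
  by (simp add: stretch'_def unstretch'_def stretch_unstretch)

lemma circle_lift_stretch': "circle_lift stretch'"
  unfolding circle_lift_def strict_mono_def
proof (intro conjI allI impI)
  show "stretch' (s + 1) = stretch' s + 1" for s
    using stretch_add_1[of "s - 1/4"] by (simp add: stretch'_def add_diff_eq diff_add_eq)
qed (simp add: stretch'_def stretch_strict_mono)

lemma circle_lift_unstretch': "circle_lift unstretch'"
  using circle_lift_stretch' unstretch'_stretch' stretch'_unstretch' by (rule circle_lift_inverse)

definition stretch_commutator :: "real \<Rightarrow> real" where
  "stretch_commutator = unstretch' \<circ> unstretch \<circ> stretch' \<circ> stretch"

lemma circle_lift_stretch_commutator: "circle_lift stretch_commutator"
  unfolding stretch_commutator_def
  by (intro circle_lift_comp circle_lift_unstretch circle_lift_unstretch' circle_lift_stretch circle_lift_stretch')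

lemma stretch_commutator_value: "stretch_commutator (1/8) = 9/8"
proof -
  have "stretch (1/8) = 3/8" using stretch_of_int_add[of "1/8" 0] by simp
  moreover have "unstretch (5/8) = 7/8" using unstretch_of_int_add[of "5/8" 0] by simp
  moreover have "3/8 - 1/4 = (1/8::real)" "3/8 + 1/4 = (5/8::real)" "7/8 - 1/4 = (5/8::real)" by simp_all
  moreover have "7/8 + 1/4 = (9/8::real)" by simp
  ultimately show ?thesis
    unfolding stretch_commutator_def comp_def stretch'_def unstretch'_def
    by (simp only:)
qed

lemma circle_lift_add_nat: "circle_lift f \<Longrightarrow> f (s + of_nat n) = f s + of_nat n"
proof (induction n)
  case (Suc n)
  then show ?case
    unfolding circle_lift_def by (metis add.assoc add.commute of_nat_Suc)
qed simp

text \<open>The orbit of \<open>1/8\<close> advances by exactly one in each step, and the orbit of \<open>0\<close> cannot fall behind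
  that of \<open>1/8 - 1\<close>.\<close>

lemma stretch_commutator_power: "(stretch_commutator ^^ n) 0 \<ge> real n - 1"
proof -
  have "(stretch_commutator ^^ n) (1/8) = 1/8 + real n" for n
  proof (induction n)
    case (Suc n)
    then show ?case
      using circle_lift_add_nat[OF circle_lift_stretch_commutator, of "1/8" n]
      by (simp add: stretch_commutator_value)
  qed simp
  moreover have l: "circle_lift (stretch_commutator ^^ n)" for n
  proof (induction n)
    case 0
    then show ?case using circle_lift_id by (simp add: id_def)
  next
    case (Suc n)
    then show ?case
      using circle_lift_comp[OF circle_lift_stretch_commutator Suc] by (simp add: comp_def)
  qed
  moreover have "(stretch_commutator ^^ n) (1/8) \<le> (stretch_commutator ^^ n) (0 + 1)"
    using l[of n] unfolding circle_lift_def by (simp add: strict_mono_less_eq del: funpow.simps)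
  moreover have "(stretch_commutator ^^ n) (0 + 1) = (stretch_commutator ^^ n) 0 + 1"
    using l[of n] unfolding circle_lift_def by blast
  ultimately show ?thesis by simp
qed

text \<open>The displacement \<open>f s - s\<close> is periodic, and by monotonicity it varies by at most one over a period.\<close>

lemma periodic_mono_defect:
  fixes f :: "real \<Rightarrow> real"
  assumes mono: "\<And>s t. s \<le> t \<Longrightarrow> f s \<le> f t" and f: "\<And>s. f (s + 1) = f s + 1"
  shows "\<bar>f s - s - f 0\<bar> \<le> 1"
proof -
  obtain n u where s: "s = of_int n + u" "0 \<le> u" "u < (1::real)" by (rule int_frac_cases)
  have nat: "f (t + of_nat k) = f t + of_nat k" for t k
    by (induction k) (simp_all add: f flip: add.assoc, metis add.assoc add.commute f)
  have Z: "f (t + of_int n) = f t + of_int n" for t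
  proof (cases "n \<ge> 0")
    case True
    then show ?thesis using nat[of t "nat n"] by simp
  next
    case False
    then show ?thesis using nat[of "t + of_int n" "nat (- n)"] by simp
  qed
  have "f 0 \<le> f u" "f u \<le> f (0 + 1)"
    using mono s by auto
  moreover have "f (0 + 1) = f 0 + 1"
    by (rule f)
  moreover have "f s = f u + of_int n" using Z[of u] s by (simp add: add.commute)
  ultimately show ?thesis using s by auto
qed

section \<open>Parallel transport along paths in a wedge of two circles\<close>

text \<open>The wedge is placed in the plane with common point \<open>0\<close>. The bundle is glued from trivial pieces; the
  points \<open>2\<close> and \<open>-2\<close> opposite to the common point are where the trivialisations differ by the
  holonomy.\<close>

definition two_circles :: "complex set" where
  "two_circles = sphere 1 1 \<union> sphere (-1) 1"

definition local_transport :: "complex \<Rightarrow> complex \<Rightarrow> real \<Rightarrow> real" where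
  "local_transport w w' =
    (if Re w > 1 \<and> Re w' > 1 then
       (if Im w < 0 \<and> Im w' \<ge> 0 then stretch else if Im w \<ge> 0 \<and> Im w' < 0 then unstretch else id)
     else if Re w < -1 \<and> Re w' < -1 then
       (if Im w \<ge> 0 \<and> Im w' < 0 then stretch' else if Im w < 0 \<and> Im w' \<ge> 0 then unstretch' else id)
     else id)"

lemma circle_lift_local_transport: "circle_lift (local_transport w w')"
  by (simp add: local_transport_def circle_lift_unstretch circle_lift_unstretch' circle_lift_stretch circle_lift_stretch')

lemma local_transport_self [simp]: "local_transport w w = id"
  by (auto simp: local_transport_def)

text \<open>Close to the common point of the circles the fibres are identified by the identity; the holonomy
  is picked up only when the real axis is crossed at \<open>2\<close> or at \<open>-2\<close>.\<close>

lemma local_transport_middle: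
  assumes "w \<in> two_circles" "w' \<in> two_circles" "dist w w' < 1/2" "\<bar>Re w\<bar> \<le> 3/2" "\<bar>Re w'\<bar> \<le> 3/2"
  shows "local_transport w w' = id"
proof -
  have im: "(Im z)^2 \<ge> 3/4" if "z \<in> two_circles" "\<bar>Re z\<bar> \<le> 3/2" "\<bar>Re z\<bar> > 1" for z
  proof -
    have "(Re z - 1)^2 + (Im z)^2 = 1 \<or> (Re z + 1)^2 + (Im z)^2 = 1"
      using that(1) by (auto simp: two_circles_def dist_norm cmod_def power2_commute algebra_simps)
    then have "(\<bar>Re z\<bar> - 1)^2 + (Im z)^2 = 1 \<or> (\<bar>Re z\<bar> + 1)^2 + (Im z)^2 = 1"
      by (cases "Re z \<ge> 0") (auto simp: power2_eq_square algebra_simps)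
    moreover have "(\<bar>Re z\<bar> - 1)^2 \<le> (1/2)^2"
      using that by (intro power_mono) auto
    moreover have "(\<bar>Re z\<bar> + 1)^2 \<ge> (2::real)^2"
      using that by (intro power_mono) auto
    moreover have "(Im z)^2 \<ge> 0" by simp
    moreover have "(1/2)^2 = (1/4::real)" "(2::real)^2 = 4" by (simp_all add: power2_eq_square)
    ultimately show ?thesis by linarith
  qed
  have "\<bar>Im w - Im w'\<bar> < 1/2"
    using assms(3) abs_Im_le_cmod[of "w - w'"] by (simp add: dist_norm)
  then have *: False if "(Im w)^2 \<ge> 3/4" "(Im w')^2 \<ge> 3/4" "Im w < 0 \<and> Im w' \<ge> 0 \<or> Im w \<ge> 0 \<and> Im w' < 0"
  proof -
    have "\<bar>Im z\<bar> > 1/2" if "(Im z)^2 \<ge> 3/4" for z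
    proof (rule ccontr)
      assume "\<not> ?thesis"
      then have "\<bar>Im z\<bar>^2 \<le> (1/2)^2" by (intro power_mono) auto
      then show False using that by (simp add: power2_eq_square)
    qed
    then show False using that \<open>\<bar>Im w - Im w'\<bar> < 1/2\<close> by fastforce
  qed
  show ?thesis
    using im[OF assms(1)] im[OF assms(2)] assms(4,5) *
    by (auto simp: local_transport_def)
qed

text \<open>The radius \<open>1/2\<close> is small enough for three nearby points to lie in a common trivial piece.\<close>

lemma local_transport_trans:
  assumes "u \<in> two_circles" "v \<in> two_circles" "w \<in> two_circles"
    and "dist u v < 1/2" "dist v w < 1/2" "dist u w < 1/2"
  shows "local_transport v w (local_transport u v s) = local_transport u w s"
proof -
  have re: "\<bar>Re u - Re v\<bar> < 1/2" "\<bar>Re v - Re w\<bar> < 1/2" "\<bar>Re u - Re w\<bar> < 1/2"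
    using assms abs_Re_le_cmod[of "u - v"] abs_Re_le_cmod[of "v - w"] abs_Re_le_cmod[of "u - w"]
    by (simp_all add: dist_norm)
  consider "Re u > 1 \<and> Re v > 1 \<and> Re w > 1" | "Re u < -1 \<and> Re v < -1 \<and> Re w < -1"
    | "\<bar>Re u\<bar> \<le> 3/2 \<and> \<bar>Re v\<bar> \<le> 3/2 \<and> \<bar>Re w\<bar> \<le> 3/2"
    using re by argo
  then show ?thesis
  proof cases
    case 1
    then show ?thesis by (auto simp: local_transport_def unstretch_stretch stretch_unstretch unstretch'_stretch' stretch'_unstretch')
  next
    case 2
    then show ?thesis by (auto simp: local_transport_def unstretch_stretch stretch_unstretch unstretch'_stretch' stretch'_unstretch')
  next
    case 3
    then show ?thesis using local_transport_middle assms by (simp add: id_def)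
  qed
qed

text \<open>These are the flat sections over a map \<open>f\<close> into the wedge, that is, the lifts of \<open>f\<close> to the covering
  space whose fibre is the real line with the discrete topology.\<close>

definition parallel :: "'a::metric_space set \<Rightarrow> ('a \<Rightarrow> complex) \<Rightarrow> ('a \<Rightarrow> real) \<Rightarrow> bool" where
  "parallel K f s \<longleftrightarrow> (\<forall>x\<in>K. \<exists>d>0. \<forall>y\<in>K. dist x y < d \<longrightarrow> s y = local_transport (f x) (f y) (s x))"

lemma parallel_compose:
  assumes s: "parallel K f s" and h: "continuous_on L h" "h \<in> L \<rightarrow> K"
  shows "parallel L (f \<circ> h) (s \<circ> h)"
  unfolding parallel_def
proof
  fix x assume x: "x \<in> L"
  then obtain d where d: "d > 0" "\<forall>y\<in>K. dist (h x) y < d \<longrightarrow> s y = local_transport (f (h x)) (f y) (s (h x))"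
    using s h(2) unfolding parallel_def by blast
  obtain e where "e > 0" "\<forall>y\<in>L. dist y x < e \<longrightarrow> dist (h y) (h x) < d"
    using h(1) x d(1) unfolding continuous_on_iff by blast
  then show "\<exists>d>0. \<forall>y\<in>L. dist x y < d \<longrightarrow> (s \<circ> h) y = local_transport ((f \<circ> h) x) ((f \<circ> h) y) ((s \<circ> h) x)"
    using d h(2) by (intro exI[of _ e]) (auto simp: dist_commute Pi_iff)
qed

text \<open>Local transport is strictly increasing, so the set of points where one section lies below another is
  open and closed. Uniqueness of sections is the antisymmetric case.\<close>

lemma parallel_le:
  assumes s: "parallel K f s" "parallel K f s'" and K: "connected K" "v \<in> K" "w \<in> K" and le: "s v \<le> s' v"
  shows "s w \<le> s' w"
proof -
  let ?L = "{x \<in> K. s x \<le> s' x}"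
  have near: "\<exists>d>0. \<forall>y\<in>K. dist x y < d \<longrightarrow> (s y \<le> s' y \<longleftrightarrow> s x \<le> s' x)" if x: "x \<in> K" for x
  proof -
    obtain d where d: "d > 0" "\<forall>y\<in>K. dist x y < d \<longrightarrow> s y = local_transport (f x) (f y) (s x)"
      using s(1) x unfolding parallel_def by blast
    obtain d' where d': "d' > 0" "\<forall>y\<in>K. dist x y < d' \<longrightarrow> s' y = local_transport (f x) (f y) (s' x)"
      using s(2) x unfolding parallel_def by blast
    show ?thesis
      using d d' circle_lift_local_transport[unfolded circle_lift_def]
      by (intro exI[of _ "min d d'"]) (simp add: strict_mono_less_eq)
  qed
  have "openin (top_of_set K) ?L"
    unfolding openin_euclidean_subtopology_iff
  proof (intro conjI ballI)
    fix x assume x: "x \<in> ?L"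
    then obtain d where "d > 0" "\<forall>y\<in>K. dist x y < d \<longrightarrow> (s y \<le> s' y \<longleftrightarrow> s x \<le> s' x)"
      using near by blast
    then show "\<exists>e>0. \<forall>y\<in>K. dist y x < e \<longrightarrow> y \<in> ?L"
      using x unfolding dist_commute[of x] by blast
  qed blast
  moreover have "openin (top_of_set K) (K - ?L)"
    unfolding openin_euclidean_subtopology_iff
  proof (intro conjI ballI)
    fix x assume x: "x \<in> K - ?L"
    then obtain d where "d > 0" "\<forall>y\<in>K. dist x y < d \<longrightarrow> (s y \<le> s' y \<longleftrightarrow> s x \<le> s' x)"
      using near by blast
    then show "\<exists>e>0. \<forall>y\<in>K. dist y x < e \<longrightarrow> y \<in> K - ?L"
      using x unfolding dist_commute[of x] by blast
  qed blast
  then have "closedin (top_of_set K) ?L"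
    by (auto simp: closedin_def)
  ultimately have "?L = {} \<or> ?L = K" using K(1) unfolding connected_clopen by blast
  then show ?thesis using K le by blast
qed

lemma parallel_unique:
  assumes "parallel K f s" "parallel K f s'" "connected K" "v \<in> K" "w \<in> K" "s v = s' v"
  shows "s w = s' w"
  using parallel_le[of K f s s' v w] parallel_le[of K f s' s v w] assms by simp

text \<open>Over a compact convex set the parallel sections are constructed along segments from one
  point; the number of steps can be chosen uniformly.\<close>

lemma parallel_exists:
  fixes K :: "'a::real_normed_vector set"
  assumes K: "compact K" "convex K" "v \<in> K" and f: "continuous_on K f" "f \<in> K \<rightarrow> two_circles"
  obtains s where "parallel K f s" "s v = s0"
proof -
  obtain d where d: "d > 0" "\<And>x y. x \<in> K \<Longrightarrow> y \<in> K \<Longrightarrow> dist x y < d \<Longrightarrow> dist (f x) (f y) < 1/2"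
    using compact_uniformly_continuous[OF f(1) K(1)] unfolding uniformly_continuous_on_def
    by (metis dist_commute half_gt_zero zero_less_one)
  obtain B where B: "\<And>x. x \<in> K \<Longrightarrow> dist v x \<le> B"
    using compact_imp_bounded[OF K(1)] bounded_any_center[of K v] by blast
  \<comment> \<open>with \<open>N\<close> steps every segment from \<open>v\<close> is cut into pieces of length less than \<open>d / 2\<close>\<close>
  obtain N where N: "of_nat N > max 1 (2 * B / d)" using reals_Archimedean2 by blast
  then have N0: "N > 0" by (cases N) auto
  have BN: "B / N < d / 2" using N d(1) N0 by (simp add: field_simps)
  define pt where "pt i x = v + (real i / N) *\<^sub>R (x - v)" for i and x :: 'a
  have ptK: "pt i x \<in> K" if "i \<le> N" "x \<in> K" for i x
  proof -
    have "pt i x = (1 - real i / N) *\<^sub>R v + (real i / N) *\<^sub>R x"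
      by (simp add: pt_def algebra_simps)
    then show ?thesis using K(2,3) that N0 unfolding convex_alt by simp
  qed
  have step: "dist (pt i x) (pt (Suc i) x) < d / 2" if "x \<in> K" for i x
  proof -
    have "pt (Suc i) x - pt i x = (1 / N) *\<^sub>R (x - v)"
      by (simp add: pt_def add_divide_distrib algebra_simps)
    then have "dist (pt i x) (pt (Suc i) x) = dist v x / N"
      by (simp add: dist_norm norm_minus_commute[of "pt i x"] norm_minus_commute[of v])
    also have "\<dots> \<le> B / N" using B[OF that] by (simp add: divide_right_mono)
    finally show ?thesis using BN by (rule le_less_trans)
  qed
  have close: "dist (pt i x) (pt i y) \<le> dist x y" if "i \<le> N" for i x y
  proof -
    have "pt i x - pt i y = (real i / N) *\<^sub>R (x - y)"
      by (simp add: pt_def algebra_simps)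
    then have "dist (pt i x) (pt i y) = (real i / N) * dist x y" by (simp add: dist_norm)
    also have "\<dots> \<le> 1 * dist x y" using that N0 by (intro mult_right_mono) auto
    finally show ?thesis by simp
  qed
  define S where "S = rec_nat (\<lambda>x. s0) (\<lambda>i r x. local_transport (f (pt i x)) (f (pt (Suc i) x)) (r x))"
  have S0: "S 0 x = s0" and SS: "S (Suc i) x = local_transport (f (pt i x)) (f (pt (Suc i) x)) (S i x)" for i x
    by (simp_all add: S_def)
  \<comment> \<open>on each small quadrilateral between two neighbouring segments the transport along two adjacent sides
    agrees with the transport along the diagonal\<close>
  have loc: "S i y = local_transport (f (pt i x)) (f (pt i y)) (S i x)"
    if "i \<le> N" "x \<in> K" "y \<in> K" "dist x y < d / 2" for i x y
    using that(1)
  proof (induction i)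
    case 0
    then show ?case by (simp add: S0 pt_def)
  next
    case (Suc i)
    let ?a = "pt i x" and ?b = "pt (Suc i) x" and ?a' = "pt i y" and ?b' = "pt (Suc i) y"
    have inK: "?a \<in> K" "?b \<in> K" "?a' \<in> K" "?b' \<in> K" using ptK Suc.prems that by auto
    have di: "dist ?a ?b < d / 2" "dist ?a' ?b' < d / 2" "dist ?a ?a' < d / 2" "dist ?b ?b' < d / 2"
      using step[OF that(2), of i] step[OF that(3), of i] close[of i x y] close[of "Suc i" x y] Suc.prems that(4) by auto
    then have ab': "dist ?a ?b' < d"
      using dist_triangle[of ?a ?b' ?b] by linarith
    have dd: "dist (f p) (f q) < 1/2" if "p \<in> K" "q \<in> K" "dist p q < d / 2" for p q
      using d that by auto
    have fW: "f p \<in> two_circles" if "p \<in> K" for p using f(2) that by auto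
    have "S (Suc i) y = local_transport (f ?a') (f ?b') (local_transport (f ?a) (f ?a') (S i x))"
      using Suc by (simp add: SS)
    also have "\<dots> = local_transport (f ?a) (f ?b') (S i x)"
      using inK di ab' by (intro local_transport_trans fW dd d(2)) auto
    also have "\<dots> = local_transport (f ?b) (f ?b') (local_transport (f ?a) (f ?b) (S i x))"
      using inK di ab' by (intro local_transport_trans[symmetric] fW dd d(2)) auto
    finally show ?case by (simp add: SS)
  qed
  have ptN: "pt N x = x" for x using N0 by (simp add: pt_def)
  have "parallel K f (S N)"
    unfolding parallel_def
  proof
    fix x assume x: "x \<in> K"
    have "S N y = local_transport (f x) (f y) (S N x)" if "y \<in> K" "dist x y < d / 2" for y
      using loc[OF order_refl x that] unfolding ptN .
    moreover have "d / 2 > 0" using d(1) by simp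
    ultimately show "\<exists>d>0. \<forall>y\<in>K. dist x y < d \<longrightarrow> S N y = local_transport (f x) (f y) (S N x)"
      by blast
  qed
  moreover have "S i v = s0" for i
    by (induction i) (simp_all add: S0 SS pt_def)
  ultimately show thesis using that by blast
qed

text \<open>By the uniqueness of flat sections, this map from the fibre at the start of a path to the fibre at its end
  is well defined.\<close>

definition transport :: "(real \<Rightarrow> complex) \<Rightarrow> real \<Rightarrow> real" where
  "transport p s0 = (THE s1. \<exists>s. parallel {0..1} p s \<and> s 0 = s0 \<and> s 1 = s1)"

lemma transport_eqI:
  assumes s: "parallel {0..1} p s" and "s 0 = s0"
  shows "transport p s0 = s 1"
  unfolding transport_def
proof (rule the_equality)
  show "\<exists>s'. parallel {0..1} p s' \<and> s' 0 = s0 \<and> s' 1 = s 1"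
    using assms by blast
next
  fix s1 assume "\<exists>s'. parallel {0..1} p s' \<and> s' 0 = s0 \<and> s' 1 = s1"
  then obtain s' where s': "parallel {0..1} p s'" "s' 0 = s0" "s' 1 = s1" by blast
  have "s' 1 = s 1"
    by (rule parallel_unique[OF s'(1) s(1) connected_Icc, of 0]) (use s' assms in auto)
  then show "s1 = s 1" using s' by simp
qed

definition circles_path :: "(real \<Rightarrow> complex) \<Rightarrow> bool" where
  "circles_path p \<longleftrightarrow> continuous_on {0..1} p \<and> p \<in> {0..1} \<rightarrow> two_circles"

lemma transportE:
  assumes "circles_path p"
  obtains s where "parallel {0..1} p s" "s 0 = s0" "s 1 = transport p s0"
proof -
  obtain s where "parallel {0..1} p s" "s 0 = s0"
    using parallel_exists[of "{0..1::real}" 0 p s0] assms by (auto simp: circles_path_def)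
  then show thesis using that transport_eqI by metis
qed

lemma transport_mono:
  assumes "circles_path p" "s0 \<le> s1"
  shows "transport p s0 \<le> transport p s1"
proof -
  obtain s where s: "parallel {0..1} p s" "s 0 = s0" "s 1 = transport p s0"
    using assms(1) by (rule transportE)
  obtain s' where s': "parallel {0..1} p s'" "s' 0 = s1" "s' 1 = transport p s1"
    using assms(1) by (rule transportE)
  have "s 1 \<le> s' 1"
    by (rule parallel_le[OF s(1) s'(1) connected_Icc, of 0]) (use s s' assms in auto)
  then show ?thesis using s s' by simp
qed

lemma transport_add_1:
  assumes "circles_path p"
  shows "transport p (s0 + 1) = transport p s0 + 1"
proof -
  obtain s where s: "parallel {0..1} p s" "s 0 = s0" "s 1 = transport p s0"
    using assms(1) by (rule transportE)
  have "local_transport w w' (t + 1) = local_transport w w' t + 1" for w w' t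
    using circle_lift_local_transport unfolding circle_lift_def by blast
  then have "parallel {0..1} p (\<lambda>t. s t + 1)"
    using s(1) unfolding parallel_def by metis
  from transport_eqI[OF this refl] show ?thesis using s by simp
qed

lemma transport_defect:
  assumes "circles_path p"
  shows "\<bar>transport p s - s - transport p 0\<bar> \<le> 1"
  using transport_mono[OF assms] transport_add_1[OF assms] by (rule periodic_mono_defect)

lemma join_loops_first: "t \<in> {0..1} \<Longrightarrow> join_loops p q (t / 2) = p t"
  by (simp add: join_loops_def)

lemma join_loops_second: "t \<in> {0..1} \<Longrightarrow> p 1 = q 0 \<Longrightarrow> join_loops p q (1/2 + t / 2) = q t"
  by (auto simp: join_loops_def)

lemma parallel_cong:
  assumes "parallel K f s" "\<And>x. x \<in> K \<Longrightarrow> f x = g x"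
  shows "parallel K g s"
  using assms unfolding parallel_def by metis

lemma transport_join_loops:
  assumes pq: "circles_path (join_loops p q)" and "p 1 = q 0"
  shows "transport (join_loops p q) s0 = transport q (transport p s0)"
proof -
  obtain s where s: "parallel {0..1} (join_loops p q) s" "s 0 = s0" "s 1 = transport (join_loops p q) s0"
    using pq by (rule transportE)
  have "parallel {0..1} (join_loops p q \<circ> (\<lambda>t. t / 2)) (s \<circ> (\<lambda>t. t / 2))"
    by (rule parallel_compose[OF s(1)]) (auto intro!: continuous_intros)
  then have "parallel {0..1} p (s \<circ> (\<lambda>t. t / 2))"
    by (rule parallel_cong) (simp add: join_loops_first)
  from transport_eqI[OF this refl] have 1: "transport p s0 = s (1/2)" using s by simp
  have "parallel {0..1} (join_loops p q \<circ> (\<lambda>t. 1/2 + t / 2)) (s \<circ> (\<lambda>t. 1/2 + t / 2))"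
    by (rule parallel_compose[OF s(1)]) (auto intro!: continuous_intros)
  then have "parallel {0..1} q (s \<circ> (\<lambda>t. 1/2 + t / 2))"
    by (rule parallel_cong) (simp add: join_loops_second assms)
  from transport_eqI[OF this refl] have 2: "transport q (s (1/2)) = s 1" by simp
  show ?thesis using 1 2 s by simp
qed

lemma transport_reverse:
  assumes p: "circles_path p"
  shows "transport (\<lambda>t. p (1 - t)) (transport p s0) = s0"
proof -
  obtain s where s: "parallel {0..1} p s" "s 0 = s0" "s 1 = transport p s0"
    using p by (rule transportE)
  have "parallel {0..1} (p \<circ> (\<lambda>t. 1 - t)) (s \<circ> (\<lambda>t. 1 - t))"
    by (rule parallel_compose[OF s(1)]) (auto intro!: continuous_intros)
  then have "parallel {0..1} (\<lambda>t. p (1 - t)) (s \<circ> (\<lambda>t. 1 - t))"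
    by (simp add: comp_def)
  from transport_eqI[OF this refl] show ?thesis using s by simp
qed

lemma transport_const: "transport (\<lambda>t. w) s0 = s0"
proof -
  have "parallel {0..1} (\<lambda>t. w) (\<lambda>t. s0)"
    unfolding parallel_def by (auto intro: exI[of _ 1])
  from transport_eqI[OF this refl] show ?thesis .
qed

lemma transport_cong:
  assumes "\<And>t. t \<in> {0..1} \<Longrightarrow> p t = q t"
  shows "transport p = transport q"
proof -
  have "parallel {0..1} p s = parallel {0..1} q s" for s
    using parallel_cong[of "{0..1}" p s q] parallel_cong[of "{0..1}" q s p] assms by auto
  then show ?thesis by (simp add: transport_def fun_eq_iff)
qed

text \<open>A parallel section over a triangle restricts to parallel sections over its sides, so that the
  holonomy around the boundary of a singular triangle is trivial.\<close>

definition std_triangle :: "(real \<times> real) set" where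
  "std_triangle = {(x, y). 0 \<le> y \<and> y \<le> x \<and> x \<le> 1}"

lemma convex_triangle: "convex std_triangle"
proof -
  have eq: "std_triangle = {z. inner z (0, 1) \<ge> 0} \<inter> {z. inner z (1, -1) \<ge> 0} \<inter> {z. inner z (1, 0) \<le> 1}"
    by (auto simp: std_triangle_def inner_prod_def)
  have "convex {z. inner z a \<ge> b}" "convex {z. inner z a \<le> b}" for a :: "real \<times> real" and b
    using convex_halfspace_ge[of b a] convex_halfspace_le[of a b] by (simp_all add: inner_commute)
  then show ?thesis unfolding eq by (intro convex_Int)
qed

lemma compact_triangle: "compact std_triangle"
proof -
  have eq: "std_triangle = ({0..1} \<times> {0..1}) \<inter> {z. snd z \<le> fst z}"
    by (auto simp: std_triangle_def)
  show ?thesis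
    unfolding eq
    by (intro compact_Int_closed compact_Times compact_Icc closed_Collect_le continuous_intros)
qed

lemma transport_triangle:
  assumes "continuous_on std_triangle G" "G \<in> std_triangle \<rightarrow> two_circles"
  shows "transport (\<lambda>t. G (t, t)) s0 = transport (\<lambda>t. G (1, t)) (transport (\<lambda>t. G (t, 0)) s0)"
proof -
  obtain s where s: "parallel std_triangle G s" "s (0, 0) = s0"
    using parallel_exists[OF compact_triangle convex_triangle _ assms, of "(0, 0)" s0]
    by (auto simp: std_triangle_def)
  have side: "transport (\<lambda>t. G (h t)) (s (h 0)) = s (h 1)"
    if "continuous_on {0..1} h" "h \<in> {0..1} \<rightarrow> std_triangle" for h
  proof -
    have "parallel {0..1} (\<lambda>t. G (h t)) (\<lambda>t. s (h t))"
      using parallel_compose[OF s(1) that] by (simp add: comp_def)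
    from transport_eqI[OF this refl] show ?thesis .
  qed
  have "transport (\<lambda>t. G (t, t)) (s (0, 0)) = s (1, 1)"
    by (rule side) (auto simp: std_triangle_def intro!: continuous_intros)
  moreover have "transport (\<lambda>t. G (t, 0)) (s (0, 0)) = s (1, 0)"
    by (rule side) (auto simp: std_triangle_def intro!: continuous_intros)
  moreover have "transport (\<lambda>t. G (1, t)) (s (1, 0)) = s (1, 1)"
    by (rule side) (auto simp: std_triangle_def intro!: continuous_intros)
  ultimately show ?thesis using s(2) by simp
qed

lemma stretch_fixed [simp]: "stretch 0 = 0" "unstretch 0 = 0"
  using stretch_of_int_add[of 0 0] unstretch_of_int_add[of 0 0] by simp_all

lemma stretch'_fixed [simp]: "stretch' (1/4) = 1/4" "unstretch' (1/4) = 1/4"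
  by (simp_all add: stretch'_def unstretch'_def)

text \<open>A fixed point of the holonomy of a circle gives a constant section over all paths in that circle.\<close>

lemma transport_first_circle:
  assumes "p \<in> {0..1} \<rightarrow> sphere 1 1"
  shows "transport p 0 = 0"
proof -
  have re: "Re w \<ge> 0" if "w \<in> sphere 1 1" for w
    using that abs_Re_le_cmod[of "1 - w"] by (simp add: dist_norm)
  have "local_transport (p x) (p y) 0 = 0" if "x \<in> {0..1}" "y \<in> {0..1}" for x y
    using re[of "p x"] re[of "p y"] assms that by (auto simp: local_transport_def Pi_iff)
  then have "parallel {0..1} p (\<lambda>t. 0)"
    unfolding parallel_def by (auto intro!: exI[of _ 1])
  from transport_eqI[OF this refl] show ?thesis .
qed

lemma transport_second_circle:
  assumes "circles_path p" "p \<in> {0..1} \<rightarrow> sphere (-1) 1"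
  shows "\<bar>transport p 0\<bar> \<le> 1"
proof -
  have re: "Re w \<le> 0" if "w \<in> sphere (-1) 1" for w
    using that abs_Re_le_cmod[of "-1 - w"] by (simp add: dist_norm)
  have "local_transport (p x) (p y) (1/4) = 1/4" if "x \<in> {0..1}" "y \<in> {0..1}" for x y
    using re[of "p x"] re[of "p y"] assms(2) that by (auto simp: local_transport_def Pi_iff)
  \<comment> \<open>the transport of \<open>0\<close> is squeezed between those of the fixed points \<open>-3/4\<close> and \<open>1/4\<close>\<close>
  then have "parallel {0..1} p (\<lambda>t. 1/4)"
    unfolding parallel_def by (auto intro!: exI[of _ 1])
  from transport_eqI[OF this refl] have "transport p (1/4) = 1/4" .
  then show ?thesis using transport_defect[OF assms(1), of "1/4"]
      transport_mono[OF assms(1), of 0 "1/4"] transport_mono[OF assms(1), of "-3/4" 0]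
      transport_add_1[OF assms(1), of "-3/4"] by simp
qed

definition circle_loop :: "real \<Rightarrow> complex" where
  "circle_loop t = 1 - cis (2 * pi * t)"

lemma circle_loop_region:
  assumes "t \<in> {0..1}"
  shows "Re (circle_loop t) > 1 \<longleftrightarrow> 1/4 < t \<and> t < 3/4"
    and "Im (circle_loop t) < 0 \<longleftrightarrow> 0 < t \<and> t < 1/2"
    and "Im (circle_loop t) = 0 \<longleftrightarrow> t = 0 \<or> t = 1/2 \<or> t = 1"
proof -
  show "Re (circle_loop t) > 1 \<longleftrightarrow> 1/4 < t \<and> t < 3/4"
  proof -
    consider "t \<le> 1/4" | "1/4 < t" "t < 3/4" | "t \<ge> 3/4" by linarith
    then show ?thesis
    proof cases
      case 1
      have "cos (2 * pi * t) \<ge> 0"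
      proof (rule cos_ge_zero)
        show "2 * pi * t \<le> pi / 2" using mult_left_mono[OF 1, of "2 * pi"] pi_ge_zero by linarith
        show "- (pi / 2) \<le> 2 * pi * t"
          by (rule order_trans[of _ 0]) (use assms in auto)
      qed
      then show ?thesis using 1 by (simp add: circle_loop_def)
    next
      case 2
      have "cos (2 * pi * t - pi) > 0"
      proof (rule cos_gt_zero_pi)
        have "2 * pi * (1/4) < 2 * pi * t" "2 * pi * t < 2 * pi * (3/4)"
          using 2 by (intro mult_strict_left_mono; simp)+
        then show "- (pi / 2) < 2 * pi * t - pi" "2 * pi * t - pi < pi / 2"
          by linarith+
      qed
      then show ?thesis using 2 by (simp add: circle_loop_def cos_diff)
    next
      case 3
      have "cos (2 * pi * t - 2 * pi) \<ge> 0"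
      proof (rule cos_ge_zero)
        have "2 * pi * (3/4) \<le> 2 * pi * t" using 3 by (intro mult_left_mono) auto
        then show "- (pi / 2) \<le> 2 * pi * t - 2 * pi" by linarith
        have "2 * pi * t \<le> 2 * pi" using assms by simp
        then show "2 * pi * t - 2 * pi \<le> pi / 2" using pi_gt_zero by linarith
      qed
      then show ?thesis using 3 by (simp add: circle_loop_def cos_diff)
    qed
  qed
  have pos: "sin (2 * pi * t) > 0" if "0 < t" "t < 1/2"
    by (rule sin_gt_zero) (use that in auto)
  have neg: "sin (2 * pi * t) < 0" if "1/2 < t" "t < 1"
    by (rule sin_lt_zero) (use that in auto)
  have zero: "sin (2 * pi * t) = 0" if "t = 0 \<or> t = 1/2 \<or> t = 1"
  proof -
    have "2 * pi * t = 0 \<or> 2 * pi * t = pi \<or> 2 * pi * t = 2 * pi" using that by auto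
    then show ?thesis by (elim disjE; simp only: sin_zero sin_pi sin_two_pi)
  qed
  consider "t = 0 \<or> t = 1/2 \<or> t = 1" | "0 < t" "t < 1/2" | "1/2 < t" "t < 1" using assms by fastforce
  then show "Im (circle_loop t) < 0 \<longleftrightarrow> 0 < t \<and> t < 1/2"
    and "Im (circle_loop t) = 0 \<longleftrightarrow> t = 0 \<or> t = 1/2 \<or> t = 1"
    by (cases; use pos neg zero in \<open>auto simp: circle_loop_def\<close>)+
qed

lemma Re_circle_loop_nonneg: "Re (circle_loop t) \<ge> 0"
  by (simp add: circle_loop_def)

text \<open>The same section describes both loops: it jumps when the loop crosses the real axis at the
  point opposite to the common point.\<close>

lemma local_transport_circle_loop:
  assumes xy: "x \<in> {0..1}" "y \<in> {0..1}" "dist x y < 1/8"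
  shows "local_transport (circle_loop x) (circle_loop y) =
      (if x < 1/2 \<and> y \<ge> 1/2 then stretch else if x \<ge> 1/2 \<and> y < 1/2 then unstretch else id)"
    and "local_transport (- circle_loop x) (- circle_loop y) =
      (if x \<le> 1/2 \<and> y > 1/2 then stretch' else if x > 1/2 \<and> y \<le> 1/2 then unstretch' else id)"
proof -
  let ?p = "circle_loop x" and ?q = "circle_loop y"
  have re: "\<not> Re ?p < - 1" "\<not> Re ?q < - 1" "\<not> - Re ?p > 1" "\<not> - Re ?q > 1"
    using Re_circle_loop_nonneg[of x] Re_circle_loop_nonneg[of y] by linarith+
  note px = circle_loop_region[OF xy(1)] and py = circle_loop_region[OF xy(2)]
  have sgn: "r > 0 \<longleftrightarrow> \<not> r < 0 \<and> r \<noteq> 0" for r :: real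
    by linarith
  have im: "Im ?p > 0 \<longleftrightarrow> 1/2 < x \<and> x < 1" "Im ?q > 0 \<longleftrightarrow> 1/2 < y \<and> y < 1"
    unfolding sgn[of "Im ?p"] sgn[of "Im ?q"] px(2,3) py(2,3) using xy(1,2) by auto
  have d: "\<bar>x - y\<bar> < 1/8" using xy(3) by (simp add: dist_real_def)
  let ?N = "1/4 < x \<and> x < 3/4 \<and> 1/4 < y \<and> y < 3/4"
  have x01: "0 \<le> x" "x \<le> 1" and y01: "0 \<le> y" "y \<le> 1" using xy by auto
  have d': "x - y < 1/8" "y - x < 1/8" using d by linarith+
  have if3: "(if N then if b then f else if c then g else h else h) =
      (if N \<and> b then f else if N \<and> c then g else h)" for N b c and f g h :: "real \<Rightarrow> real"
    by simp
  have "local_transport ?p ?q =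
      (if ?N then if (0 < x \<and> x < 1/2) \<and> \<not> (0 < y \<and> y < 1/2) then stretch
        else if \<not> (0 < x \<and> x < 1/2) \<and> (0 < y \<and> y < 1/2) then unstretch else id else id)"
    unfolding local_transport_def linorder_not_less[symmetric]
    by (simp only: px(1,2) py(1,2) re simp_thms if_False conj_assoc)
  also have "\<dots> = (if x < 1/2 \<and> y \<ge> 1/2 then stretch else if x \<ge> 1/2 \<and> y < 1/2 then unstretch else id)"
  proof -
    have "(?N \<and> (0 < x \<and> x < 1/2) \<and> \<not> (0 < y \<and> y < 1/2)) = (x < 1/2 \<and> y \<ge> 1/2)"
      using d' x01 y01 by argo
    moreover have "(?N \<and> \<not> (0 < x \<and> x < 1/2) \<and> (0 < y \<and> y < 1/2)) = (x \<ge> 1/2 \<and> y < 1/2)"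
      using d' x01 y01 by argo
    ultimately show ?thesis unfolding if3 by (simp only:)
  qed
  finally show "local_transport ?p ?q =
      (if x < 1/2 \<and> y \<ge> 1/2 then stretch else if x \<ge> 1/2 \<and> y < 1/2 then unstretch else id)" .
  have "local_transport (- ?p) (- ?q) =
      (if ?N then if \<not> (1/2 < x \<and> x < 1) \<and> (1/2 < y \<and> y < 1) then stretch'
        else if (1/2 < x \<and> x < 1) \<and> \<not> (1/2 < y \<and> y < 1) then unstretch' else id else id)"
  proof -
    have neg: "(- a < - b) = (b < a)" "(- a < 0) = (0 < a)" "(0 \<le> - a) = (\<not> 0 < a)" for a b :: real
      by linarith+
    show ?thesis
      unfolding local_transport_def minus_complex.sel uminus_complex.sel
      by (simp only: neg px(1) py(1) im re simp_thms if_False conj_assoc)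
  qed
  also have "\<dots> = (if x \<le> 1/2 \<and> y > 1/2 then stretch' else if x > 1/2 \<and> y \<le> 1/2 then unstretch' else id)"
  proof -
    have "(?N \<and> \<not> (1/2 < x \<and> x < 1) \<and> (1/2 < y \<and> y < 1)) = (x \<le> 1/2 \<and> y > 1/2)"
      using d' x01 y01 by argo
    moreover have "(?N \<and> (1/2 < x \<and> x < 1) \<and> \<not> (1/2 < y \<and> y < 1)) = (x > 1/2 \<and> y \<le> 1/2)"
      using d' x01 y01 by argo
    ultimately show ?thesis unfolding if3 by (simp only:)
  qed
  finally show "local_transport (- circle_loop x) (- circle_loop y) =
      (if x \<le> 1/2 \<and> y > 1/2 then stretch' else if x > 1/2 \<and> y \<le> 1/2 then unstretch' else id)" .
qed

lemma transport_circle_loop: "transport circle_loop s0 = stretch s0"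
proof -
  let ?s = "\<lambda>t. if t < 1/2 then s0 else stretch s0"
  have "?s y = local_transport (circle_loop x) (circle_loop y) (?s x)"
    if "x \<in> {0..1}" "y \<in> {0..1}" "dist x y < 1/8" for x y
    unfolding local_transport_circle_loop(1)[OF that] by (simp add: unstretch_stretch)
  then have "parallel {0..1} circle_loop ?s"
    unfolding parallel_def by (intro ballI exI[of _ "1/8"] conjI impI) (simp, blast)
  from transport_eqI[OF this, of s0] show ?thesis by simp
qed

lemma transport_minus_circle_loop: "transport (\<lambda>t. - circle_loop t) s0 = stretch' s0"
proof -
  let ?s = "\<lambda>t. if t \<le> 1/2 then s0 else stretch' s0"
  have "?s y = local_transport (- circle_loop x) (- circle_loop y) (?s x)"
    if "x \<in> {0..1}" "y \<in> {0..1}" "dist x y < 1/8" for x y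
    unfolding local_transport_circle_loop(2)[OF that] by (simp add: unstretch'_stretch')
  then have "parallel {0..1} (\<lambda>t. - circle_loop t) ?s"
    unfolding parallel_def by (intro ballI exI[of _ "1/8"] conjI impI) (simp, blast)
  from transport_eqI[OF this, of s0] show ?thesis by simp
qed

section \<open>The groupoid laws for paths\<close>

abbreviation path_homotopic :: "'a topology \<Rightarrow> 'a \<Rightarrow> 'a \<Rightarrow> (real \<Rightarrow> 'a) \<Rightarrow> (real \<Rightarrow> 'a) \<Rightarrow> bool" where
  "path_homotopic X a b \<equiv> homotopic_with (\<lambda>r. r 0 = a \<and> r 1 = b) (top_of_set {0..1}) X"

definition path_between :: "'a topology \<Rightarrow> 'a \<Rightarrow> 'a \<Rightarrow> (real \<Rightarrow> 'a) \<Rightarrow> bool" where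
  "path_between X a b p \<longleftrightarrow> pathin X p \<and> p 0 = a \<and> p 1 = b"

lemma path_homotopic_refl: "path_between X a b p \<Longrightarrow> path_homotopic X a b p p"
  by (auto simp: path_between_def pathin_def)

lemma path_homotopic_imp_between:
  assumes "path_homotopic X a b p q" shows "path_between X a b p" "path_between X a b q"
  using homotopic_with_imp_continuous_maps[OF assms] homotopic_with_imp_property[OF assms]
  by (auto simp: path_between_def pathin_def)

lemma loops_eq: "p \<in> loops X a \<longleftrightarrow> path_between X a a p"
  by (simp add: loops_def path_between_def)

lemma loop_homotopy_eq: "(p, q) \<in> loop_homotopy X a \<longleftrightarrow> path_homotopic X a a p q"
  by (simp add: loop_homotopy_def)

lemma path_between_const: "a \<in> topspace X \<Longrightarrow> path_between X a a (\<lambda>t. a)"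
  by (simp add: path_between_def)

lemma path_homotopicI:
  fixes h :: "real \<times> real \<Rightarrow> 'a"
  assumes h: "continuous_map (top_of_set ({0..1} \<times> {0..1})) X h"
    and "\<And>t. t \<in> {0..1} \<Longrightarrow> h (0, t) = p t" "\<And>t. t \<in> {0..1} \<Longrightarrow> h (1, t) = q t"
    and "\<And>s. s \<in> {0..1} \<Longrightarrow> h (s, 0) = a" "\<And>s. s \<in> {0..1} \<Longrightarrow> h (s, 1) = b"
  shows "path_homotopic X a b p q"
proof (subst homotopic_with)
  show "\<exists>h :: real \<times> real \<Rightarrow> 'a. continuous_map (prod_topology (top_of_set {0..1}) (top_of_set {0..1})) X h \<and>
      (\<forall>x\<in>topspace (top_of_set {0..1}). h (0, x) = p x) \<and>
      (\<forall>x\<in>topspace (top_of_set {0..1}). h (1, x) = q x) \<and> (\<forall>t\<in>{0..1}. h (t, 0) = a \<and> h (t, 1) = b)"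
    using assms by (intro exI[of _ h]) auto
qed auto

lemma continuous_map_compose_path:
  assumes "pathin X p" "continuous_on S f" "\<And>z. z \<in> S \<Longrightarrow> f z \<in> {0..1}"
  shows "continuous_map (top_of_set S) X (\<lambda>z. p (f z))"
proof -
  have "continuous_map (top_of_set S) (top_of_set {0..1}) f"
    using assms(2,3) by (auto simp: continuous_map_in_subtopology)
  from continuous_map_compose[OF this assms(1)[unfolded pathin_def]] show ?thesis
    by (simp add: comp_def)
qed

text \<open>All groupoid laws follow from this lemma, because both sides of each law are reparametrisations of one
  path. The homotopy moves the parameters along segments.\<close>

lemma path_homotopic_reparametrize:
  assumes p: "pathin X p" and f: "continuous_on {0..1} f" "\<And>t. t \<in> {0..1} \<Longrightarrow> f t \<in> {0..1}"
    and g: "continuous_on {0..1} g" "\<And>t. t \<in> {0..1} \<Longrightarrow> g t \<in> {0..1}"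
    and eq: "f 0 = g 0" "f 1 = g 1"
    and p': "\<And>t. t \<in> {0..1} \<Longrightarrow> p' t = p (f t)" and q': "\<And>t. t \<in> {0..1} \<Longrightarrow> q' t = p (g t)"
  shows "path_homotopic X (p (f 0)) (p (f 1)) p' q'"
proof (rule path_homotopicI)
  show "continuous_map (top_of_set ({0..1} \<times> {0..1})) X (\<lambda>z. p ((1 - fst z) * f (snd z) + fst z * g (snd z)))"
  proof (rule continuous_map_compose_path[OF p])
    show "continuous_on ({0..1} \<times> {0..1}) (\<lambda>z. (1 - fst z) * f (snd z) + fst z * g (snd z))"
      by (intro continuous_intros continuous_on_compose2[OF f(1)] continuous_on_compose2[OF g(1)]) auto
    fix z :: "real \<times> real" assume "z \<in> {0..1} \<times> {0..1}"
    then have z: "fst z \<in> {0..1}" "snd z \<in> {0..1}" by auto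
    then show "(1 - fst z) * f (snd z) + fst z * g (snd z) \<in> {0..1}"
      using convex_bound_le[of "f (snd z)" 1 "g (snd z)" "1 - fst z" "fst z"] f(2)[OF z(2)] g(2)[OF z(2)] by auto
  qed
qed (use p' q' eq in \<open>auto simp: algebra_simps\<close>)

lemma continuous_map_if_half:
  fixes h k :: "real \<times> real \<Rightarrow> 'a"
  assumes "continuous_map (top_of_set ({0..1} \<times> {0..1})) X h" "continuous_map (top_of_set ({0..1} \<times> {0..1})) X k"
    and "\<And>s. s \<in> {0..1} \<Longrightarrow> h (s, 1) = k (s, 0)"
  shows "continuous_map (top_of_set ({0..1} \<times> {0..1})) X
    (\<lambda>z. if snd z \<le> 1/2 then h (fst z, 2 * snd z) else k (fst z, 2 * snd z - 1))"
proof -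
  let ?T = "top_of_set ({0..1} \<times> {0..1}) :: (real \<times> real) topology"
  show ?thesis
  proof (rule continuous_map_cases_le)
    show "continuous_map ?T euclideanreal snd" "continuous_map ?T euclideanreal (\<lambda>z. 1/2)"
      by (auto intro!: continuous_intros)
    have "continuous_map (subtopology ?T {x \<in> topspace ?T. snd x \<le> 1/2}) ?T (\<lambda>z. (fst z, 2 * snd z))"
      by (auto simp: continuous_map_in_subtopology subtopology_subtopology intro!: continuous_intros)
    from continuous_map_compose[OF this assms(1)]
    show "continuous_map (subtopology ?T {x \<in> topspace ?T. snd x \<le> 1/2}) X (\<lambda>z. h (fst z, 2 * snd z))"
      by (simp add: comp_def)
    have "continuous_map (subtopology ?T {x \<in> topspace ?T. 1/2 \<le> snd x}) ?T (\<lambda>z. (fst z, 2 * snd z - 1))"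
      by (auto simp: continuous_map_in_subtopology subtopology_subtopology intro!: continuous_intros)
    from continuous_map_compose[OF this assms(2)]
    show "continuous_map (subtopology ?T {x \<in> topspace ?T. 1/2 \<le> snd x}) X (\<lambda>z. k (fst z, 2 * snd z - 1))"
      by (simp add: comp_def)
  next
    fix z assume z: "z \<in> topspace ?T" "snd z = 1/2"
    then have "fst z \<in> {0..1}" by auto
    then show "h (fst z, 2 * snd z) = k (fst z, 2 * snd z - 1)"
      using assms(3)[of "fst z"] unfolding z(2) by simp
  qed
qed

lemma path_homotopic_join:
  assumes "path_homotopic X a b p p'" "path_homotopic X b c q q'"
  shows "path_homotopic X a c (join_loops p q) (join_loops p' q')"
proof -
  obtain h where h: "continuous_map (prod_topology (top_of_set {0..1::real}) (top_of_set {0..1::real})) X h"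
    "\<And>t. t \<in> {0..1} \<Longrightarrow> h (t, 0) = a \<and> h (t, 1) = b" "\<And>x. h (0, x) = p x" "\<And>x. h (1, x) = p' x"
    using assms(1) unfolding homotopic_with_def by auto
  obtain k where k: "continuous_map (prod_topology (top_of_set {0..1::real}) (top_of_set {0..1::real})) X k"
    "\<And>t. t \<in> {0..1} \<Longrightarrow> k (t, 0) = b \<and> k (t, 1) = c" "\<And>x. k (0, x) = q x" "\<And>x. k (1, x) = q' x"
    using assms(2) unfolding homotopic_with_def by auto
  show ?thesis
  proof (rule path_homotopicI)
    show "continuous_map (top_of_set ({0..1} \<times> {0..1})) X
        (\<lambda>z. if snd z \<le> 1/2 then h (fst z, 2 * snd z) else k (fst z, 2 * snd z - 1))"
      by (rule continuous_map_if_half) (use h k in auto)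
  qed (use h k in \<open>auto simp: join_loops_def\<close>)
qed

lemma path_between_join:
  assumes "path_between X a b p" "path_between X b c q"
  shows "path_between X a c (join_loops p q)"
  using path_homotopic_imp_between(1)[OF path_homotopic_join[OF path_homotopic_refl[OF assms(1)] path_homotopic_refl[OF assms(2)]]] .

lemma path_between_reverse:
  assumes "path_between X a b p" shows "path_between X b a (\<lambda>t. p (1 - t))"
proof -
  have "pathin X (\<lambda>t. p (1 - t))"
    unfolding pathin_def
    by (rule continuous_map_compose_path) (use assms in \<open>auto simp: path_between_def intro!: continuous_intros\<close>)
  then show ?thesis using assms by (auto simp: path_between_def)
qed

lemma continuous_on_if_le:
  fixes f g :: "real \<Rightarrow> real"
  assumes "continuous_on UNIV f" "continuous_on UNIV g" "f c = g c"
  shows "continuous_on S (\<lambda>t. if t \<le> c then f t else g t)"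
proof -
  have "continuous_on ({..c} \<union> {c..}) (\<lambda>t. if t \<le> c then f t else g t)"
    by (rule continuous_on_If) (use assms in \<open>auto intro: continuous_on_subset\<close>)
  then show ?thesis by (rule continuous_on_subset) auto
qed

lemma path_homotopic_assoc:
  assumes "path_between X a b p" "path_between X b c q" "path_between X c d r"
  shows "path_homotopic X a d (join_loops (join_loops p q) r) (join_loops p (join_loops q r))"
proof -
  let ?P = "join_loops (join_loops p q) r"
  let ?f = "\<lambda>t::real. if t \<le> 1/2 then t / 2 else if t \<le> 3/4 then t - 1/4 else 2 * t - 1"
  have P: "path_between X a d ?P" using assms by (intro path_between_join)
  have c: "continuous_on {0..1} ?f"
    by (intro continuous_on_if_le continuous_intros) (simp_all)
  have "path_homotopic X (?P 0) (?P 1) ?P (join_loops p (join_loops q r))"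
  proof (rule path_homotopic_reparametrize[where f = "\<lambda>t. t" and g = ?f])
    show "join_loops p (join_loops q r) t = ?P (?f t)" if "t \<in> {0..1}" for t
      using that assms by (auto simp: join_loops_def path_between_def algebra_simps)
  qed (use P c in \<open>auto simp: path_between_def split: if_splits\<close>)
  then show ?thesis using P by (simp add: path_between_def)
qed

lemma path_homotopic_const_left:
  assumes "path_between X a b p"
  shows "path_homotopic X a b (join_loops (\<lambda>t. a) p) p"
proof -
  have "path_homotopic X (p (max (2 * 0 - 1) 0)) (p (max (2 * 1 - 1) 0)) (join_loops (\<lambda>t. a) p) p"
  proof (rule path_homotopic_reparametrize[where p = p and g = "\<lambda>t. t"])
    show "join_loops (\<lambda>t. a) p t = p (max (2 * t - 1) 0)" for t
      using assms by (auto simp: join_loops_def path_between_def max_def)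
  qed (use assms in \<open>auto simp: path_between_def intro!: continuous_intros\<close>)
  then show ?thesis using assms by (simp add: path_between_def)
qed

lemma path_homotopic_reverse_right:
  assumes "path_between X a b p"
  shows "path_homotopic X a a (join_loops p (\<lambda>t. p (1 - t))) (\<lambda>t. a)"
proof -
  let ?f = "\<lambda>t::real. if t \<le> 1/2 then 2 * t else 2 - 2 * t"
  have "path_homotopic X (p (?f 0)) (p (?f 1)) (join_loops p (\<lambda>t. p (1 - t))) (\<lambda>t. a)"
  proof (rule path_homotopic_reparametrize[where p = p and g = "\<lambda>t. 0"])
    show "continuous_on {0..1} ?f" by (intro continuous_on_if_le continuous_intros) simp_all
    show "join_loops p (\<lambda>t. p (1 - t)) t = p (?f t)" for t
      by (simp add: join_loops_def algebra_simps)
  qed (use assms in \<open>auto simp: path_between_def split: if_splits\<close>)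
  then show ?thesis using assms by (simp add: path_between_def)
qed

lemma path_homotopic_reverse_left:
  assumes "path_between X a b p"
  shows "path_homotopic X b b (join_loops (\<lambda>t. p (1 - t)) p) (\<lambda>t. b)"
  using path_homotopic_reverse_right[OF path_between_reverse[OF assms]] by simp

section \<open>The fundamental group\<close>

definition loop_class :: "'a topology \<Rightarrow> 'a \<Rightarrow> (real \<Rightarrow> 'a) \<Rightarrow> (real \<Rightarrow> 'a) set" where
  "loop_class X a p = loop_homotopy X a `` {p}"

lemma loop_class_eq_iff:
  assumes "path_between X a a p" "path_between X a a q"
  shows "loop_class X a p = loop_class X a q \<longleftrightarrow> path_homotopic X a a p q"
  unfolding loop_class_def loop_homotopy_eq[symmetric]
  by (rule eq_equiv_class_iff[OF equiv_loop_homotopy]) (use assms in \<open>auto simp: loops_eq\<close>)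

lemma carrier_fundamental_group:
  "carrier (fundamental_group X a) = loop_class X a ` Collect (path_between X a a)"
  by (auto simp: fundamental_group_def quotient_def loop_class_def loops_eq)

lemma one_fundamental_group: "\<one>\<^bsub>fundamental_group X a\<^esub> = loop_class X a (\<lambda>t. a)"
  by (simp add: fundamental_group_def loop_class_def)

lemma mult_fundamental_group:
  assumes "path_between X a a p" "path_between X a a q"
  shows "loop_class X a p \<otimes>\<^bsub>fundamental_group X a\<^esub> loop_class X a q = loop_class X a (join_loops p q)"
proof -
  have "congruent2 (loop_homotopy X a) (loop_homotopy X a) (\<lambda>p q. loop_homotopy X a `` {join_loops p q})"
  proof -
    have "loop_homotopy X a `` {join_loops p q} = loop_homotopy X a `` {join_loops p' q'}"
      if "(p, p') \<in> loop_homotopy X a" "(q, q') \<in> loop_homotopy X a" for p p' q q'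
    proof -
      have "(join_loops p q, join_loops p' q') \<in> loop_homotopy X a"
        using that unfolding loop_homotopy_eq by (rule path_homotopic_join)
      then show ?thesis by (rule equiv_class_eq[OF equiv_loop_homotopy])
    qed
    then show ?thesis unfolding congruent2_def by fast
  qed
  from UN_equiv_class2[OF equiv_loop_homotopy equiv_loop_homotopy this, of p q] assms
  show ?thesis by (simp add: fundamental_group_def loop_class_def loops_eq)
qed

lemma group_fundamental_group:
  assumes a: "a \<in> topspace X"
  shows "group (fundamental_group X a)"
proof (rule groupI)
  let ?G = "fundamental_group X a"
  note c = path_between_const[OF a]
  show "\<one>\<^bsub>?G\<^esub> \<in> carrier ?G"
    using c by (auto simp: carrier_fundamental_group one_fundamental_group)
  show "P \<otimes>\<^bsub>?G\<^esub> Q \<in> carrier ?G" if "P \<in> carrier ?G" "Q \<in> carrier ?G" for P Q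
    using that by (auto simp: carrier_fundamental_group mult_fundamental_group path_between_join[of X a a])
  show "P \<otimes>\<^bsub>?G\<^esub> Q \<otimes>\<^bsub>?G\<^esub> R = P \<otimes>\<^bsub>?G\<^esub> (Q \<otimes>\<^bsub>?G\<^esub> R)"
    if PQR: "P \<in> carrier ?G" "Q \<in> carrier ?G" "R \<in> carrier ?G" for P Q R
  proof -
    obtain p q r where pqr: "path_between X a a p" "path_between X a a q" "path_between X a a r"
      "P = loop_class X a p" "Q = loop_class X a q" "R = loop_class X a r"
      using PQR by (auto simp: carrier_fundamental_group)
    then show ?thesis
      by (simp add: mult_fundamental_group path_between_join[of X a a] loop_class_eq_iff
          path_homotopic_assoc[of X a a])
  qed
  show "\<one>\<^bsub>?G\<^esub> \<otimes>\<^bsub>?G\<^esub> P = P" if P: "P \<in> carrier ?G" for P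
  proof -
    obtain p where p: "path_between X a a p" "P = loop_class X a p"
      using P by (auto simp: carrier_fundamental_group)
    then show ?thesis
      using c by (simp add: one_fundamental_group mult_fundamental_group path_between_join[of X a a]
          loop_class_eq_iff path_homotopic_const_left)
  qed
  show "\<exists>Q\<in>carrier ?G. Q \<otimes>\<^bsub>?G\<^esub> P = \<one>\<^bsub>?G\<^esub>" if P: "P \<in> carrier ?G" for P
  proof -
    obtain p where p: "path_between X a a p" "P = loop_class X a p"
      using P by (auto simp: carrier_fundamental_group)
    have r: "path_between X a a (\<lambda>t. p (1 - t))" by (rule path_between_reverse[OF p(1)])
    have "loop_class X a (\<lambda>t. p (1 - t)) \<otimes>\<^bsub>?G\<^esub> P = \<one>\<^bsub>?G\<^esub>"
      using p r c path_homotopic_reverse_left[OF p(1)]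
      by (simp add: mult_fundamental_group one_fundamental_group loop_class_eq_iff path_between_join[of X a a])
    then show ?thesis using r by (auto simp: carrier_fundamental_group)
  qed
qed

primrec loop_power :: "'a \<Rightarrow> nat \<Rightarrow> (real \<Rightarrow> 'a) \<Rightarrow> real \<Rightarrow> 'a" where
  "loop_power a 0 p = (\<lambda>t. a)"
| "loop_power a (Suc n) p = join_loops p (loop_power a n p)"

lemma path_between_loop_power:
  "path_between X a a p \<Longrightarrow> path_between X a a (loop_power a n p)"
proof (induction n)
  case 0
  then show ?case using path_between_const[of a X]
    by (auto simp: path_between_def pathin_def continuous_map_def Pi_iff)
qed (simp add: path_between_join)

lemma loop_class_power:
  assumes p: "path_between X a a p"
  shows "loop_class X a p [^]\<^bsub>fundamental_group X a\<^esub> n = loop_class X a (loop_power a n p)"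
proof -
  have "a \<in> topspace X"
    using p by (auto simp: path_between_def pathin_def continuous_map_def Pi_iff)
  then interpret group "fundamental_group X a" by (rule group_fundamental_group)
  have pc: "loop_class X a p \<in> carrier (fundamental_group X a)"
    using p by (auto simp: carrier_fundamental_group)
  show ?thesis
  proof (induction n)
    case (Suc n)
    show ?case
      unfolding nat_pow_Suc2[OF pc] Suc
      by (simp add: mult_fundamental_group p path_between_loop_power)
  qed (simp add: one_fundamental_group)
qed

section \<open>Change of base point\<close>

definition conjugate_loop :: "(real \<Rightarrow> 'a) \<Rightarrow> (real \<Rightarrow> 'a) \<Rightarrow> real \<Rightarrow> 'a" where
  "conjugate_loop l p = join_loops l (join_loops p (\<lambda>t. l (1 - t)))"

lemma path_between_conjugate:
  "path_between X y a l \<Longrightarrow> path_between X a a p \<Longrightarrow> path_between X y y (conjugate_loop l p)"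
  unfolding conjugate_loop_def by (intro path_between_join path_between_reverse)

lemma path_homotopic_conjugate:
  "path_between X y a l \<Longrightarrow> path_homotopic X a a p q \<Longrightarrow>
    path_homotopic X y y (conjugate_loop l p) (conjugate_loop l q)"
  unfolding conjugate_loop_def by (intro path_homotopic_join path_homotopic_refl path_between_reverse)

lemma path_homotopic_conjugate_const:
  assumes l: "path_between X y a l"
  shows "path_homotopic X y y (conjugate_loop l (\<lambda>t. a)) (\<lambda>t. y)"
proof -
  have "path_homotopic X y y (conjugate_loop l (\<lambda>t. a)) (join_loops l (\<lambda>t. l (1 - t)))"
    unfolding conjugate_loop_def
    by (rule path_homotopic_join[OF path_homotopic_refl[OF l] path_homotopic_const_left[OF path_between_reverse[OF l]]])
  then show ?thesis using path_homotopic_reverse_right[OF l] by (rule homotopic_with_trans)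
qed

text \<open>Conjugation by a path to another base point is a homomorphism on homotopy classes.\<close>

lemma path_homotopic_conjugate_join:
  assumes l: "path_between X y a l" and p: "path_between X a a p" and q: "path_between X a a q"
  shows "path_homotopic X y y (join_loops (conjugate_loop l p) (conjugate_loop l q)) (conjugate_loop l (join_loops p q))"
proof -
  let ?m = "\<lambda>t. l (1 - t)"
  note m = path_between_reverse[OF l]
  note R = path_homotopic_refl and J = path_between_join and T = homotopic_with_trans
  \<comment> \<open>the inner factors \<open>?m l\<close> cancel\<close>
  have "path_homotopic X a y (join_loops ?m (join_loops l (join_loops q ?m))) (join_loops (join_loops ?m l) (join_loops q ?m))"
    by (rule homotopic_with_symD[OF path_homotopic_assoc[OF m l J[OF q m]]])
  moreover have "path_homotopic X a y (join_loops (join_loops ?m l) (join_loops q ?m)) (join_loops (\<lambda>t. a) (join_loops q ?m))"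
    by (rule path_homotopic_join[OF path_homotopic_reverse_left[OF l] R[OF J[OF q m]]])
  moreover have "path_homotopic X a y (join_loops (\<lambda>t. a) (join_loops q ?m)) (join_loops q ?m)"
    by (rule path_homotopic_const_left[OF J[OF q m]])
  ultimately have cancel: "path_homotopic X a y (join_loops ?m (join_loops l (join_loops q ?m))) (join_loops q ?m)"
    using T by blast
  have "path_homotopic X a y (join_loops (join_loops p ?m) (join_loops l (join_loops q ?m)))
      (join_loops p (join_loops ?m (join_loops l (join_loops q ?m))))"
    by (rule path_homotopic_assoc[OF p m J[OF l J[OF q m]]])
  moreover have "path_homotopic X a y (join_loops p (join_loops ?m (join_loops l (join_loops q ?m)))) (join_loops p (join_loops q ?m))"
    by (rule path_homotopic_join[OF R[OF p] cancel])
  moreover have "path_homotopic X a y (join_loops p (join_loops q ?m)) (join_loops (join_loops p q) ?m)"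
    by (rule homotopic_with_symD[OF path_homotopic_assoc[OF p q m]])
  ultimately have "path_homotopic X a y (join_loops (join_loops p ?m) (join_loops l (join_loops q ?m)))
      (join_loops (join_loops p q) ?m)"
    using T by blast
  from path_homotopic_join[OF R[OF l] this]
  have "path_homotopic X y y (join_loops l (join_loops (join_loops p ?m) (join_loops l (join_loops q ?m))))
      (join_loops l (join_loops (join_loops p q) ?m))" .
  moreover have "path_homotopic X y y (join_loops (join_loops l (join_loops p ?m)) (join_loops l (join_loops q ?m)))
      (join_loops l (join_loops (join_loops p ?m) (join_loops l (join_loops q ?m))))"
    by (rule path_homotopic_assoc[OF l J[OF p m] J[OF l J[OF q m]]])
  ultimately show ?thesis
    unfolding conjugate_loop_def using T by blast
qed

lemma path_homotopic_conjugate_power: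
  assumes l: "path_between X y a l" and p: "path_between X a a p"
  shows "path_homotopic X y y (loop_power y n (conjugate_loop l p)) (conjugate_loop l (loop_power a n p))"
proof (induction n)
  case 0
  then show ?case using homotopic_with_symD[OF path_homotopic_conjugate_const[OF l]] by simp
next
  case (Suc n)
  have "path_homotopic X y y (join_loops (conjugate_loop l p) (loop_power y n (conjugate_loop l p)))
      (join_loops (conjugate_loop l p) (conjugate_loop l (loop_power a n p)))"
    by (rule path_homotopic_join[OF path_homotopic_refl[OF path_between_conjugate[OF l p]] Suc])
  moreover have "path_homotopic X y y (join_loops (conjugate_loop l p) (conjugate_loop l (loop_power a n p)))
      (conjugate_loop l (join_loops p (loop_power a n p)))"
    by (rule path_homotopic_conjugate_join[OF l p path_between_loop_power[OF p]])
  ultimately show ?case by (simp add: homotopic_with_trans)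
qed

section \<open>The parts of the Hawaiian earring\<close>

definition earring_circle :: "nat \<Rightarrow> complex set" where
  "earring_circle m = sphere (complex_of_real (1 / real m)) (1 / real m)"

text \<open>Index \<open>0\<close> is excluded because \<open>1 / real 0 = 0\<close> would produce a degenerate circle; the common point is
  inserted so that the part is a based space even when \<open>M\<close> selects no circle.\<close>

definition earring_part :: "nat set \<Rightarrow> complex set" where
  "earring_part M = insert 0 (\<Union>m\<in>M \<inter> {1..}. earring_circle m)"

text \<open>The equation shows that the index of the circle through \<open>z \<noteq> 0\<close> is determined by \<open>z\<close>.\<close>

lemma earring_circle_iff:
  assumes "m \<ge> 1"
  shows "z \<in> earring_circle m \<longleftrightarrow> real m * (cmod z)\<^sup>2 = 2 * Re z"
proof -
  have m: "real m > 0" using assms by simp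
  have "z \<in> earring_circle m \<longleftrightarrow> (cmod (of_real (1 / real m) - z))\<^sup>2 = (1 / real m)\<^sup>2"
    unfolding earring_circle_def mem_sphere dist_norm
    by (rule power2_eq_iff_nonneg[symmetric]) (use m in auto)
  also have "(cmod (of_real (1 / real m) - z))\<^sup>2 = (1 / real m)\<^sup>2 - 2 * Re z / real m + (cmod z)\<^sup>2"
    unfolding cmod_power2 by (simp add: power2_eq_square algebra_simps)
  also have "\<dots> = (1 / real m)\<^sup>2 \<longleftrightarrow> real m * (cmod z)\<^sup>2 = 2 * Re z"
    using m by (auto simp: field_simps)
  finally show ?thesis .
qed

lemma zero_in_earring_circle: "m \<ge> 1 \<Longrightarrow> 0 \<in> earring_circle m"
  by (simp add: earring_circle_iff)

lemma earring_circle_Int: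
  assumes "m \<ge> 1" "k \<ge> 1" "z \<in> earring_circle m" "z \<in> earring_circle k" "z \<noteq> 0"
  shows "m = k"
  using assms by (simp add: earring_circle_iff) (metis mult_cancel_right norm_eq_zero of_nat_eq_iff power_eq_0_iff)

lemma norm_earring_circle:
  assumes "m \<ge> 1" "z \<in> earring_circle m" shows "cmod z \<le> 2 / real m"
proof -
  have "cmod z * (real m * cmod z) \<le> cmod z * 2"
    using assms complex_Re_le_cmod[of z] by (simp add: earring_circle_iff power2_eq_square algebra_simps)
  then show ?thesis
    using assms(1) by (cases "z = 0") (simp_all add: field_simps)
qed

lemma hawaiian_earring_eq: "hawaiian_earring = earring_part UNIV"
proof -
  have "hawaiian_earring = (\<Union>m\<in>{1..}. earring_circle m)"
    by (simp add: hawaiian_earring_def earring_circle_def)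
  then show ?thesis using zero_in_earring_circle[of 1] by (auto simp: earring_part_def)
qed

lemma earring_part_mono: "M \<subseteq> N \<Longrightarrow> earring_part M \<subseteq> earring_part N"
  by (auto simp: earring_part_def)

lemma earring_part_Int: "z \<in> earring_part M \<Longrightarrow> z \<in> earring_part N \<Longrightarrow> z \<in> earring_part (M \<inter> N)"
  using earring_circle_Int by (auto simp: earring_part_def)

lemma earring_part_Un: "earring_part (M \<union> N) = earring_part M \<union> earring_part N"
  by (auto simp: earring_part_def)

text \<open>All but finitely many of the circles lie in a given neighbourhood of the common point, so the part is an
  intersection of finite unions of closed sets.\<close>

lemma closed_earring_part: "closed (earring_part M)"
proof -
  have "earring_part M = (\<Inter>N. (\<Union>m\<in>M \<inter> {1..N}. earring_circle m) \<union> cball 0 (2 / real (Suc N)))" (is "_ = (\<Inter>N. ?C N)")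
  proof (intro equalityI subsetI INT_I)
    fix z N assume z: "z \<in> earring_part M"
    show "z \<in> ?C N"
    proof (cases "z = 0")
      case False
      then obtain m where m: "m \<in> M" "m \<ge> 1" "z \<in> earring_circle m" using z by (auto simp: earring_part_def)
      show ?thesis
      proof (cases "m \<le> N")
        case False
        then have "cmod z \<le> 2 / real (Suc N)"
          using norm_earring_circle[OF m(2,3)] divide_left_mono[of "real (Suc N)" "real m" 2] by simp
        then show ?thesis by simp
      qed (use m in auto)
    qed simp
  next
    fix z assume z: "z \<in> (\<Inter>N. ?C N)"
    show "z \<in> earring_part M"
    proof (cases "z = 0")
      case False
      obtain N where "real N > 2 / cmod z" using reals_Archimedean2 by blast
      then have "2 < real N * cmod z" using False by (simp add: field_simps)
      also have "\<dots> \<le> real (Suc N) * cmod z" by (intro mult_right_mono) auto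
      finally have "2 / real (Suc N) < cmod z" by (simp add: field_simps)
      moreover have "z \<in> ?C N" using z by blast
      ultimately show ?thesis by (auto simp: earring_part_def)
    qed (simp add: earring_part_def)
  qed
  moreover have "closed (?C N)" for N
    by (intro closed_Un closed_UN) (auto simp: earring_circle_def)
  ultimately show ?thesis by (simp add: closed_INT)
qed

text \<open>Complementary parts are closed and share only the common point, so that maps can be pasted.\<close>

lemma continuous_map_earring_cases:
  assumes f: "continuous_map (top_of_set (earring_part M)) Y f"
    and g: "continuous_map (top_of_set (earring_part N)) Y g"
    and "M \<inter> N = {}" "M \<union> N = UNIV" "f 0 = g 0"
  shows "continuous_map (top_of_set hawaiian_earring) Y (\<lambda>z. if z \<in> earring_part M then f z else g z)"
proof -
  have H: "hawaiian_earring = earring_part M \<union> earring_part N"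
    using assms by (simp add: hawaiian_earring_eq flip: earring_part_Un)
  let ?T = "top_of_set hawaiian_earring"
  have eq: "f z = g z" if "z \<in> earring_part M" "z \<in> earring_part N" for z
    using earring_part_Int[OF that] assms(3,5) by (simp add: earring_part_def)
  have cl: "closedin ?T (earring_part M)" "closedin ?T (earring_part N)"
    using closed_earring_part by (auto simp: H intro: closed_subset)
  have sub: "subtopology ?T (earring_part M) = top_of_set (earring_part M)"
    "subtopology ?T (earring_part N) = top_of_set (earring_part N)"
    by (auto simp: subtopology_subtopology H Int_Un_distrib Int_Un_distrib2 Int_absorb1 Int_absorb2
        intro!: arg_cong2[where f = subtopology])
  show ?thesis
  proof (rule pasting_lemma_closed[where I = "UNIV :: bool set"
        and T = "\<lambda>b. earring_part (if b then M else N)" and f = "\<lambda>b. if b then f else g"])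
    show "closedin ?T (earring_part (if b then M else N))" for b using cl by simp
    show "continuous_map (subtopology ?T (earring_part (if b then M else N))) Y (if b then f else g)" for b
      using f g sub by simp
    show "(if i then f else g) x = (if j then f else g) x"
      if "x \<in> topspace ?T \<inter> earring_part (if i then M else N) \<inter> earring_part (if j then M else N)" for i j x
      using that eq by (auto split: if_splits)
    show "\<exists>j. j \<in> UNIV \<and> x \<in> earring_part (if j then M else N) \<and>
        (if x \<in> earring_part M then f x else g x) = (if j then f else g) x" if "x \<in> topspace ?T" for x
      using that by (intro exI[of _ "x \<in> earring_part M"]) (auto simp: H)
  qed auto
qed

section \<open>Nested loops in the Hawaiian earring\<close>

definition earring_loop :: "nat \<Rightarrow> real \<Rightarrow> complex" where
  "earring_loop m t = circle_loop t / of_nat m"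

definition commutator_loop :: "(real \<Rightarrow> 'a) \<Rightarrow> (real \<Rightarrow> 'a) \<Rightarrow> real \<Rightarrow> 'a" where
  "commutator_loop p q =
     join_loops (join_loops p q) (join_loops (\<lambda>t. p (1 - t)) (\<lambda>t. q (1 - t)))"

text \<open>The range of \<open>branch A\<close> consists of the codes of the initial segments of \<open>A\<close>, the vertices on a branch of the
  binary tree. Two different branches separate at some vertex, so these infinite sets form an almost
  disjoint family of the size of the continuum.\<close>

definition branch :: "nat set \<Rightarrow> nat \<Rightarrow> nat" where
  "branch A k = prod_encode (k, set_encode (A \<inter> {..<k}))"

lemma branch_ge: "k \<le> branch A k"
  by (simp add: branch_def le_prod_encode_1)

lemma branch_almost_disjoint:
  assumes "A \<noteq> A'"
  obtains K where "\<And>k. k \<ge> K \<Longrightarrow> branch A k \<notin> range (branch A')"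
proof -
  obtain i where i: "i \<in> A \<longleftrightarrow> i \<notin> A'" using assms by blast
  have "branch A k \<notin> range (branch A')" if "k \<ge> Suc i" for k
  proof
    assume "branch A k \<in> range (branch A')"
    then have "A \<inter> {..<k} = A' \<inter> {..<k}"
      by (auto simp: branch_def set_encode_eq)
    then show False using i that by fastforce
  qed
  then show thesis by (rule that)
qed

definition block :: "nat set \<Rightarrow> nat \<Rightarrow> real \<Rightarrow> complex" where
  "block A n = (if n \<in> range (branch A)
     then commutator_loop (earring_loop (2 * n + 1)) (earring_loop (2 * n + 2)) else (\<lambda>t. 0))"

text \<open>The nesting is cut off at depth \<open>k\<close>.\<close>

primrec approx_loop :: "nat set \<Rightarrow> nat \<Rightarrow> nat \<Rightarrow> real \<Rightarrow> complex" where
  "approx_loop A 0 n = (\<lambda>t. 0)"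
| "approx_loop A (Suc k) n = join_loops (block A n) (loop_power 0 (Suc n) (approx_loop A k (Suc n)))"

lemma earring_loop_between:
  assumes "m \<ge> 1" "m \<in> M"
  shows "path_between (top_of_set (earring_part M)) 0 0 (earring_loop m)"
proof -
  have "(cmod (circle_loop t))\<^sup>2 = 2 * Re (circle_loop t)" for t
  proof -
    have "(cmod (circle_loop t))\<^sup>2 = 1 - 2 * cos (2 * pi * t) + ((cos (2 * pi * t))\<^sup>2 + (sin (2 * pi * t))\<^sup>2)"
      unfolding cmod_power2 circle_loop_def by (simp add: power2_eq_square algebra_simps)
    also have "\<dots> = 2 * Re (circle_loop t)"
      by (simp only: sin_cos_squared_add2) (simp add: circle_loop_def)
    finally show ?thesis .
  qed
  then have "earring_loop m t \<in> earring_circle m" for t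
    using assms(1) by (simp add: earring_circle_iff earring_loop_def norm_divide power_divide power2_eq_square field_simps)
  then have "earring_loop m t \<in> earring_part M" for t
    using assms by (auto simp: earring_part_def)
  moreover have "continuous_on {0..1} (earring_loop m)"
    unfolding earring_loop_def circle_loop_def by (intro continuous_intros) (use assms in auto)
  moreover have "circle_loop 0 = 0" "circle_loop 1 = 0"
    by (simp_all add: circle_loop_def complex_eq_iff)
  ultimately show ?thesis
    by (auto simp: path_between_def pathin_def continuous_map_in_subtopology earring_loop_def)
qed

lemma path_between_commutator:
  assumes "path_between X a a p" "path_between X a a q"
  shows "path_between X a a (commutator_loop p q)"
  unfolding commutator_loop_def
  using assms path_between_reverse[of X a a p] path_between_reverse[of X a a q]
  by (intro path_between_join[of X a a]) auto

lemma earring_const_between: "path_between (top_of_set (earring_part M)) 0 0 (\<lambda>t. 0)"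
  by (rule path_between_const) (simp add: earring_part_def)

lemma block_between:
  assumes "{2 * n + 1, 2 * n + 2} \<subseteq> M"
  shows "path_between (top_of_set (earring_part M)) 0 0 (block A n)"
  unfolding block_def
  using assms by (auto intro!: path_between_commutator earring_loop_between earring_const_between)

lemma approx_loop_between:
  "{2 * n + 1..} \<subseteq> M \<Longrightarrow> path_between (top_of_set (earring_part M)) 0 0 (approx_loop A k n)"
proof (induction k arbitrary: n)
  case 0
  then show ?case using earring_const_between by simp
next
  case (Suc k)
  have "path_between (top_of_set (earring_part M)) 0 0 (approx_loop A k (Suc n))"
    by (rule Suc.IH) (use Suc.prems in auto)
  moreover have "path_between (top_of_set (earring_part M)) 0 0 (block A n)"
    by (rule block_between) (use Suc.prems in auto)
  ultimately show ?case
    unfolding approx_loop.simps by (intro path_between_join[of _ 0 0] path_between_loop_power)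
qed

lemma path_between_in:
  "path_between (top_of_set S) a b p \<Longrightarrow> t \<in> {0..1} \<Longrightarrow> p t \<in> S"
  by (auto simp: path_between_def pathin_def continuous_map_in_subtopology)

lemma norm_earring_part:
  assumes "z \<in> earring_part {m. n < m}" shows "cmod z \<le> 2 / real (Suc n)"
proof (cases "z = 0")
  case False
  then obtain m where m: "n < m" "z \<in> earring_circle m" using assms by (auto simp: earring_part_def)
  then have "cmod z \<le> 2 / real m" by (intro norm_earring_circle) auto
  also have "\<dots> \<le> 2 / real (Suc n)" using m by (intro divide_left_mono) auto
  finally show ?thesis .
qed simp

lemma dist_join_loops_le:
  assumes "\<And>t. t \<in> {0..1} \<Longrightarrow> dist (p t) (p' t) \<le> e" "\<And>t. t \<in> {0..1} \<Longrightarrow> dist (q t) (q' t) \<le> e" "t \<in> {0..1}"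
  shows "dist (join_loops p q t) (join_loops p' q' t) \<le> e"
  using assms by (auto simp: join_loops_def)

lemma dist_loop_power_le:
  assumes "\<And>t. t \<in> {0..1} \<Longrightarrow> dist (p t) (p' t) \<le> e" "e \<ge> 0" "t \<in> {0..1}"
  shows "dist (loop_power a n p t) (loop_power a n p' t) \<le> e"
  using assms(3)
proof (induction n arbitrary: t)
  case (Suc n)
  show ?case unfolding loop_power.simps by (rule dist_join_loops_le) (use assms Suc in auto)
qed (use assms in auto)

text \<open>Approximations of depth at least \<open>k\<close> differ only where they run through circles of index at least
  \<open>2 * (n + k) + 1\<close>.\<close>

lemma approx_loop_Cauchy:
  assumes "t \<in> {0..1}" "k \<le> l"
  shows "dist (approx_loop A k n t) (approx_loop A l n t) \<le> 2 / real (Suc (n + k))"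
  using assms
proof (induction k arbitrary: n l t)
  case 0
  have "approx_loop A l n t \<in> earring_part {m. n < m}"
    by (rule path_between_in[OF approx_loop_between]) (use 0 in auto)
  from norm_earring_part[OF this] show ?case by simp
next
  case (Suc k)
  then obtain l' where l: "l = Suc l'" "k \<le> l'" by (cases l) auto
  show ?case unfolding l(1) approx_loop.simps(2)
  proof (rule dist_join_loops_le)
    show "dist (loop_power 0 (Suc n) (approx_loop A k (Suc n)) t) (loop_power 0 (Suc n) (approx_loop A l' (Suc n)) t)
        \<le> 2 / real (Suc (n + Suc k))" if "t \<in> {0..1}" for t
      by (rule dist_loop_power_le) (use Suc.IH[of _ l' "Suc n"] l that in auto)
  qed (use Suc in auto)
qed

definition tower_loop :: "nat set \<Rightarrow> nat \<Rightarrow> real \<Rightarrow> complex" where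
  "tower_loop A n t = lim (\<lambda>k. approx_loop A k n t)"

lemma uniform_limit_tower_loop:
  "uniform_limit {0..1} (\<lambda>k. approx_loop A k n) (tower_loop A n) sequentially"
proof -
  have "uniformly_Cauchy_on {0..1} (\<lambda>k. approx_loop A k n)"
    unfolding uniformly_Cauchy_on_def
  proof (intro allI impI)
    fix e :: real assume e: "e > 0"
    obtain K where K: "real K > 4 / e" using reals_Archimedean2 by blast
    have small: "dist (approx_loop A K n t) (approx_loop A k n t) < e / 2" if "t \<in> {0..1}" "k \<ge> K" for t k
    proof -
      have "K > 0" using K e by (cases K) (auto simp: field_simps)
      have "dist (approx_loop A K n t) (approx_loop A k n t) \<le> 2 / real (Suc (n + K))"
        by (rule approx_loop_Cauchy) (use that in auto)
      also have "\<dots> \<le> 2 / real K" using \<open>K > 0\<close> by (intro divide_left_mono) auto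
      also have "\<dots> < e / 2" using K e \<open>K > 0\<close> by (simp add: field_simps)
      finally show ?thesis .
    qed
    have "dist (approx_loop A k n t) (approx_loop A l n t) < e" if "t \<in> {0..1}" "k \<ge> K" "l \<ge> K" for t k l
      using dist_triangle_half_l[OF small[OF that(1,2), unfolded dist_commute[of "approx_loop A K n t"]]
          small[OF that(1,3), unfolded dist_commute[of "approx_loop A K n t"]]] .
    then show "\<exists>M. \<forall>x\<in>{0..1}. \<forall>m\<ge>M. \<forall>k\<ge>M. dist (approx_loop A m n x) (approx_loop A k n x) < e"
      by blast
  qed
  then have "uniformly_convergent_on {0..1} (\<lambda>k. approx_loop A k n)"
    by (rule Cauchy_uniformly_convergent)
  then show ?thesis
    unfolding uniformly_convergent_uniform_limit_iff tower_loop_def by simp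
qed

lemma approx_loop_tendsto: "t \<in> {0..1} \<Longrightarrow> (\<lambda>k. approx_loop A k n t) \<longlonglongrightarrow> tower_loop A n t"
  using uniform_limit_tower_loop by (rule tendsto_uniform_limitI)

lemma tower_loop_between:
  assumes "{2 * n + 1..} \<subseteq> M"
  shows "path_between (top_of_set (earring_part M)) 0 0 (tower_loop A n)"
proof -
  note b = approx_loop_between[OF assms, of A]
  have "continuous_on {0..1} (tower_loop A n)"
  proof (rule uniform_limit_theorem[OF _ uniform_limit_tower_loop])
    show "\<forall>\<^sub>F k in sequentially. continuous_on {0..1} (approx_loop A k n)"
      using b by (auto simp: path_between_def pathin_def continuous_map_in_subtopology)
  qed simp
  moreover have "tower_loop A n t \<in> earring_part M" if t: "t \<in> {0..1}" for t
    by (rule Lim_in_closed_set[OF closed_earring_part _ _ approx_loop_tendsto[OF t]])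
      (use path_between_in[OF b t] in auto)
  moreover have "tower_loop A n 0 = 0" "tower_loop A n 1 = 0"
    using b by (simp_all add: tower_loop_def path_between_def)
  ultimately show ?thesis
    by (auto simp: path_between_def pathin_def continuous_map_in_subtopology)
qed

lemma loop_power_tendsto:
  assumes "\<And>t. t \<in> {0..1} \<Longrightarrow> (\<lambda>k. f k t) \<longlonglongrightarrow> g t" "t \<in> {0..1}"
  shows "(\<lambda>k. loop_power a n (f k) t) \<longlonglongrightarrow> loop_power a n g t"
  using assms(2)
proof (induction n arbitrary: t)
  case (Suc n)
  then show ?case using assms(1) by (auto simp: join_loops_def)
qed auto

lemma tower_loop_rec:
  assumes t: "t \<in> {0..1}"
  shows "tower_loop A n t = join_loops (block A n) (loop_power 0 (Suc n) (tower_loop A (Suc n))) t"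
proof (rule LIMSEQ_unique)
  show "(\<lambda>k. approx_loop A (Suc k) n t) \<longlonglongrightarrow> tower_loop A n t"
    using approx_loop_tendsto[OF t] by (rule LIMSEQ_Suc)
  have *: "(\<lambda>k. loop_power 0 (Suc n) (approx_loop A k (Suc n)) s) \<longlonglongrightarrow> loop_power 0 (Suc n) (tower_loop A (Suc n)) s"
    if "s \<in> {0..1}" for s
    using approx_loop_tendsto that by (rule loop_power_tendsto)
  show "(\<lambda>k. approx_loop A (Suc k) n t) \<longlonglongrightarrow> join_loops (block A n) (loop_power 0 (Suc n) (tower_loop A (Suc n))) t"
    unfolding approx_loop.simps(2) join_loops_def[of "block A n"]
    using *[of "2 * t - 1"] t by (cases "t \<le> 1/2") auto
qed


section \<open>The images of the nested loops in a wedge of two circles\<close>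

text \<open>The flag tells to which of the two cones of Griffiths' space the earring belongs. The \<open>n\<close>-th circle of
  that cone is scaled onto a circle of the wedge, and all other points are sent to the common point.\<close>

definition circle_detector :: "nat \<Rightarrow> bool \<Rightarrow> complex \<Rightarrow> complex" where
  "circle_detector n b z =
    (if b then if z \<in> earring_circle (2 * n + 2) then - (of_nat (2 * n + 2) * z) else 0
     else if z \<in> earring_circle (2 * n + 1) then of_nat (2 * n + 1) * z else 0)"

definition detector :: "nat \<Rightarrow> complex \<Rightarrow> complex" where
  "detector n z = circle_detector n (z \<notin> earring_part {m. odd m}) z"

lemma earring_part_single: "m \<ge> 1 \<Longrightarrow> earring_part {m} = earring_circle m"
  using zero_in_earring_circle[of m] by (auto simp: earring_part_def)

lemma circle_detector_zero [simp]: "circle_detector n b 0 = 0"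
  by (simp add: circle_detector_def)

lemma continuous_circle_detector: "continuous_on hawaiian_earring (circle_detector n b)"
proof -
  have "continuous_map (top_of_set hawaiian_earring) euclidean
      (\<lambda>z. if z \<in> earring_part {if b then 2 * n + 2 else 2 * n + 1}
        then (if b then - (of_nat (2 * n + 2) * z) else of_nat (2 * n + 1) * z) else 0)"
    by (rule continuous_map_earring_cases[where N = "- {if b then 2 * n + 2 else 2 * n + 1}"])
      (auto intro!: continuous_intros)
  moreover have "(\<lambda>z. if z \<in> earring_part {if b then 2 * n + 2 else 2 * n + 1}
        then (if b then - (of_nat (2 * n + 2) * z) else of_nat (2 * n + 1) * z) else 0) = circle_detector n b"
    by (auto simp: circle_detector_def earring_part_single fun_eq_iff)
  ultimately show ?thesis by simp
qed

lemma circle_detector_in: "circle_detector n b z \<in> (if b then sphere (- 1) 1 else sphere 1 1)"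
proof -
  have *: "cmod (1 - of_nat m * z) = 1" if "z \<in> earring_circle m" "m \<ge> 1" for m
  proof -
    have "cmod (of_nat m * (of_real (1 / real m) - z)) = real m * (1 / real m)"
      using that unfolding norm_mult by (simp add: earring_circle_def dist_norm)
    moreover have "of_nat m * (of_real (1 / real m) - z) = 1 - of_nat m * z"
      using that(2) by (simp add: algebra_simps)
    ultimately show ?thesis using that(2) by simp
  qed
  then have "of_nat m * z \<in> sphere 1 1" "- (of_nat m * z) \<in> sphere (- 1) 1"
    if "z \<in> earring_circle m" "m \<ge> 1" for m
    using that by (simp_all add: dist_norm norm_minus_commute)
  moreover have "0 \<in> sphere (1::complex) 1" "0 \<in> sphere (- 1::complex) 1"
    by simp_all
  ultimately show ?thesis
    unfolding circle_detector_def
    by (simp del: of_nat_add of_nat_mult of_nat_Suc mem_sphere)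
qed

lemma continuous_detector: "continuous_on hawaiian_earring (detector n)"
proof -
  have "continuous_map (top_of_set hawaiian_earring) euclidean
      (\<lambda>z. if z \<in> earring_part {m. odd m} then circle_detector n False z else circle_detector n True z)"
  proof (rule continuous_map_earring_cases[where N = "{m. even m}"])
    have c: "continuous_map (top_of_set (earring_part M)) euclidean (circle_detector n b)" for M b
      using continuous_on_subset[OF continuous_circle_detector earring_part_mono[of M UNIV, folded hawaiian_earring_eq]]
      by simp
    show "continuous_map (top_of_set (earring_part {m. odd m})) euclidean (circle_detector n False)"
      "continuous_map (top_of_set (earring_part {m. even m})) euclidean (circle_detector n True)"
      by (rule c)+
  qed auto
  moreover have "(\<lambda>z. if z \<in> earring_part {m. odd m} then circle_detector n False z else circle_detector n True z) = detector n"
    by (auto simp: detector_def fun_eq_iff)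
  ultimately show ?thesis by simp
qed

lemma detector_in: "detector n z \<in> two_circles"
  using circle_detector_in[of n "z \<notin> earring_part {m. odd m}" z]
  unfolding detector_def two_circles_def by (cases "z \<in> earring_part {m. odd m}") simp_all

lemma detector_zero [simp]: "detector n 0 = 0"
  by (simp add: detector_def)

lemma detector_other:
  assumes "z \<in> earring_part M" "2 * n + 1 \<notin> M" "2 * n + 2 \<notin> M"
  shows "detector n z = 0"
proof -
  have "z = 0" if "z \<in> earring_circle k" "k \<ge> 1" "k \<notin> M" for k
    using that assms(1) earring_circle_Int[of k _ z] by (auto simp: earring_part_def)
  then show ?thesis
    using assms(2,3) by (auto simp: detector_def circle_detector_def)
qed

lemma detector_circle:
  assumes "z \<in> earring_circle (2 * n + 1)" shows "detector n z = of_nat (2 * n + 1) * z"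
proof -
  have "z \<in> earring_part {m. odd m}" using assms by (auto simp: earring_part_def)
  then show ?thesis using assms by (simp add: detector_def circle_detector_def)
qed

lemma detector_circle':
  assumes "z \<in> earring_circle (2 * n + 2)" shows "detector n z = - (of_nat (2 * n + 2) * z)"
proof (cases "z = 0")
  case False
  have "z \<notin> earring_part {m. odd m}"
  proof
    assume "z \<in> earring_part {m. odd m}"
    then obtain k where k: "odd k" "k \<ge> 1" "z \<in> earring_circle k"
      using False by (auto simp: earring_part_def)
    have "k = 2 * n + 2" by (rule earring_circle_Int[OF k(2) _ k(3) assms False]) simp
    then show False using k(1) by simp
  qed
  then show ?thesis using assms by (simp add: detector_def circle_detector_def)
qed simp

lemma earring_loop_in: "m \<ge> 1 \<Longrightarrow> t \<in> {0..1} \<Longrightarrow> earring_loop m t \<in> earring_circle m"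
  using path_between_in[OF earring_loop_between[of m "{m}"]] earring_part_single by simp

lemma circles_path_detector:
  assumes "path_between (top_of_set hawaiian_earring) a b p"
  shows "circles_path (\<lambda>t. detector n (p t))"
  unfolding circles_path_def
proof
  show "continuous_on {0..1} (\<lambda>t. detector n (p t))"
    by (rule continuous_on_compose2[OF continuous_detector])
      (use assms in \<open>auto simp: path_between_def pathin_def continuous_map_in_subtopology\<close>)
qed (use detector_in in auto)

lemma join_loops_compose: "(\<lambda>t. f (join_loops p q t)) = join_loops (\<lambda>t. f (p t)) (\<lambda>t. f (q t))"
  by (auto simp: join_loops_def)

lemma transport_detector_join:
  assumes "path_between (top_of_set hawaiian_earring) 0 0 p" "path_between (top_of_set hawaiian_earring) 0 0 q"
  shows "transport (\<lambda>t. detector n (join_loops p q t)) =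
    transport (\<lambda>t. detector n (q t)) \<circ> transport (\<lambda>t. detector n (p t))"
proof
  fix s
  have "circles_path (join_loops (\<lambda>t. detector n (p t)) (\<lambda>t. detector n (q t)))"
    using circles_path_detector[OF path_between_join[OF assms], of n] unfolding join_loops_compose .
  from transport_join_loops[OF this]
  show "transport (\<lambda>t. detector n (join_loops p q t)) s =
      (transport (\<lambda>t. detector n (q t)) \<circ> transport (\<lambda>t. detector n (p t))) s"
    using assms by (simp add: join_loops_compose path_between_def)
qed

lemma transport_detector_power:
  assumes "path_between (top_of_set hawaiian_earring) 0 0 p"
  shows "transport (\<lambda>t. detector n (loop_power 0 k p t)) = transport (\<lambda>t. detector n (p t)) ^^ k"
proof (induction k)
  case 0
  then show ?case using transport_const by (auto simp: fun_eq_iff)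
next
  case (Suc k)
  show ?case
    unfolding loop_power.simps transport_detector_join[OF assms path_between_loop_power[OF assms]] Suc
    by (simp add: funpow_swap1 fun_eq_iff)
qed

lemma transport_detector_commutator:
  fixes n :: nat
  defines "p \<equiv> earring_loop (2 * n + 1)" and "q \<equiv> earring_loop (2 * n + 2)"
  shows "transport (\<lambda>t. detector n (commutator_loop p q t)) = stretch_commutator"
proof -
  let ?H = "top_of_set hawaiian_earring"
  have p: "path_between ?H 0 0 p" and q: "path_between ?H 0 0 q"
    unfolding p_def q_def hawaiian_earring_eq by (auto intro!: earring_loop_between)
  note p' = path_between_reverse[OF p] and q' = path_between_reverse[OF q]
  have dp: "detector n (p t) = circle_loop t" if "t \<in> {0..1}" for t
    using detector_circle[OF earring_loop_in[OF _ that], of n] of_nat_neq_0[of "2 * n", where ?'a = complex]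
    by (simp add: p_def earring_loop_def del: of_nat_add of_nat_mult of_nat_Suc)
  have dq: "detector n (q t) = - circle_loop t" if "t \<in> {0..1}" for t
    using detector_circle'[OF earring_loop_in[OF _ that], of n] of_nat_neq_0[of "2 * n + 1", where ?'a = complex]
    by (simp add: q_def earring_loop_def del: of_nat_add of_nat_mult of_nat_Suc)
  have tp: "transport (\<lambda>t. detector n (p t)) = stretch"
    using transport_cong[of "\<lambda>t. detector n (p t)" circle_loop] dp transport_circle_loop by auto
  have tq: "transport (\<lambda>t. detector n (q t)) = stretch'"
    using transport_cong[of "\<lambda>t. detector n (q t)" "\<lambda>t. - circle_loop t"] dq transport_minus_circle_loop by auto
  have tp': "transport (\<lambda>t. detector n (p (1 - t))) = unstretch"
    using transport_reverse[OF circles_path_detector[OF p, of n]] stretch_unstretch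
    unfolding tp by (metis ext)
  have tq': "transport (\<lambda>t. detector n (q (1 - t))) = unstretch'"
    using transport_reverse[OF circles_path_detector[OF q, of n]] stretch'_unstretch'
    unfolding tq by (metis ext)
  show ?thesis
    unfolding commutator_loop_def
      transport_detector_join[OF path_between_join[OF p q] path_between_join[OF p' q']]
      transport_detector_join[OF p q] transport_detector_join[OF p' q'] tp tq tp' tq' stretch_commutator_def
    by (simp add: comp_assoc)
qed

lemma transport_detector_zero:
  assumes "\<And>t. t \<in> {0..1} \<Longrightarrow> detector n (p t) = 0"
  shows "transport (\<lambda>t. detector n (p t)) = id"
  using transport_cong[of "\<lambda>t. detector n (p t)" "\<lambda>t. 0"] assms transport_const[of 0] by auto

lemma transport_detector_tower_step:
  "transport (\<lambda>t. detector n (tower_loop A k t)) =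
     transport (\<lambda>t. detector n (tower_loop A (Suc k) t)) ^^ Suc k \<circ> transport (\<lambda>t. detector n (block A k t))"
proof -
  have b: "path_between (top_of_set hawaiian_earring) 0 0 (block A k)"
    "path_between (top_of_set hawaiian_earring) 0 0 (tower_loop A (Suc k))"
    unfolding hawaiian_earring_eq by (auto intro: block_between tower_loop_between)
  have "transport (\<lambda>t. detector n (tower_loop A k t)) =
      transport (\<lambda>t. detector n (join_loops (block A k) (loop_power 0 (Suc k) (tower_loop A (Suc k))) t))"
    by (rule transport_cong) (simp only: tower_loop_rec)
  then show ?thesis
    by (simp only: transport_detector_join[OF b(1) path_between_loop_power[OF b(2)]] transport_detector_power[OF b(2)])
qed

text \<open>The blocks before the \<open>n\<close>-th one collapse, so that the repetitions multiply to \<open>n!\<close>, and everything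
  after the \<open>n\<close>-th block collapses too.\<close>

lemma transport_detector_tower:
  "transport (\<lambda>t. detector n (tower_loop A 0 t)) 0 =
     (if n \<in> range (branch A) then (stretch_commutator ^^ fact n) 0 else 0)"
proof -
  let ?T = "\<lambda>k. transport (\<lambda>t. detector n (tower_loop A k t))"
  have start: "?T 0 = ?T k ^^ fact k" if "k \<le> n" for k
    using that
  proof (induction k)
    case (Suc k)
    have "detector n (block A k t) = 0" if "t \<in> {0..1}" for t
    proof (rule detector_other)
      show "block A k t \<in> earring_part {2 * k + 1, 2 * k + 2}"
        by (rule path_between_in[OF block_between that]) simp
      show "2 * n + 1 \<notin> {2 * k + 1, 2 * k + 2}" "2 * n + 2 \<notin> {2 * k + 1, 2 * k + 2}"
        using Suc.prems by (auto dest: arg_cong[where f = even])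
    qed
    then have "transport (\<lambda>t. detector n (block A k t)) = id" by (rule transport_detector_zero)
    then have "?T k = ?T (Suc k) ^^ Suc k" using transport_detector_tower_step[of n A k] by simp
    then show ?case using Suc by (simp only: funpow_mult fact_Suc of_nat_id)
  qed simp
  have "detector n (tower_loop A (Suc n) t) = 0" if "t \<in> {0..1}" for t
    by (rule detector_other[OF path_between_in[OF tower_loop_between[OF subset_refl] that]]) auto
  then have "?T (Suc n) = id" by (rule transport_detector_zero)
  then have Tn: "?T n = transport (\<lambda>t. detector n (block A n t))"
    using transport_detector_tower_step[of n A n] by (simp add: id_funpow)
  show ?thesis
  proof (cases "n \<in> range (branch A)")
    case True
    then have "?T n = stretch_commutator"
      unfolding Tn block_def by (simp only: if_True transport_detector_commutator)
    then show ?thesis using start[of n] True by simp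
  next
    case False
    then have "?T n = id"
      unfolding Tn block_def by (intro transport_detector_zero) simp
    then show ?thesis using start[of n] False by (simp add: id_funpow)
  qed
qed

section \<open>Coordinates on Griffiths' space\<close>

lemma collapse_rel_class_eq_iff:
  assumes "x \<in> topspace X" "y \<in> topspace X"
  shows "collapse_rel X A `` {x} = collapse_rel X A `` {y} \<longleftrightarrow> x = y \<or> x \<in> A \<and> y \<in> A"
proof
  assume eq: "collapse_rel X A `` {x} = collapse_rel X A `` {y}"
  have "x \<in> collapse_rel X A `` {x}" using assms by (auto simp: collapse_rel_def)
  then show "x = y \<or> x \<in> A \<and> y \<in> A" unfolding eq by (auto simp: collapse_rel_def)
qed (auto simp: collapse_rel_def)

abbreviation earring_space :: "complex topology" where
  "earring_space \<equiv> top_of_set hawaiian_earring"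

abbreviation earring_cylinder :: "(complex \<times> real) topology" where
  "earring_cylinder \<equiv> top_of_set (hawaiian_earring \<times> {0..1})"

definition cone_point :: "complex \<Rightarrow> real \<Rightarrow> (complex \<times> real) set" where
  "cone_point z t = cone_rel earring_space `` {(z, t)}"

definition cone_sum :: "(bool \<times> (complex \<times> real) set) topology" where
  "cone_sum = sum_topology (\<lambda>i. cone earring_space) UNIV"

definition glued_points :: "(bool \<times> (complex \<times> real) set) set" where
  "glued_points = {(False, cone_point 0 0), (True, cone_point 0 0)}"

definition griffiths_point :: "bool \<Rightarrow> complex \<Rightarrow> real \<Rightarrow> (bool \<times> (complex \<times> real) set) set" where
  "griffiths_point b z t = collapse_rel cone_sum glued_points `` {(b, cone_point z t)}"

lemma griffiths_space_eq: "griffiths_space = quotient_topology cone_sum (collapse_rel cone_sum glued_points)"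
  by (simp add: griffiths_space_def one_point_union_def cone_sum_def glued_points_def cone_base_def cone_point_def Let_def)

lemma cone_eq: "cone earring_space = quotient_topology earring_cylinder (cone_rel earring_space)"
  by (simp add: cone_def)

lemma cone_rel_eq: "cone_rel earring_space = collapse_rel earring_cylinder (hawaiian_earring \<times> {1})"
  by (simp add: cone_rel_def)

lemma topspace_cone: "topspace (cone earring_space) = {cone_point z t | z t. z \<in> hawaiian_earring \<and> t \<in> {0..1}}"
  unfolding cone_eq topspace_quotient_topology quotient_def cone_point_def
  by (auto simp del: atLeastAtMost_iff)

lemma cone_point_in: "z \<in> hawaiian_earring \<Longrightarrow> t \<in> {0..1} \<Longrightarrow> cone_point z t \<in> topspace (cone earring_space)"
  unfolding topspace_cone by blast

lemma zero_in_earring [simp]: "0 \<in> hawaiian_earring"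
  by (simp add: hawaiian_earring_eq earring_part_def)

lemma topspace_cone_sum: "topspace cone_sum = UNIV \<times> topspace (cone earring_space)"
  by (simp add: cone_sum_def comp_def)

lemma topspace_griffiths_space:
  "topspace griffiths_space = {griffiths_point b z t | b z t. z \<in> hawaiian_earring \<and> t \<in> {0..1}}"
  unfolding griffiths_space_eq topspace_quotient_topology topspace_cone_sum topspace_cone
  by (auto simp: quotient_def griffiths_point_def)

lemma griffiths_point_in:
  "z \<in> hawaiian_earring \<Longrightarrow> t \<in> {0..1} \<Longrightarrow> griffiths_point b z t \<in> topspace griffiths_space"
  unfolding topspace_griffiths_space by blast

lemma cone_point_eq_iff:
  assumes "z \<in> hawaiian_earring" "t \<in> {0..1}" "z' \<in> hawaiian_earring" "t' \<in> {0..1}"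
  shows "cone_point z t = cone_point z' t' \<longleftrightarrow> z = z' \<and> t = t' \<or> t = 1 \<and> t' = 1"
  unfolding cone_point_def cone_rel_eq
  by (subst collapse_rel_class_eq_iff) (use assms in auto)

text \<open>The second case is the apex of a cone, the third one the point where the cones are glued.\<close>

lemma griffiths_point_eq_iff:
  assumes "z \<in> hawaiian_earring" "t \<in> {0..1}" "z' \<in> hawaiian_earring" "t' \<in> {0..1}"
  shows "griffiths_point b z t = griffiths_point b' z' t' \<longleftrightarrow>
    b = b' \<and> z = z' \<and> t = t' \<or> b = b' \<and> t = 1 \<and> t' = 1 \<or> z = 0 \<and> z' = 0 \<and> t = 0 \<and> t' = 0"
proof -
  have "griffiths_point b z t = griffiths_point b' z' t' \<longleftrightarrow>
      (b, cone_point z t) = (b', cone_point z' t') \<or> (b, cone_point z t) \<in> glued_points \<and> (b', cone_point z' t') \<in> glued_points"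
    unfolding griffiths_point_def
    by (rule collapse_rel_class_eq_iff) (use assms in \<open>auto simp: topspace_cone_sum intro: cone_point_in\<close>)
  moreover have "(b, cone_point z t) \<in> glued_points \<longleftrightarrow> z = 0 \<and> t = 0"
    using assms by (cases b) (auto simp: glued_points_def cone_point_eq_iff)
  moreover have "(b', cone_point z' t') \<in> glued_points \<longleftrightarrow> z' = 0 \<and> t' = 0"
    using assms by (cases b') (auto simp: glued_points_def cone_point_eq_iff)
  ultimately show ?thesis using assms by (auto simp: cone_point_eq_iff)
qed

text \<open>The iterated quotient is a single quotient of two cylinders.\<close>

lemma openin_griffiths_space:
  "openin griffiths_space U \<longleftrightarrow> U \<subseteq> topspace griffiths_space \<and>
     (\<forall>b. openin earring_cylinder {x \<in> hawaiian_earring \<times> {0..1}. griffiths_point b (fst x) (snd x) \<in> U})"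
proof -
  let ?r = "collapse_rel cone_sum glued_points"
  have "openin (cone earring_space) {c. (b, c) \<in> {x \<in> topspace cone_sum. ?r `` {x} \<in> U}} \<longleftrightarrow>
      openin earring_cylinder {x \<in> hawaiian_earring \<times> {0..1}. griffiths_point b (fst x) (snd x) \<in> U}" (is "openin _ ?C \<longleftrightarrow> _") for b
  proof -
    have "?C \<subseteq> topspace (cone earring_space)" by (auto simp: topspace_cone_sum)
    then have "openin (cone earring_space) ?C \<longleftrightarrow>
        openin earring_cylinder {x \<in> topspace earring_cylinder. cone_rel earring_space `` {x} \<in> ?C}"
      unfolding cone_eq by (simp add: openin_quotient_topology)
    also have "{x \<in> topspace earring_cylinder. cone_rel earring_space `` {x} \<in> ?C} =
        {x \<in> hawaiian_earring \<times> {0..1}. griffiths_point b (fst x) (snd x) \<in> U}"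
      by (auto simp: topspace_cone_sum griffiths_point_def cone_point_def intro: cone_point_in[unfolded cone_point_def])
    finally show ?thesis .
  qed
  moreover have "{x \<in> topspace cone_sum. ?r `` {x} \<in> U} \<subseteq> Sigma UNIV (topspace \<circ> (\<lambda>i. cone earring_space))"
    by (auto simp: topspace_cone_sum)
  ultimately have "openin cone_sum {x \<in> topspace cone_sum. ?r `` {x} \<in> U} \<longleftrightarrow>
      (\<forall>b. openin earring_cylinder {x \<in> hawaiian_earring \<times> {0..1}. griffiths_point b (fst x) (snd x) \<in> U})"
    unfolding cone_sum_def[THEN arg_cong[where f = openin]] openin_sum_topology by simp
  then show ?thesis
    unfolding griffiths_space_eq openin_quotient_topology topspace_quotient_topology by simp
qed

lemma continuous_griffiths_point:
  "continuous_map earring_cylinder griffiths_space (\<lambda>x. griffiths_point b (fst x) (snd x))"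
  unfolding continuous_map_def
  by (auto intro: griffiths_point_in simp: openin_griffiths_space)

lemma continuous_map_griffiths_point:
  assumes "continuous_map T earring_space z" "continuous_map T (top_of_set {0..1}) t"
  shows "continuous_map T griffiths_space (\<lambda>x. griffiths_point b (z x) (t x))"
proof -
  have "continuous_map T earring_cylinder (\<lambda>x. (z x, t x))"
    using continuous_map_pairedI[OF assms] by simp
  from continuous_map_compose[OF this continuous_griffiths_point] show ?thesis
    by (simp add: comp_def)
qed

lemma continuous_map_from_griffiths_open:
  assumes U: "openin griffiths_space U" and F: "\<And>y. y \<in> U \<Longrightarrow> F y \<in> topspace Z"
    and c: "\<And>b. continuous_map (top_of_set {x \<in> hawaiian_earring \<times> {0..1}. griffiths_point b (fst x) (snd x) \<in> U}) Z
      (\<lambda>x. F (griffiths_point b (fst x) (snd x)))"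
  shows "continuous_map (subtopology griffiths_space U) Z F"
  unfolding continuous_map_def
proof (intro conjI allI impI)
  have UY: "U \<subseteq> topspace griffiths_space" using U by (rule openin_subset)
  then have tU: "topspace (subtopology griffiths_space U) = U" by auto
  show "F \<in> topspace (subtopology griffiths_space U) \<rightarrow> topspace Z" unfolding tU using F by blast
  fix W assume W: "openin Z W"
  have "openin griffiths_space {y \<in> U. F y \<in> W}"
    unfolding openin_griffiths_space
  proof (intro conjI allI)
    fix b
    let ?D = "{x \<in> hawaiian_earring \<times> {0..1}. griffiths_point b (fst x) (snd x) \<in> U}"
    have "openin (top_of_set ?D) {x \<in> topspace (top_of_set ?D). F (griffiths_point b (fst x) (snd x)) \<in> W}"
      using c W by (rule openin_continuous_map_preimage)
    moreover have "openin earring_cylinder ?D" using U unfolding openin_griffiths_space by blast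
    ultimately have "openin earring_cylinder {x \<in> topspace (top_of_set ?D). F (griffiths_point b (fst x) (snd x)) \<in> W}"
      by (metis (no_types, lifting) openin_trans)
    moreover have "{x \<in> topspace (top_of_set ?D). F (griffiths_point b (fst x) (snd x)) \<in> W} =
        {x \<in> hawaiian_earring \<times> {0..1}. griffiths_point b (fst x) (snd x) \<in> {y \<in> U. F y \<in> W}}"
      by auto
    ultimately show "openin earring_cylinder
        {x \<in> hawaiian_earring \<times> {0..1}. griffiths_point b (fst x) (snd x) \<in> {y \<in> U. F y \<in> W}}" by simp
  qed (use UY in auto)
  then show "openin (subtopology griffiths_space U) {y \<in> topspace (subtopology griffiths_space U). F y \<in> W}"
    unfolding tU openin_open_subtopology[OF U] by blast
qed

section \<open>The two pieces of Griffiths' space\<close>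

definition lower_part :: "(bool \<times> (complex \<times> real) set) set set" where
  "lower_part = {griffiths_point b z t | b z t. z \<in> hawaiian_earring \<and> 0 \<le> t \<and> t < 1}"

definition upper_part :: "bool \<Rightarrow> (bool \<times> (complex \<times> real) set) set set" where
  "upper_part b = {griffiths_point b z t | z t. z \<in> hawaiian_earring \<and> 0 < t \<and> t \<le> 1}"

lemma griffiths_point_in_lower_part:
  assumes "z \<in> hawaiian_earring" "t \<in> {0..1}"
  shows "griffiths_point b z t \<in> lower_part \<longleftrightarrow> t < 1"
proof
  assume "griffiths_point b z t \<in> lower_part"
  then obtain b' z' t' where *: "z' \<in> hawaiian_earring" "0 \<le> t'" "t' < 1" "griffiths_point b z t = griffiths_point b' z' t'"
    unfolding lower_part_def by blast
  then show "t < 1" using assms griffiths_point_eq_iff[of z t z' t' b b'] by auto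
qed (use assms in \<open>auto simp: lower_part_def\<close>)

lemma griffiths_point_in_upper_part:
  assumes "z \<in> hawaiian_earring" "t \<in> {0..1}"
  shows "griffiths_point b z t \<in> upper_part b' \<longleftrightarrow> t > 0 \<and> b = b'"
proof
  assume "griffiths_point b z t \<in> upper_part b'"
  then obtain z' t' where *: "z' \<in> hawaiian_earring" "0 < t'" "t' \<le> 1" "griffiths_point b z t = griffiths_point b' z' t'"
    unfolding upper_part_def by blast
  then show "t > 0 \<and> b = b'" using assms griffiths_point_eq_iff[of z t z' t' b b'] by auto
qed (use assms in \<open>auto simp: upper_part_def\<close>)

lemma openin_lower_part: "openin griffiths_space lower_part"
  unfolding openin_griffiths_space
proof (intro conjI allI)
  show "lower_part \<subseteq> topspace griffiths_space"
    unfolding lower_part_def by (auto intro: griffiths_point_in)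
  fix b
  have "{x \<in> hawaiian_earring \<times> {0..1}. griffiths_point b (fst x) (snd x) \<in> lower_part} =
      hawaiian_earring \<times> {0..1} \<inter> {x. snd x < 1}"
    by (auto simp: griffiths_point_in_lower_part)
  moreover have "open {x :: complex \<times> real. snd x < 1}"
    by (intro open_Collect_less continuous_intros)
  ultimately show "openin earring_cylinder {x \<in> hawaiian_earring \<times> {0..1}. griffiths_point b (fst x) (snd x) \<in> lower_part}"
    by (simp only: openin_open_Int)
qed

lemma openin_upper_part: "openin griffiths_space (upper_part c)"
  unfolding openin_griffiths_space
proof (intro conjI allI)
  show "upper_part c \<subseteq> topspace griffiths_space"
    unfolding upper_part_def by (auto intro: griffiths_point_in)
  fix b
  have "{x \<in> hawaiian_earring \<times> {0..1}. griffiths_point b (fst x) (snd x) \<in> upper_part c} =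
      hawaiian_earring \<times> {0..1} \<inter> {x. b = c \<and> snd x > 0}"
    by (auto simp: griffiths_point_in_upper_part)
  moreover have "open {x :: complex \<times> real. b = c \<and> snd x > 0}"
    by (intro open_Collect_conj open_Collect_const open_Collect_less continuous_intros)
  ultimately show "openin earring_cylinder {x \<in> hawaiian_earring \<times> {0..1}. griffiths_point b (fst x) (snd x) \<in> upper_part c}"
    by (simp only: openin_open_Int)
qed

lemma lower_upper_cover: "lower_part \<union> (upper_part False \<union> upper_part True) = topspace griffiths_space"
proof (intro equalityI subsetI)
  fix y assume "y \<in> topspace griffiths_space"
  then obtain b z t where y: "y = griffiths_point b z t" "z \<in> hawaiian_earring" "t \<in> {0..1}"
    unfolding topspace_griffiths_space by blast
  show "y \<in> lower_part \<union> (upper_part False \<union> upper_part True)"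
    using y by (cases b; cases "t < 1") (auto simp: griffiths_point_in_lower_part griffiths_point_in_upper_part)
qed (use openin_lower_part openin_upper_part openin_subset in blast)

text \<open>The detector of the earrings is extended along the generators of the cones. The description is unique
  below the apexes: the only point with two coordinates is the gluing point, where both values are
  zero.\<close>

definition griffiths_detector :: "nat \<Rightarrow> (bool \<times> (complex \<times> real) set) set \<Rightarrow> complex" where
  "griffiths_detector n y = (THE w. \<exists>b z t. z \<in> hawaiian_earring \<and> t \<in> {0..1} \<and> y = griffiths_point b z t \<and> w = circle_detector n b z)"

lemma griffiths_detector_point:
  assumes "z \<in> hawaiian_earring" "t \<in> {0..1}" "t < 1"
  shows "griffiths_detector n (griffiths_point b z t) = circle_detector n b z"
  unfolding griffiths_detector_def
proof (rule the_equality)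
  fix w assume "\<exists>b' z' t'. z' \<in> hawaiian_earring \<and> t' \<in> {0..1} \<and> griffiths_point b z t = griffiths_point b' z' t' \<and> w = circle_detector n b' z'"
  then obtain b' z' t' where *: "z' \<in> hawaiian_earring" "t' \<in> {0..1}"
    "griffiths_point b z t = griffiths_point b' z' t'" "w = circle_detector n b' z'" by blast
  have "b = b' \<and> z = z' \<or> z = 0 \<and> z' = 0"
    using *(3) assms griffiths_point_eq_iff[OF assms(1,2) *(1,2)] by auto
  then show "w = circle_detector n b z" using *(4) by auto
qed (use assms in blast)

lemma griffiths_detector_in: "y \<in> lower_part \<Longrightarrow> griffiths_detector n y \<in> two_circles"
proof -
  assume "y \<in> lower_part"
  then obtain b z t where "y = griffiths_point b z t" "z \<in> hawaiian_earring" "0 \<le> t" "t < 1"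
    unfolding lower_part_def by blast
  then show ?thesis
    using circle_detector_in[of n b z] by (cases b) (auto simp: griffiths_detector_point two_circles_def)
qed

lemma griffiths_detector_upper:
  assumes "y \<in> lower_part" "y \<in> upper_part b"
  shows "griffiths_detector n y \<in> (if b then sphere (- 1) 1 else sphere 1 1)"
proof -
  obtain z t where y: "y = griffiths_point b z t" "z \<in> hawaiian_earring" "0 < t" "t \<le> 1"
    using assms(2) unfolding upper_part_def by blast
  then have "t < 1" using assms(1) griffiths_point_in_lower_part[of z t b] by simp
  then show ?thesis using y circle_detector_in[of n b z] by (simp add: griffiths_detector_point)
qed

lemma continuous_griffiths_detector:
  "continuous_map (subtopology griffiths_space lower_part) (top_of_set two_circles) (griffiths_detector n)"
proof (rule continuous_map_from_griffiths_open[OF openin_lower_part])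
  fix b
  let ?D = "{x \<in> hawaiian_earring \<times> {0..1}. griffiths_point b (fst x) (snd x) \<in> lower_part}"
  have "continuous_on ?D (\<lambda>x. circle_detector n b (fst x))"
    by (rule continuous_on_compose2[OF continuous_circle_detector]) (auto intro!: continuous_intros)
  moreover have "griffiths_detector n (griffiths_point b (fst x) (snd x)) = circle_detector n b (fst x)" if "x \<in> ?D" for x
    using that by (auto simp: griffiths_point_in_lower_part intro!: griffiths_detector_point)
  ultimately have "continuous_on ?D (\<lambda>x. griffiths_detector n (griffiths_point b (fst x) (snd x)))"
    by (simp cong: continuous_on_cong_simp)
  then show "continuous_map (top_of_set ?D) (top_of_set two_circles) (\<lambda>x. griffiths_detector n (griffiths_point b (fst x) (snd x)))"
    by (auto simp: continuous_map_in_subtopology intro: griffiths_detector_in)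
qed (simp add: griffiths_detector_in)

section \<open>The Hawaiian earring in Griffiths' space\<close>

definition griffiths_base :: "(bool \<times> (complex \<times> real) set) set" where
  "griffiths_base = griffiths_point False 0 0"

text \<open>The circles are distributed to the cones by the parity of their indices; both cones contain a full
  earring, of which only every other circle is used.\<close>

definition earring_to_griffiths :: "complex \<Rightarrow> (bool \<times> (complex \<times> real) set) set" where
  "earring_to_griffiths z = griffiths_point (z \<notin> earring_part {m. odd m}) z 0"

abbreviation griffiths_homotopic where
  "griffiths_homotopic \<equiv> path_homotopic griffiths_space griffiths_base griffiths_base"

lemma griffiths_point_base: "griffiths_point b 0 0 = griffiths_base"
  unfolding griffiths_base_def by (subst griffiths_point_eq_iff) auto

lemma earring_to_griffiths_zero [simp]: "earring_to_griffiths 0 = griffiths_base"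
  by (simp add: earring_to_griffiths_def griffiths_point_base)

lemma continuous_earring_to_griffiths: "continuous_map earring_space griffiths_space earring_to_griffiths"
proof -
  have c: "continuous_map (top_of_set (earring_part M)) griffiths_space (\<lambda>z. griffiths_point b z 0)" for b M
    by (rule continuous_map_griffiths_point)
      (auto simp: continuous_map_in_subtopology hawaiian_earring_eq intro!: earring_part_mono[THEN subsetD, of M UNIV])
  have "continuous_map earring_space griffiths_space
      (\<lambda>z. if z \<in> earring_part {m. odd m} then griffiths_point False z 0 else griffiths_point True z 0)"
    by (rule continuous_map_earring_cases[OF c c, where N = "{m. even m}"]) (auto simp: griffiths_point_base)
  moreover have "(\<lambda>z. if z \<in> earring_part {m. odd m} then griffiths_point False z 0 else griffiths_point True z 0) = earring_to_griffiths"
    by (auto simp: earring_to_griffiths_def fun_eq_iff)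
  ultimately show ?thesis by simp
qed

lemma griffiths_detector_earring:
  "z \<in> hawaiian_earring \<Longrightarrow> griffiths_detector n (earring_to_griffiths z) = detector n z"
  unfolding earring_to_griffiths_def detector_def by (rule griffiths_detector_point) auto

lemma earring_to_griffiths_lower: "z \<in> hawaiian_earring \<Longrightarrow> earring_to_griffiths z \<in> lower_part"
  unfolding earring_to_griffiths_def by (simp add: griffiths_point_in_lower_part)

lemma path_between_continuous_image:
  assumes "path_between X a b p" "continuous_map X Y f"
  shows "path_between Y (f a) (f b) (\<lambda>t. f (p t))"
  using assms continuous_map_compose[of "top_of_set {0..1}" X p Y f]
  by (auto simp: path_between_def pathin_def comp_def)

text \<open>A loop in the base of a cone is pushed up along the sides of the square that it spans
  together with the height; what remains is a path along one generator and back.\<close>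

lemma null_homotopic_in_cone:
  assumes p: "path_between earring_space 0 0 p"
  shows "griffiths_homotopic (\<lambda>t. griffiths_point b (p t) 0) (\<lambda>t. griffiths_base)"
proof -
  \<comment> \<open>\<open>(c1, c2)\<close> runs along the left, upper and right side of the unit square\<close>
  define c1 where "c1 t = max 0 (min 1 (3 * t - 1))" for t :: real
  define c2 where "c2 t = max 0 (min 1 (min (3 * t) (3 - 3 * t)))" for t :: real
  have c01: "c1 t \<in> {0..1}" "c2 t \<in> {0..1}" for t by (auto simp: c1_def c2_def)
  have cc: "continuous_on S c1" "continuous_on S c2" for S
    unfolding c1_def c2_def by (intro continuous_intros)+
  have cend: "c1 0 = 0" "c2 0 = 0" "c1 1 = 1" "c2 1 = 0" by (simp_all add: c1_def c2_def)
  have pin: "pathin earring_space p" "p 0 = 0" "p 1 = 0" using p by (auto simp: path_between_def)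
  have pH: "p t \<in> hawaiian_earring" if "t \<in> {0..1}" for t
    using path_between_in[OF p that] .
  let ?S = "{0..1} \<times> {0..1} :: (real \<times> real) set"
  have "griffiths_homotopic (\<lambda>t. griffiths_point b (p t) 0) (\<lambda>t. griffiths_point b (p (c1 t)) (c2 t))"
  proof (rule path_homotopicI)
    show "continuous_map (top_of_set ?S) griffiths_space
       (\<lambda>z. griffiths_point b (p ((1 - fst z) * snd z + fst z * c1 (snd z))) (fst z * c2 (snd z)))"
    proof (rule continuous_map_griffiths_point)
      show "continuous_map (top_of_set ?S) earring_space (\<lambda>z. p ((1 - fst z) * snd z + fst z * c1 (snd z)))"
      proof (rule continuous_map_compose_path[OF pin(1)])
        show "continuous_on ?S (\<lambda>z. (1 - fst z) * snd z + fst z * c1 (snd z))"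
          by (intro continuous_intros continuous_on_compose2[OF cc(1)[of UNIV]]) auto
        fix z :: "real \<times> real" assume "z \<in> ?S"
        then show "(1 - fst z) * snd z + fst z * c1 (snd z) \<in> {0..1}"
          using convex_bound_le[of "snd z" 1 "c1 (snd z)" "1 - fst z" "fst z"] c01(1)[of "snd z"] by auto
      qed
      have "continuous_on ?S (\<lambda>z. fst z * c2 (snd z))"
        by (intro continuous_intros continuous_on_compose2[OF cc(2)[of UNIV]]) auto
      then show "continuous_map (top_of_set ?S) (top_of_set {0..1}) (\<lambda>z. fst z * c2 (snd z))"
        using c01(2) by (auto simp: continuous_map_in_subtopology mult_le_one)
    qed
  qed (use cend pin griffiths_point_base in \<open>auto\<close>)
  moreover have "griffiths_point b (p (c1 t)) (c2 t) = griffiths_point b 0 (c2 t)" if "t \<in> {0..1}" for t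
  proof -
    have "c1 t = 0 \<or> c1 t = 1 \<or> c2 t = 1" unfolding c1_def c2_def by linarith
    then show ?thesis
      using pin pH[OF c01(1)] c01 by (subst griffiths_point_eq_iff) auto
  qed
  moreover have "griffiths_homotopic (\<lambda>t. griffiths_point b (p (c1 t)) (c2 t)) (\<lambda>t. griffiths_base)"
  proof (rule path_homotopicI)
    have "continuous_on ?S (\<lambda>z. (1 - fst z) * c2 (snd z))"
      by (intro continuous_intros continuous_on_compose2[OF cc(2)[of UNIV]]) auto
    then show "continuous_map (top_of_set ?S) griffiths_space (\<lambda>z. griffiths_point b 0 ((1 - fst z) * c2 (snd z)))"
      using c01(2) by (intro continuous_map_griffiths_point) (auto simp: continuous_map_in_subtopology mult_le_one)
  qed (use calculation(2) cend griffiths_point_base in auto)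
  ultimately show ?thesis by (meson homotopic_with_trans)
qed

lemma griffiths_path_to_base:
  assumes "y \<in> topspace griffiths_space"
  obtains l where "path_between griffiths_space y griffiths_base l"
proof -
  obtain b z t where y: "y = griffiths_point b z t" "z \<in> hawaiian_earring" "t \<in> {0..1}"
    using assms unfolding topspace_griffiths_space by blast
  have "path_between griffiths_space griffiths_base (griffiths_point b 0 1) (\<lambda>s. griffiths_point b 0 s)"
    unfolding path_between_def pathin_def
    by (auto simp: griffiths_point_base intro!: continuous_map_griffiths_point)
  moreover have "path_between griffiths_space (griffiths_point b z 1) y (\<lambda>s. griffiths_point b z (1 - s * (1 - t)))"
    unfolding path_between_def pathin_def y(1)
    using y(2,3) by (auto simp: continuous_map_in_subtopology mult_le_one intro!: continuous_map_griffiths_point continuous_intros)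
  moreover have "griffiths_point b 0 1 = griffiths_point b z 1"
    using y(2) by (subst griffiths_point_eq_iff) auto
  ultimately have "path_between griffiths_space griffiths_base y
      (join_loops (\<lambda>s. griffiths_point b 0 s) (\<lambda>s. griffiths_point b z (1 - s * (1 - t))))"
    using path_between_join[of griffiths_space griffiths_base "griffiths_point b 0 1"] by simp
  from path_between_reverse[OF this] show thesis by (rule that)
qed

section \<open>Paths as singular simplices\<close>

(* the degree of one-dimensional chains is kept in the form 1 *)
declare One_nat_def [simp del]

definition path_simplex :: "(real \<Rightarrow> 'a) \<Rightarrow> (nat \<Rightarrow> real) \<Rightarrow> 'a" where
  "path_simplex p = restrict (\<lambda>x. p (x 1)) (standard_simplex 1)"

definition edge_point :: "real \<Rightarrow> nat \<Rightarrow> real" where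
  "edge_point t = (\<lambda>i. if i = 0 then 1 - t else if i = 1 then t else 0)"

text \<open>The barycentric coordinates of a point of the triangle with vertices \<open>(0, 0)\<close>, \<open>(1, 0)\<close> and \<open>(1, 1)\<close>, in
  this order.\<close>

definition triangle_point :: "real \<times> real \<Rightarrow> nat \<Rightarrow> real" where
  "triangle_point z = (\<lambda>i. if i = 0 then 1 - fst z else if i = 1 then fst z - snd z else if i = 2 then snd z else 0)"

lemma atMost_nat_numerals: "{..1::nat} = {0, 1}" "{..Suc 0} = {0, 1}" "{..2::nat} = {0, 1, 2}"
  by auto

lemma powertop_real_UNIV_eq: "powertop_real UNIV = (euclidean :: (nat \<Rightarrow> real) topology)"
  by (simp add: euclidean_product_topology)

lemma standard_simplex_1_cases:
  assumes "x \<in> standard_simplex 1"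
  shows "x = edge_point (x 1)" "x 1 \<in> {0..1}" "x 0 = 1 - x 1"
proof -
  have "x 0 + x 1 = 1" "\<forall>i>1. x i = 0" "x 1 \<in> {0..1}"
    using assms by (auto simp: standard_simplex_def atMost_nat_numerals)
  then show "x = edge_point (x 1)" "x 1 \<in> {0..1}" "x 0 = 1 - x 1"
    by (auto simp: edge_point_def fun_eq_iff)
qed

lemma edge_point_in: "t \<in> {0..1} \<Longrightarrow> edge_point t \<in> standard_simplex 1"
  by (auto simp: standard_simplex_def edge_point_def atMost_nat_numerals)

lemma triangle_point_in: "z \<in> std_triangle \<Longrightarrow> triangle_point z \<in> standard_simplex 2"
  by (auto simp: standard_simplex_def triangle_point_def atMost_nat_numerals std_triangle_def)

lemma path_simplex_edge_point: "t \<in> {0..1} \<Longrightarrow> path_simplex p (edge_point t) = p t"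
  using edge_point_in by (simp add: path_simplex_def) (simp add: edge_point_def)

lemma path_simplex_cong:
  assumes "\<And>t. t \<in> {0..1} \<Longrightarrow> p t = q t" shows "path_simplex p = path_simplex q"
  unfolding path_simplex_def using assms standard_simplex_1_cases(2) by (intro restrict_ext) blast

lemma continuous_on_coordinate: "continuous_on S (\<lambda>x :: nat \<Rightarrow> real. x i)"
  using continuous_on_product_coordinates by (rule continuous_on_subset) simp

lemma continuous_map_coordinate:
  "continuous_map (subtopology (powertop_real UNIV) S) euclideanreal (\<lambda>x :: nat \<Rightarrow> real. x i)"
  by (simp add: powertop_real_UNIV_eq continuous_on_coordinate)

lemma singular_simplex_path_simplex:
  assumes "pathin X p"
  shows "singular_simplex 1 X (path_simplex p)"
  unfolding singular_simplex_def
proof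
  have "continuous_map (subtopology (powertop_real UNIV) (standard_simplex 1)) (top_of_set {0..1}) (\<lambda>x. x 1)"
    using standard_simplex_1_cases(2)
    by (auto simp: continuous_map_in_subtopology continuous_map_coordinate)
  from continuous_map_compose[OF this assms[unfolded pathin_def]]
  have "continuous_map (subtopology (powertop_real UNIV) (standard_simplex 1)) X (\<lambda>x. p (x 1))"
    by (simp add: comp_def)
  then show "continuous_map (subtopology (powertop_real UNIV) (standard_simplex 1)) X (path_simplex p)"
    by (rule continuous_map_eq) (simp add: path_simplex_def)
qed (simp add: path_simplex_def)

lemma chain_map_path_simplex: "chain_map 1 f (frag_of (path_simplex p)) = frag_of (path_simplex (\<lambda>t. f (p t)))"
proof -
  have "simplex_map 1 f (path_simplex p) = path_simplex (\<lambda>t. f (p t))"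
    by (auto simp: simplex_map_def path_simplex_def)
  then show ?thesis by simp
qed

lemma continuous_edge_point: "continuous_on S edge_point"
proof (rule continuous_on_coordinatewise_then_product)
  fix i
  show "continuous_on S (\<lambda>x. edge_point x i)"
    unfolding edge_point_def by (cases "i = 0"; cases "i = 1") (auto intro!: continuous_intros)
qed

lemma continuous_triangle_point: "continuous_on S triangle_point"
proof (rule continuous_on_coordinatewise_then_product)
  fix i
  show "continuous_on S (\<lambda>x. triangle_point x i)"
    unfolding triangle_point_def
    by (cases "i = 0"; cases "i = 1"; cases "i = 2") (auto intro!: continuous_intros)
qed

definition triangle_simplex :: "(real \<times> real \<Rightarrow> 'a) \<Rightarrow> (nat \<Rightarrow> real) \<Rightarrow> 'a" where
  "triangle_simplex G = restrict (\<lambda>x. G (x 1 + x 2, x 2)) (standard_simplex 2)"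

lemma standard_simplex_2_cases:
  assumes "x \<in> standard_simplex 2"
  shows "(x 1 + x 2, x 2) \<in> std_triangle"
proof -
  have "x 0 + x 1 + x 2 = 1" "\<forall>i. x i \<ge> 0"
    using assms by (auto simp: standard_simplex_def atMost_nat_numerals algebra_simps)
  then show ?thesis by (auto simp: std_triangle_def) (metis add.assoc add_increasing le_add_same_cancel2 order_refl)
qed

lemma singular_simplex_triangle_simplex:
  assumes "continuous_map (top_of_set std_triangle) X G"
  shows "singular_simplex 2 X (triangle_simplex G)"
  unfolding singular_simplex_def
proof
  have "continuous_map (subtopology (powertop_real UNIV) (standard_simplex 2)) (top_of_set std_triangle)
      (\<lambda>x. (x 1 + x 2, x 2))"
    using standard_simplex_2_cases
    by (auto simp: continuous_map_in_subtopology powertop_real_UNIV_eq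
        intro!: continuous_on_Pair continuous_on_add continuous_on_coordinate)
  from continuous_map_compose[OF this assms]
  have "continuous_map (subtopology (powertop_real UNIV) (standard_simplex 2)) X (\<lambda>x. G (x 1 + x 2, x 2))"
    by (simp add: comp_def)
  then show "continuous_map (subtopology (powertop_real UNIV) (standard_simplex 2)) X (triangle_simplex G)"
    by (rule continuous_map_eq) (simp add: triangle_simplex_def)
qed (simp add: triangle_simplex_def)

lemma singular_face_triangle_simplex:
  "singular_face 2 0 (triangle_simplex G) = path_simplex (\<lambda>t. G (1, t))"
  "singular_face 2 1 (triangle_simplex G) = path_simplex (\<lambda>t. G (t, t))"
  "singular_face 2 2 (triangle_simplex G) = path_simplex (\<lambda>t. G (t, 0))"
proof -
  have "singular_face 2 k (triangle_simplex G) =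
      restrict (\<lambda>x. G (simplical_face k x 1 + simplical_face k x 2, simplical_face k x 2)) (standard_simplex 1)"
    if "k \<le> 2" for k
    using that simplical_face_in_standard_simplex[of 2 k]
    by (auto simp: singular_face_def triangle_simplex_def fun_eq_iff restrict_def)
  note * = this
  show "singular_face 2 0 (triangle_simplex G) = path_simplex (\<lambda>t. G (1, t))"
    "singular_face 2 1 (triangle_simplex G) = path_simplex (\<lambda>t. G (t, t))"
    "singular_face 2 2 (triangle_simplex G) = path_simplex (\<lambda>t. G (t, 0))"
    unfolding *[of 0, simplified] *[of 1, simplified] *[of 2, simplified] path_simplex_def
    by (auto intro!: restrict_ext simp: simplical_face_def standard_simplex_1_cases(3) simp flip: One_nat_def)
qed

lemma chain_boundary_2_of:
  "chain_boundary 2 (frag_of f) = frag_of (singular_face 2 0 f) - frag_of (singular_face 2 1 f) + frag_of (singular_face 2 2 f)"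
  by (simp add: chain_boundary_of atMost_nat_numerals algebra_simps)

text \<open>The diagonal of a singular triangle is homologous to the sum of the two other sides; concatenation,
  reversal and homotopy of paths are all treated by suitable choices of \<open>G\<close>.\<close>

lemma homologous_triangle:
  assumes "continuous_map (top_of_set std_triangle) X G"
  shows "homologous_rel 1 X {} (frag_of (path_simplex (\<lambda>t. G (t, t))))
    (frag_of (path_simplex (\<lambda>t. G (t, 0))) + frag_of (path_simplex (\<lambda>t. G (1, t))))"
proof -
  have "singular_relboundary 1 X {} (chain_boundary 2 (frag_of (triangle_simplex G)))"
    unfolding singular_boundary
    using singular_simplex_triangle_simplex[OF assms]
    by (intro exI[of _ "frag_of (triangle_simplex G)"]) (simp add: singular_chain_of Suc_1)
  from singular_relboundary_minus[THEN iffD2, OF this]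
  show ?thesis
    by (simp add: homologous_rel_def chain_boundary_2_of singular_face_triangle_simplex algebra_simps)
qed

lemma homologous_const:
  assumes "a \<in> topspace X"
  shows "homologous_rel 1 X {} (frag_of (path_simplex (\<lambda>t. a))) 0"
proof -
  have "homologous_rel 1 X {} (frag_of (path_simplex (\<lambda>t. a)))
      (frag_of (path_simplex (\<lambda>t. a)) + frag_of (path_simplex (\<lambda>t. a)))"
    using homologous_triangle[of X "\<lambda>z. a"] assms by simp
  then have "singular_relboundary 1 X {} (- frag_of (path_simplex (\<lambda>t. a)))"
    by (simp add: homologous_rel_def)
  then show ?thesis
    by (simp add: homologous_rel_def singular_relboundary_minus)
qed

lemma homologous_join_loops:
  assumes j: "pathin X (join_loops p q)" and "p 1 = q 0"
  shows "homologous_rel 1 X {} (frag_of (path_simplex (join_loops p q)))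
    (frag_of (path_simplex p) + frag_of (path_simplex q))"
proof -
  let ?G = "\<lambda>z. join_loops p q ((fst z + snd z) / 2)"
  have "continuous_map (top_of_set std_triangle) X ?G"
    by (rule continuous_map_compose_path[OF j]) (auto simp: std_triangle_def intro!: continuous_intros)
  from homologous_triangle[OF this]
  have "homologous_rel 1 X {} (frag_of (path_simplex (join_loops p q)))
    (frag_of (path_simplex (\<lambda>t. join_loops p q (t / 2))) + frag_of (path_simplex (\<lambda>t. join_loops p q ((1 + t) / 2))))"
    by simp
  moreover have "path_simplex (\<lambda>t. join_loops p q (t / 2)) = path_simplex p"
    by (rule path_simplex_cong) (simp add: join_loops_first)
  moreover have "path_simplex (\<lambda>t. join_loops p q ((1 + t) / 2)) = path_simplex q"
    by (rule path_simplex_cong) (use join_loops_second[of _ p q] assms(2) in \<open>simp add: add_divide_distrib\<close>)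
  ultimately show ?thesis by simp
qed

lemma pathin_topspace: "pathin X p \<Longrightarrow> t \<in> {0..1} \<Longrightarrow> p t \<in> topspace X"
  unfolding pathin_def continuous_map_def by auto

lemma homologous_reverse:
  assumes p: "pathin X p"
  shows "homologous_rel 1 X {} (frag_of (path_simplex p) + frag_of (path_simplex (\<lambda>t. p (1 - t)))) 0"
proof -
  have "continuous_map (top_of_set std_triangle) X (\<lambda>z. p (fst z - snd z))"
    by (rule continuous_map_compose_path[OF p]) (auto simp: std_triangle_def intro!: continuous_intros)
  from homologous_triangle[OF this]
  have "homologous_rel 1 X {} (frag_of (path_simplex (\<lambda>t. p 0)))
      (frag_of (path_simplex p) + frag_of (path_simplex (\<lambda>t. p (1 - t))))"
    by simp
  moreover have "homologous_rel 1 X {} (frag_of (path_simplex (\<lambda>t. p 0))) 0"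
    by (rule homologous_const) (use pathin_topspace[OF p, of 0] in simp)
  ultimately show ?thesis
    using homologous_rel_trans homologous_rel_sym[THEN iffD1] by blast
qed

text \<open>The square of a homotopy is cut along its diagonal into two singular triangles; the constant
  sides are boundaries themselves.\<close>

lemma homologous_if_homotopic:
  assumes "homotopic_with (\<lambda>r. r 0 = a \<and> r 1 = b) (top_of_set {0..1}) X p q"
  shows "homologous_rel 1 X {} (frag_of (path_simplex p)) (frag_of (path_simplex q))"
proof -
  obtain h where h: "continuous_map (prod_topology (top_of_set {0..1::real}) (top_of_set {0..1::real})) X h"
    "\<And>t. t \<in> {0..1} \<Longrightarrow> h (t, 0) = a \<and> h (t, 1) = b" "\<And>x. h (0, x) = p x" "\<And>x. h (1, x) = q x"
    using assms unfolding homotopic_with_def by auto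
  have hc: "continuous_map (top_of_set std_triangle) X (\<lambda>z. h (f z))"
    if "continuous_on std_triangle f" "f \<in> std_triangle \<rightarrow> {0..1} \<times> {0..1}" for f
  proof -
    have "continuous_map (top_of_set std_triangle) (top_of_set ({0..1} \<times> {0..1})) f"
      using that by (auto simp: continuous_map_in_subtopology)
    then have "continuous_map (top_of_set std_triangle) (prod_topology (top_of_set {0..1}) (top_of_set {0..1})) f"
      by simp
    from continuous_map_compose[OF this h(1)] show ?thesis by (simp add: comp_def)
  qed
  have top: "a \<in> topspace X" "b \<in> topspace X"
    using h(1) h(2)[of 0] by (auto simp: continuous_map_def Pi_iff)
  let ?d = "frag_of (path_simplex (\<lambda>t. h (t, t)))"
  have "homologous_rel 1 X {} ?d
      (frag_of (path_simplex (\<lambda>t. h (t, 0))) + frag_of (path_simplex (\<lambda>t. h (1, t))))"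
    by (rule homologous_triangle[OF hc[of "\<lambda>z. z"]])
      (auto simp: std_triangle_def intro!: continuous_intros)
  moreover have "path_simplex (\<lambda>t. h (t, 0)) = path_simplex (\<lambda>t. a)"
    by (rule path_simplex_cong) (use h in auto)
  ultimately have 1: "homologous_rel 1 X {} ?d (frag_of (path_simplex (\<lambda>t. a)) + frag_of (path_simplex q))"
    using h(4) by simp
  have "homologous_rel 1 X {} ?d
      (frag_of (path_simplex (\<lambda>t. h (0, t))) + frag_of (path_simplex (\<lambda>t. h (t, 1))))"
    using homologous_triangle[OF hc[of "\<lambda>z. (snd z, fst z)"]]
    by (force simp: std_triangle_def intro!: continuous_intros)
  moreover have "path_simplex (\<lambda>t. h (t, 1)) = path_simplex (\<lambda>t. b)"
    by (rule path_simplex_cong) (use h in auto)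
  ultimately have 2: "homologous_rel 1 X {} ?d (frag_of (path_simplex p) + frag_of (path_simplex (\<lambda>t. b)))"
    using h(3) by simp
  have 3: "homologous_rel 1 X {} (frag_of (path_simplex (\<lambda>t. a)) + frag_of (path_simplex q)) (0 + frag_of (path_simplex q))"
    "homologous_rel 1 X {} (frag_of (path_simplex p) + frag_of (path_simplex (\<lambda>t. b))) (frag_of (path_simplex p) + 0)"
    by (intro homologous_rel_add homologous_const top homologous_rel_refl)+
  have "homologous_rel 1 X {} ?d (frag_of (path_simplex q))"
    using homologous_rel_trans[OF 3(1) 1] by simp
  moreover have "homologous_rel 1 X {} ?d (frag_of (path_simplex p))"
    using homologous_rel_trans[OF 3(2) 2] by simp
  ultimately show ?thesis
    using homologous_rel_trans homologous_rel_sym[THEN iffD1] by blast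
qed

lemma singular_relcycle_loop:
  assumes "pathin X p" "p 0 = p 1"
  shows "singular_relcycle 1 X {} (frag_of (path_simplex p))"
  unfolding singular_cycle
proof
  show "singular_chain 1 X (frag_of (path_simplex p))"
    using singular_simplex_path_simplex[OF assms(1)] by (simp add: singular_chain_of)
  have "simplical_face 0 x \<in> standard_simplex 1 \<and> simplical_face 1 x \<in> standard_simplex 1"
    if "x \<in> standard_simplex 0" for x
    using that simplical_face_in_standard_simplex[of 1 _ x] by auto
  then have "path_simplex p (simplical_face 0 x) = path_simplex p (simplical_face 1 x)"
    if "x \<in> standard_simplex 0" for x
  proof -
    have "x 0 = 1" using standard_simplex_0 that by auto
    then show ?thesis
      using assms(2) that \<open>\<And>x. x \<in> standard_simplex 0 \<Longrightarrow> simplical_face 0 x \<in> _ \<and> simplical_face 1 x \<in> _\<close>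
      by (simp add: path_simplex_def) (simp add: simplical_face_def)
  qed
  then have "singular_face 1 0 (path_simplex p) = singular_face 1 1 (path_simplex p)"
    by (auto simp: singular_face_def One_nat_def intro!: restrict_ext)
  then show "chain_boundary 1 (frag_of (path_simplex p)) = 0"
    by (simp add: chain_boundary_of atMost_nat_numerals)
qed

section \<open>Classes of cycles\<close>

abbreviation hclass :: "'a topology \<Rightarrow> 'a chain \<Rightarrow> 'a chain set" where
  "hclass X c \<equiv> homologous_rel_set 1 X {} c"

lemma homology_group_1: "homology_group 1 X = homology_group (int 1) X"
  by simp

lemma hclass_in_carrier:
  "singular_relcycle 1 X {} c \<Longrightarrow> hclass X c \<in> carrier (homology_group 1 X)"
  unfolding homology_group_1 carrier_relative_homology_group by blast

lemma hclass_mult: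
  assumes "singular_relcycle 1 X {} c" "singular_relcycle 1 X {} d"
  shows "hclass X c \<otimes>\<^bsub>homology_group 1 X\<^esub> hclass X d = hclass X (c + d)"
proof -
  have "(\<lambda>c. hclass X c) \<in> hom (relcycle_group 1 X {}) (homology_group 1 X)"
    using normal.r_coset_hom_Mod[OF normal_subgroup_singular_relboundary_relcycle, of 1 X "{}"]
    unfolding homology_group_1 nontrivial_relative_homology_group right_coset_singular_relboundary by simp
  from hom_mult[OF this, of c d] assms show ?thesis by simp
qed

lemma hclass_zero: "hclass X 0 = \<one>\<^bsub>homology_group 1 X\<^esub>"
  unfolding homology_group_1 one_relative_homology_group by (simp add: homologous_rel_set_eq_relboundary)

lemma hclass_nat_pow:
  assumes "singular_relcycle 1 X {} c"
  shows "hclass X c [^]\<^bsub>homology_group 1 X\<^esub> (n::nat) = hclass X (frag_cmul (int n) c)"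
proof (induction n)
  case 0
  then show ?case by (simp add: hclass_zero)
next
  case (Suc n)
  then show ?case
    using assms by (simp add: hclass_mult singular_relcycle_cmul frag_cmul_distrib algebra_simps)
qed

lemma hclass_int_pow:
  assumes c: "singular_relcycle 1 X {} c"
  shows "hclass X c [^]\<^bsub>homology_group 1 X\<^esub> (n::int) = hclass X (frag_cmul n c)"
proof -
  interpret group "homology_group 1 X" by simp
  show ?thesis
  proof (cases "n \<ge> 0")
    case True
    then show ?thesis using hclass_nat_pow[OF c, of "nat n"] by (simp flip: int_pow_int)
  next
    case False
    have "hclass X (frag_cmul n c) \<otimes>\<^bsub>homology_group 1 X\<^esub> hclass X (frag_cmul (- n) c) = \<one>\<^bsub>homology_group 1 X\<^esub>"
      using c by (simp add: hclass_mult singular_relcycle_cmul hclass_zero flip: frag_cmul_distrib)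
    then have "hclass X (frag_cmul n c) = inv\<^bsub>homology_group 1 X\<^esub> hclass X (frag_cmul (- n) c)"
      using c by (intro inv_equality[symmetric] hclass_in_carrier singular_relcycle_cmul)
    also have "hclass X (frag_cmul (- n) c) = hclass X c [^]\<^bsub>homology_group 1 X\<^esub> (- n)"
      using hclass_nat_pow[OF c, of "nat (- n)"] False by (simp flip: int_pow_int)
    finally show ?thesis using hclass_in_carrier[OF c] by (simp add: int_pow_neg)
  qed
qed

lemma hclass_finprod:
  assumes "finite F" "\<And>i. i \<in> F \<Longrightarrow> singular_relcycle 1 X {} (c i)"
  shows "(\<Otimes>\<^bsub>homology_group 1 X\<^esub>i\<in>F. hclass X (c i)) = hclass X (\<Sum>i\<in>F. c i)"
proof -
  interpret comm_group "homology_group 1 X" by simp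
  show ?thesis using assms
  proof (induction F)
    case empty
    then show ?case by (simp add: hclass_zero)
  next
    case (insert i F)
    then show ?case
      by (simp add: hclass_in_carrier hclass_mult singular_relcycle_sum Pi_iff)
  qed
qed

section \<open>Excision and bounded functionals on chains\<close>

text \<open>This is the exactness of the Mayer-Vietoris sequence in degree one: the bounding chain is a relative
  cycle modulo \<open>U\<close>, and excision moves it into \<open>V\<close>. It is stated for chains, since functionals that
  are additive only up to a bounded error do not descend to homology.\<close>

lemma boundary_in_open_union:
  assumes UV: "openin Y U" "openin Y V" "U \<union> V = topspace Y"
    and x: "singular_chain 1 (subtopology Y U) x" "singular_relboundary 1 Y {} x"
  obtains z u where "singular_chain 1 (subtopology Y (U \<inter> V)) z" "singular_chain 2 (subtopology Y U) u"
    "x = z + chain_boundary 2 u"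
proof -
  obtain d where d: "singular_chain 2 Y d" "chain_boundary 2 d = x"
    using x(2) unfolding singular_boundary by (auto simp: Suc_1)
  have sub: "subtopology Y (topspace Y) = Y" by simp
  have rd: "singular_relcycle 2 (subtopology Y (topspace Y)) U d"
    unfolding singular_relcycle using d x(1) by (simp flip: One_nat_def)
  have "closedin Y (topspace Y - V)" using UV by blast
  then have cl: "Y closure_of (topspace Y - V) = topspace Y - V" by (simp add: closure_of_closedin)
  have int: "Y interior_of U = U" using UV by (simp add: interior_of_openin)
  have "Y closure_of (topspace Y - V) \<subseteq> Y interior_of U" unfolding cl int using UV by blast
  moreover have "U \<subseteq> topspace Y" using UV by blast
  ultimately obtain c' where c': "singular_relcycle 2 (subtopology Y (topspace Y - (topspace Y - V))) (U - (topspace Y - V)) c'"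
    "homologous_rel 2 (subtopology Y (topspace Y)) U d c'"
    using rd by (rule excised_relcycle_exists)
  have eq: "topspace Y - (topspace Y - V) = V" "U - (topspace Y - V) = U \<inter> V"
    using UV by (auto dest: openin_subset)
  have z: "singular_chain 1 (subtopology Y (U \<inter> V)) (chain_boundary 2 c')"
    using c'(1) unfolding eq singular_relcycle
    by (simp add: subtopology_subtopology Int_left_absorb Int_commute Int_left_commute flip: One_nat_def)
  obtain e u where e: "singular_chain 3 Y e" and u: "singular_chain 2 (subtopology Y U) u"
    and du: "chain_boundary 3 e + u = d - c'"
    using c'(2) unfolding homologous_rel_def singular_relboundary by (auto simp: eval_nat_numeral One_nat_def)
  have "chain_boundary 2 (chain_boundary 3 e) = 0"
    using chain_boundary_boundary[OF e] by simp
  then have "chain_boundary 2 u = chain_boundary 2 (d - c')"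
    using du by (metis add_0 chain_boundary_add)
  then have "x = chain_boundary 2 c' + chain_boundary 2 u"
    using d by (simp add: chain_boundary_diff)
  with z u that show thesis by blast
qed

definition chain_eval :: "('s \<Rightarrow> real) \<Rightarrow> ('s \<Rightarrow>\<^sub>0 int) \<Rightarrow> real" where
  "chain_eval \<phi> c = (\<Sum>s\<in>Poly_Mapping.keys c. of_int (Poly_Mapping.lookup c s) * \<phi> s)"

lemma chain_eval_superset:
  assumes "finite S" "Poly_Mapping.keys c \<subseteq> S"
  shows "chain_eval \<phi> c = (\<Sum>s\<in>S. of_int (Poly_Mapping.lookup c s) * \<phi> s)"
  unfolding chain_eval_def
  by (rule sum.mono_neutral_left) (use assms in \<open>auto simp: in_keys_iff\<close>)

lemma chain_eval_of [simp]: "chain_eval \<phi> (frag_of s) = \<phi> s"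
  by (simp add: chain_eval_def keys_frag_of)

lemma chain_eval_0 [simp]: "chain_eval \<phi> 0 = 0"
  by (simp add: chain_eval_def)

lemma chain_eval_add: "chain_eval \<phi> (c + d) = chain_eval \<phi> c + chain_eval \<phi> d"
proof -
  let ?S = "Poly_Mapping.keys c \<union> Poly_Mapping.keys d"
  have "chain_eval \<phi> (c + d) = (\<Sum>s\<in>?S. of_int (Poly_Mapping.lookup (c + d) s) * \<phi> s)"
    by (rule chain_eval_superset) (use keys_add[of c d] in auto)
  also have "\<dots> = chain_eval \<phi> c + chain_eval \<phi> d"
    by (simp add: chain_eval_superset[of ?S c] chain_eval_superset[of ?S d] lookup_add
        distrib_right sum.distrib)
  finally show ?thesis .
qed

lemma chain_eval_diff: "chain_eval \<phi> (c - d) = chain_eval \<phi> c - chain_eval \<phi> d"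
  using chain_eval_add[of \<phi> "c - d" d] by simp

lemma chain_eval_cmul: "chain_eval \<phi> (frag_cmul k c) = of_int k * chain_eval \<phi> c"
proof -
  have "chain_eval \<phi> (frag_cmul k c) = (\<Sum>s\<in>Poly_Mapping.keys c. of_int (Poly_Mapping.lookup (frag_cmul k c) s) * \<phi> s)"
    by (rule chain_eval_superset) (use keys_cmul[of k c] in auto)
  then show ?thesis by (simp add: chain_eval_def sum_distrib_left algebra_simps)
qed

lemma chain_eval_sum: "chain_eval \<phi> (sum c F) = (\<Sum>i\<in>F. chain_eval \<phi> (c i))"
  by (induction F rule: infinite_finite_induct) (simp_all add: chain_eval_add)

text \<open>The bounds depend on the chain but not on the functional; they will be used for a sequence of
  functionals.\<close>

lemma chain_eval_bounded:
  assumes "Poly_Mapping.keys c \<subseteq> S"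
  obtains C where "\<And>\<phi>. (\<And>s. s \<in> S \<Longrightarrow> \<bar>\<phi> s\<bar> \<le> 1) \<Longrightarrow> \<bar>chain_eval \<phi> c\<bar> \<le> C"
proof -
  have "\<exists>C. \<forall>\<phi>. (\<forall>s\<in>S. \<bar>\<phi> s\<bar> \<le> 1) \<longrightarrow> \<bar>chain_eval \<phi> c\<bar> \<le> C"
    using assms
  proof (induction c rule: frag_induction)
    case (one x)
    then show ?case by (intro exI[of _ 1]) auto
  next
    case (diff a b)
    then obtain A B where "\<forall>\<phi>. (\<forall>s\<in>S. \<bar>\<phi> s\<bar> \<le> 1) \<longrightarrow> \<bar>chain_eval \<phi> a\<bar> \<le> A"
      "\<forall>\<phi>. (\<forall>s\<in>S. \<bar>\<phi> s\<bar> \<le> 1) \<longrightarrow> \<bar>chain_eval \<phi> b\<bar> \<le> B" by blast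
    then show ?case
      by (intro exI[of _ "A + B"]) (auto simp: chain_eval_diff intro: order_trans[OF abs_triangle_ineq4 add_mono])
  qed auto
  then show thesis using that by blast
qed

lemma chain_eval_boundary_bounded:
  assumes "singular_chain 2 X u"
  obtains C where "\<And>\<phi>. (\<And>s. singular_simplex 2 X s \<Longrightarrow>
      \<bar>\<phi> (singular_face 2 1 s) - \<phi> (singular_face 2 0 s) - \<phi> (singular_face 2 2 s)\<bar> \<le> 1)
    \<Longrightarrow> \<bar>chain_eval \<phi> (chain_boundary 2 u)\<bar> \<le> C"
proof -
  let ?b = "\<lambda>\<phi> :: ((nat \<Rightarrow> real) \<Rightarrow> 'a) \<Rightarrow> real. \<forall>s. singular_simplex 2 X s \<longrightarrow>
      \<bar>\<phi> (singular_face 2 1 s) - \<phi> (singular_face 2 0 s) - \<phi> (singular_face 2 2 s)\<bar> \<le> 1"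
  have "\<exists>C. \<forall>\<phi>. ?b \<phi> \<longrightarrow> \<bar>chain_eval \<phi> (chain_boundary 2 u)\<bar> \<le> C"
    using assms[unfolded singular_chain_def]
  proof (induction u rule: frag_induction)
    case (one x)
    have "\<bar>chain_eval \<phi> (chain_boundary 2 (frag_of x))\<bar> \<le> 1" if "?b \<phi>" for \<phi>
    proof -
      have "\<bar>\<phi> (singular_face 2 1 x) - \<phi> (singular_face 2 0 x) - \<phi> (singular_face 2 2 x)\<bar> \<le> 1"
        using one that by simp
      then show ?thesis
        unfolding chain_boundary_2_of chain_eval_add chain_eval_diff chain_eval_of by linarith
    qed
    then show ?case by blast
  next
    case (diff a b)
    then obtain A B where "\<forall>\<phi>. ?b \<phi> \<longrightarrow> \<bar>chain_eval \<phi> (chain_boundary 2 a)\<bar> \<le> A"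
      "\<forall>\<phi>. ?b \<phi> \<longrightarrow> \<bar>chain_eval \<phi> (chain_boundary 2 b)\<bar> \<le> B" by blast
    then have "\<forall>\<phi>. ?b \<phi> \<longrightarrow> \<bar>chain_eval \<phi> (chain_boundary 2 (a - b))\<bar> \<le> A + B"
      unfolding chain_boundary_diff chain_eval_diff
      by (blast intro: order_trans[OF abs_triangle_ineq4 add_mono])
    then show ?case by blast
  qed auto
  then show thesis using that by blast
qed

section \<open>Homology classes of composed loops\<close>

lemma frag_cmul_diff_right: "frag_cmul k (a - b) = frag_cmul k a - frag_cmul k b"
  using frag_cmul_distrib2[of k "a - b" b] by simp

lemma homologous_join:
  assumes "path_between X a b p" "path_between X b c q"
  shows "homologous_rel 1 X {} (frag_of (path_simplex (join_loops p q)))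
    (frag_of (path_simplex p) + frag_of (path_simplex q))"
  by (rule homologous_join_loops) (use assms path_between_join[OF assms] in \<open>auto simp: path_between_def\<close>)

lemma homologous_loop_power:
  assumes p: "path_between X a a p"
  shows "homologous_rel 1 X {} (frag_of (path_simplex (loop_power a n p))) (frag_cmul (int n) (frag_of (path_simplex p)))"
proof (induction n)
  case 0
  have "a \<in> topspace X"
    using p by (auto simp: path_between_def pathin_def continuous_map_def Pi_iff)
  then show ?case using homologous_const by simp
next
  case (Suc n)
  have "homologous_rel 1 X {} (frag_of (path_simplex p) + frag_of (path_simplex (loop_power a n p)))
      (frag_of (path_simplex p) + frag_cmul (int n) (frag_of (path_simplex p)))"
    by (intro homologous_rel_add homologous_rel_refl Suc)
  from homologous_rel_trans[OF this homologous_join[OF p path_between_loop_power[OF p]]]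
  show ?case by (simp add: frag_cmul_distrib)
qed

lemma homologous_commutator:
  assumes p: "path_between X a a p" and q: "path_between X a a q"
  shows "homologous_rel 1 X {} (frag_of (path_simplex (commutator_loop p q))) 0"
proof -
  let ?p = "\<lambda>t. p (1 - t)" and ?q = "\<lambda>t. q (1 - t)"
  let ?c = "\<lambda>p. frag_of (path_simplex p)"
  note p' = path_between_reverse[OF p] and q' = path_between_reverse[OF q]
  have "homologous_rel 1 X {} (?c (join_loops p q) + ?c (join_loops ?p ?q)) ((?c p + ?c q) + (?c ?p + ?c ?q))"
    by (intro homologous_rel_add homologous_join[OF p q] homologous_join[OF p' q'])
  from homologous_rel_trans[OF this homologous_join[OF path_between_join[OF p q] path_between_join[OF p' q']]]
  have 1: "homologous_rel 1 X {} (?c (commutator_loop p q)) ((?c p + ?c ?p) + (?c q + ?c ?q))"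
    unfolding commutator_loop_def by (simp only: ac_simps)
  have "homologous_rel 1 X {} ((?c p + ?c ?p) + (?c q + ?c ?q)) (0 + 0)"
    by (intro homologous_rel_add homologous_reverse) (use p q in \<open>auto simp: path_between_def\<close>)
  from homologous_rel_trans[OF this 1] show ?thesis by simp
qed

lemma homologous_conjugate:
  assumes l: "path_between X y a l" and p: "path_between X a a p"
  shows "homologous_rel 1 X {} (frag_of (path_simplex (conjugate_loop l p))) (frag_of (path_simplex p))"
proof -
  let ?l = "\<lambda>t. l (1 - t)"
  let ?c = "\<lambda>p. frag_of (path_simplex p)"
  note l' = path_between_reverse[OF l]
  have "homologous_rel 1 X {} (?c l + ?c (join_loops p ?l)) (?c l + (?c p + ?c ?l))"
    by (intro homologous_rel_add homologous_rel_refl homologous_join[OF p l'])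
  from homologous_rel_trans[OF this homologous_join[OF l path_between_join[OF p l']]]
  have 1: "homologous_rel 1 X {} (?c (conjugate_loop l p)) ((?c l + ?c ?l) + ?c p)"
    unfolding conjugate_loop_def by (simp only: ac_simps)
  have "homologous_rel 1 X {} ((?c l + ?c ?l) + ?c p) (0 + ?c p)"
    by (intro homologous_rel_add homologous_reverse homologous_rel_refl) (use l in \<open>auto simp: path_between_def\<close>)
  from homologous_rel_trans[OF this 1] show ?thesis by simp
qed

section \<open>The nested loops are roots of each other\<close>

text \<open>The map \<open>g\<close> into another space is a parameter so that the earring and Griffiths' space are treated
  together.\<close>

definition tower_chain :: "(complex \<Rightarrow> 'a) \<Rightarrow> nat set \<Rightarrow> nat \<Rightarrow> 'a chain" where
  "tower_chain g A n = frag_of (path_simplex (\<lambda>t. g (tower_loop A n t)))"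

lemma tower_loop_earring: "path_between earring_space 0 0 (tower_loop A n)"
  unfolding hawaiian_earring_eq by (rule tower_loop_between) simp

lemma block_earring: "path_between earring_space 0 0 (block A n)"
  unfolding hawaiian_earring_eq by (rule block_between) simp

lemma chain_map_tower_chain: "chain_map 1 f (tower_chain g A n) = tower_chain (\<lambda>z. f (g z)) A n"
  unfolding tower_chain_def by (rule chain_map_path_simplex)

lemma singular_relcycle_tower_chain:
  assumes "continuous_map earring_space X g"
  shows "singular_relcycle 1 X {} (tower_chain g A n)"
  unfolding tower_chain_def
  by (rule singular_relcycle_loop)
    (use path_between_continuous_image[OF tower_loop_earring assms, of A n] in \<open>auto simp: path_between_def\<close>)

lemma homologous_tower_chain:
  assumes g: "continuous_map earring_space X g"
  shows "homologous_rel 1 X {} (tower_chain g A n) (frag_cmul (int (Suc n)) (tower_chain g A (Suc n)))"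
proof -
  let ?c = "\<lambda>p. frag_of (path_simplex p)"
  let ?P = "loop_power 0 (Suc n) (tower_loop A (Suc n))"
  have "homologous_rel 1 earring_space {} (?c (block A n)) 0"
  proof (cases "n \<in> range (branch A)")
    case True
    then show ?thesis
      unfolding block_def hawaiian_earring_eq
      by (auto intro!: homologous_commutator earring_loop_between)
  next
    case False
    then show ?thesis unfolding block_def using homologous_const[of 0 earring_space] by simp
  qed
  then have "homologous_rel 1 earring_space {} (?c (block A n) + ?c ?P) (0 + frag_cmul (int (Suc n)) (?c (tower_loop A (Suc n))))"
    by (intro homologous_rel_add homologous_loop_power tower_loop_earring)
  from homologous_rel_trans[OF this homologous_join[OF block_earring path_between_loop_power[OF tower_loop_earring]]]
  have "homologous_rel 1 earring_space {} (?c (join_loops (block A n) ?P)) (frag_cmul (int (Suc n)) (?c (tower_loop A (Suc n))))"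
    by (simp only: add_0)
  moreover have "path_simplex (join_loops (block A n) ?P) = path_simplex (tower_loop A n)"
    by (rule path_simplex_cong) (simp only: tower_loop_rec)
  ultimately have "singular_relboundary 1 earring_space {} (tower_chain id A n - frag_cmul (int (Suc n)) (tower_chain id A (Suc n)))"
    by (simp add: homologous_rel_def tower_chain_def)
  from singular_relboundary_chain_map[OF this g, of "{}"]
  show ?thesis
    by (simp add: homologous_rel_def chain_map_diff chain_map_tower_chain id_def)
qed

section \<open>Detection of the nested loops in Griffiths' space\<close>

text \<open>The functional is defined on all singular simplices; on those below the apexes the detector is
  continuous.\<close>

definition path_functional :: "nat \<Rightarrow> ((nat \<Rightarrow> real) \<Rightarrow> (bool \<times> (complex \<times> real) set) set) \<Rightarrow> real" where
  "path_functional n \<sigma> = transport (\<lambda>t. griffiths_detector n (\<sigma> (edge_point t))) 0"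

lemma continuous_detector_simplex:
  assumes \<sigma>: "singular_simplex k (subtopology griffiths_space lower_part) \<sigma>"
    and h: "continuous_on S h" "\<And>x. x \<in> S \<Longrightarrow> h x \<in> standard_simplex k"
  shows "continuous_on S (\<lambda>x. griffiths_detector n (\<sigma> (h x)))"
    and "(\<lambda>x. griffiths_detector n (\<sigma> (h x))) \<in> S \<rightarrow> two_circles"
proof -
  have "continuous_map (top_of_set S) (subtopology (powertop_real UNIV) (standard_simplex k)) h"
    using h by (auto simp: continuous_map_in_subtopology powertop_real_UNIV_eq)
  from continuous_map_compose[OF this \<sigma>[unfolded singular_simplex_def, THEN conjunct1]]
  have "continuous_map (top_of_set S) (top_of_set two_circles) (griffiths_detector n \<circ> (\<sigma> \<circ> h))"
    using continuous_griffiths_detector by (rule continuous_map_compose)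
  then show "continuous_on S (\<lambda>x. griffiths_detector n (\<sigma> (h x)))"
    "(\<lambda>x. griffiths_detector n (\<sigma> (h x))) \<in> S \<rightarrow> two_circles"
    by (auto simp: continuous_map_in_subtopology comp_def)
qed

text \<open>By connectedness a path above the bases stays in one cone, so that its image in the wedge stays in one
  circle.\<close>

lemma path_functional_upper:
  assumes \<sigma>: "singular_simplex 1 (subtopology griffiths_space (lower_part \<inter> (upper_part False \<union> upper_part True))) \<sigma>"
  shows "\<bar>path_functional n \<sigma>\<bar> \<le> 1"
proof -
  have \<sigma>l: "singular_simplex 1 (subtopology griffiths_space lower_part) \<sigma>"
    using \<sigma> by (rule singular_simplex_mono) blast
  have circ: "circles_path (\<lambda>t. griffiths_detector n (\<sigma> (edge_point t)))"
    unfolding circles_path_def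
    using continuous_detector_simplex[OF \<sigma>l continuous_edge_point edge_point_in] by blast
  have range: "\<sigma> ` standard_simplex 1 \<subseteq> lower_part \<inter> (upper_part False \<union> upper_part True)"
    using \<sigma> by (simp add: singular_simplex_subtopology)
  have "continuous_map (subtopology (powertop_real UNIV) (standard_simplex 1)) griffiths_space \<sigma>"
    using \<sigma> by (simp add: singular_simplex_def continuous_map_in_subtopology)
  then have conn: "connectedin griffiths_space (\<sigma> ` standard_simplex 1)"
    by (rule connectedin_continuous_map_image)
      (simp add: connectedin_subtopology connectedin_standard_simplex)
  have disj: "upper_part False \<inter> upper_part True \<inter> \<sigma> ` standard_simplex 1 = {}"
  proof -
    have "upper_part False \<inter> upper_part True = {}"
    proof (rule ccontr)
      assume "upper_part False \<inter> upper_part True \<noteq> {}"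
      then obtain z t where "griffiths_point False z t \<in> upper_part True" "z \<in> hawaiian_earring" "0 < t" "t \<le> 1"
        unfolding upper_part_def[of False] by blast
      then show False using griffiths_point_in_upper_part[of z t False True] by simp
    qed
    then show ?thesis by blast
  qed
  have cover: "\<sigma> ` standard_simplex 1 \<subseteq> upper_part False \<union> upper_part True"
    using range by blast
  have "upper_part False \<inter> \<sigma> ` standard_simplex 1 = {} \<or> upper_part True \<inter> \<sigma> ` standard_simplex 1 = {}"
  proof (rule ccontr)
    assume "\<not> ?thesis"
    then have "upper_part False \<inter> \<sigma> ` standard_simplex 1 \<noteq> {}" "upper_part True \<inter> \<sigma> ` standard_simplex 1 \<noteq> {}"
      by simp_all
    with conn[unfolded connectedin, THEN conjunct2] openin_upper_part[of False] openin_upper_part[of True] cover disj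
    show False by metis
  qed
  then obtain b where b: "\<sigma> ` standard_simplex 1 \<subseteq> lower_part \<inter> upper_part b"
    using range by blast
  have "griffiths_detector n (\<sigma> (edge_point t)) \<in> (if b then sphere (- 1) 1 else sphere 1 1)" if "t \<in> {0..1}" for t
    using edge_point_in[OF that] b by (intro griffiths_detector_upper) auto
  then show ?thesis
    unfolding path_functional_def
    using transport_first_circle[of "\<lambda>t. griffiths_detector n (\<sigma> (edge_point t))"]
      transport_second_circle[OF circ]
    by (cases b) (auto simp: Pi_iff)
qed

lemma path_functional_defect:
  assumes \<sigma>: "singular_simplex 2 (subtopology griffiths_space lower_part) \<sigma>"
  shows "\<bar>path_functional n (singular_face 2 1 \<sigma>) - path_functional n (singular_face 2 0 \<sigma>)
    - path_functional n (singular_face 2 2 \<sigma>)\<bar> \<le> 1"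
proof -
  define G where "G = (\<lambda>z. griffiths_detector n (\<sigma> (triangle_point z)))"
  have G: "continuous_on std_triangle G" "G \<in> std_triangle \<rightarrow> two_circles"
    unfolding G_def
    using continuous_detector_simplex[OF \<sigma> continuous_triangle_point] triangle_point_in by auto
  have face: "path_functional n (singular_face 2 k \<sigma>) = transport (\<lambda>t. G (h t)) 0"
    if "k \<le> 2" "\<And>t. t \<in> {0..1} \<Longrightarrow> simplical_face k (edge_point t) = triangle_point (h t)" for k h
    unfolding path_functional_def G_def
    by (rule fun_cong[OF transport_cong])
      (use that edge_point_in in \<open>auto simp: singular_face_def simp flip: One_nat_def\<close>)
  have f: "path_functional n (singular_face 2 0 \<sigma>) = transport (\<lambda>t. G (1, t)) 0"
    "path_functional n (singular_face 2 1 \<sigma>) = transport (\<lambda>t. G (t, t)) 0"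
    "path_functional n (singular_face 2 2 \<sigma>) = transport (\<lambda>t. G (t, 0)) 0"
    by (rule face; auto simp: simplical_face_def edge_point_def triangle_point_def fun_eq_iff)+
  have "circles_path (\<lambda>t. G (1, t))"
    unfolding circles_path_def
  proof
    show "continuous_on {0..1} (\<lambda>t. G (1, t))"
      by (rule continuous_on_compose2[OF G(1)]) (auto simp: std_triangle_def intro!: continuous_intros)
  qed (use G(2) in \<open>auto simp: std_triangle_def\<close>)
  from transport_defect[OF this, of "transport (\<lambda>t. G (t, 0)) 0"]
  show ?thesis unfolding f transport_triangle[OF G] by linarith
qed

lemma path_functional_tower:
  "path_functional n (path_simplex (\<lambda>t. earring_to_griffiths (tower_loop A 0 t))) =
     (if n \<in> range (branch A) then (stretch_commutator ^^ fact n) 0 else 0)"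
proof -
  have "path_functional n (path_simplex (\<lambda>t. earring_to_griffiths (tower_loop A 0 t))) =
      transport (\<lambda>t. detector n (tower_loop A 0 t)) 0"
    unfolding path_functional_def
    by (rule fun_cong[OF transport_cong])
      (simp add: path_simplex_edge_point griffiths_detector_earring path_between_in[OF tower_loop_earring])
  then show ?thesis by (simp add: transport_detector_tower)
qed

text \<open>For suitable \<open>n\<close> the \<open>n\<close>-th functional sees only the loop of \<open>A0\<close>, and sees it about \<open>n!\<close> times,
  whereas its value on a boundary is bounded independently of \<open>n\<close>.\<close>

theorem tower_chains_independent:
  assumes "finite F" and bd: "singular_relboundary 1 griffiths_space {} (\<Sum>A\<in>F. frag_cmul (k A) (tower_chain earring_to_griffiths A 0))"
    and A0: "A0 \<in> F"
  shows "k A0 = 0"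
proof (rule ccontr)
  assume k0: "k A0 \<noteq> 0"
  define x where "x = (\<Sum>A\<in>F. frag_cmul (k A) (tower_chain earring_to_griffiths A 0))"
  have "continuous_map earring_space (subtopology griffiths_space lower_part) earring_to_griffiths"
    using continuous_earring_to_griffiths earring_to_griffiths_lower by (auto simp: continuous_map_in_subtopology)
  from singular_relcycle_tower_chain[OF this]
  have "singular_chain 1 (subtopology griffiths_space lower_part) x"
    unfolding x_def by (intro singular_chain_sum singular_chain_cmul) (simp add: singular_cycle)
  moreover have "openin griffiths_space (upper_part False \<union> upper_part True)"
    by (intro openin_Un openin_upper_part)
  ultimately obtain z u where
    z: "singular_chain 1 (subtopology griffiths_space (lower_part \<inter> (upper_part False \<union> upper_part True))) z"
    and u: "singular_chain 2 (subtopology griffiths_space lower_part) u" and x: "x = z + chain_boundary 2 u"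
    using boundary_in_open_union[OF openin_lower_part _ lower_upper_cover] bd unfolding x_def by blast
  obtain C where C: "\<And>n. \<bar>chain_eval (path_functional n) z\<bar> \<le> C"
    using chain_eval_bounded[OF z[unfolded singular_chain_def]] path_functional_upper by (metis mem_Collect_eq)
  obtain D where D: "\<And>n. \<bar>chain_eval (path_functional n) (chain_boundary 2 u)\<bar> \<le> D"
    using chain_eval_boundary_bounded[OF u] path_functional_defect by metis
  have bound: "\<bar>chain_eval (path_functional n) x\<bar> \<le> C + D" for n
    using C[of n] D[of n] unfolding x chain_eval_add by linarith
  have "\<exists>K. \<forall>j\<ge>K. branch A0 j \<notin> range (branch A)" if "A \<noteq> A0" for A
    using branch_almost_disjoint[of A0 A] that by metis
  then obtain K where K: "\<And>A j. A \<noteq> A0 \<Longrightarrow> j \<ge> K A \<Longrightarrow> branch A0 j \<notin> range (branch A)" by metis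
  obtain J where J: "real J > C + D + 1" using reals_Archimedean2 by blast
  \<comment> \<open>beyond \<open>K A\<close> the branch of \<open>A0\<close> avoids that of \<open>A\<close>, and \<open>J\<close> makes \<open>n!\<close> exceed the bound\<close>
  define j where "j = J + (\<Sum>A\<in>F. K A)"
  define n where "n = branch A0 j"
  have jK: "j \<ge> K A" if "A \<in> F" for A
    using member_le_sum[OF that, of K] assms(1) unfolding j_def by simp
  have "chain_eval (path_functional n) x = (\<Sum>A\<in>F. of_int (k A) * (if n \<in> range (branch A) then (stretch_commutator ^^ fact n) 0 else 0))"
    unfolding x_def chain_eval_sum chain_eval_cmul tower_chain_def chain_eval_of path_functional_tower ..
  also have "\<dots> = (\<Sum>A\<in>F. if A = A0 then of_int (k A0) * (stretch_commutator ^^ fact n) 0 else 0)"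
    by (rule sum.cong) (use K jK in \<open>auto simp: n_def\<close>)
  also have "\<dots> = of_int (k A0) * (stretch_commutator ^^ fact n) 0"
    using assms(1) A0 by simp
  finally have "\<bar>of_int (k A0)\<bar> * \<bar>(stretch_commutator ^^ fact n) 0\<bar> \<le> C + D"
    using bound[of n] by (simp add: abs_mult)
  moreover have "(stretch_commutator ^^ fact n) 0 > C + D"
  proof -
    have "real J \<le> real n" using branch_ge[of j A0] by (simp add: n_def j_def)
    also have "\<dots> \<le> real (fact n)" using fact_ge_self[of n] by (simp only: of_nat_le_iff)
    finally show ?thesis using J stretch_commutator_power[of "fact n"] by linarith
  qed
  moreover have "1 * \<bar>(stretch_commutator ^^ fact n) 0\<bar> \<le> \<bar>of_int (k A0)\<bar> * \<bar>(stretch_commutator ^^ fact n) 0\<bar>"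
    using k0 by (intro mult_right_mono) auto
  ultimately show False by linarith
qed

text \<open>A space through which the map from the earring to Griffiths' space factors inherits the independence of
  the loops.\<close>

lemma homology_contains_continuum_sum_rat:
  assumes g: "continuous_map earring_space X g" and f: "continuous_map X griffiths_space f"
    and fg: "\<And>z. z \<in> hawaiian_earring \<Longrightarrow> f (g z) = earring_to_griffiths z"
  shows "contains_copy_of (homology_group 1 X) continuum_sum_rat"
proof -
  interpret comm_group "homology_group 1 X" by simp
  let ?x = "\<lambda>A n. hclass X (tower_chain g A n)"
  note cyc = singular_relcycle_tower_chain[OF g]
  show ?thesis
  proof (rule contains_copy_of_continuum_sum_rat[where x = ?x])
    show "?x A n \<in> carrier (homology_group 1 X)" for A n
      using cyc by (rule hclass_in_carrier)
    show "?x A n = ?x A (Suc n) [^]\<^bsub>homology_group 1 X\<^esub> Suc n" for A n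
      unfolding hclass_nat_pow[OF cyc] homologous_rel_set_eq by (rule homologous_tower_chain[OF g])
  next
    fix F and k :: "nat set \<Rightarrow> int" and A
    assume F: "finite F" "A \<in> F"
      and "(\<Otimes>\<^bsub>homology_group 1 X\<^esub>A\<in>F. ?x A 0 [^]\<^bsub>homology_group 1 X\<^esub> k A) = \<one>\<^bsub>homology_group 1 X\<^esub>"
    then have "hclass X (\<Sum>A\<in>F. frag_cmul (k A) (tower_chain g A 0)) = hclass X 0"
      by (simp add: hclass_int_pow[OF cyc] hclass_finprod singular_relcycle_cmul cyc hclass_zero)
    then have "singular_relboundary 1 X {} (\<Sum>A\<in>F. frag_cmul (k A) (tower_chain g A 0))"
      unfolding homologous_rel_set_eq by (simp add: homologous_rel_def)
    from singular_relboundary_chain_map[OF this f, of "{}"]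
    have "singular_relboundary 1 griffiths_space {} (\<Sum>A\<in>F. frag_cmul (k A) (tower_chain (\<lambda>z. f (g z)) A 0))"
      by (simp add: chain_map_sum[OF F(1)] comp_def chain_map_tower_chain)
    moreover have "tower_chain (\<lambda>z. f (g z)) A 0 = tower_chain earring_to_griffiths A 0" for A
      unfolding tower_chain_def using fg path_between_in[OF tower_loop_earring]
      by (intro arg_cong[where f = frag_of] path_simplex_cong) auto
    ultimately show "k A = 0"
      using tower_chains_independent[OF F(1) _ F(2)] by simp
  qed
qed

section \<open>The fundamental group of Griffiths' space\<close>

lemma path_homotopic_cong:
  assumes "path_homotopic X a b p q" "\<And>t. t \<in> {0..1} \<Longrightarrow> p t = p' t" "\<And>t. t \<in> {0..1} \<Longrightarrow> q t = q' t"
  shows "path_homotopic X a b p' q'"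
  by (rule homotopic_with_eq[OF assms(1)]) (use assms(2,3) in auto)

lemma commutator_null_homotopic:
  assumes a: "a \<in> topspace X"
    and "path_homotopic X a a p (\<lambda>t. a)" "path_homotopic X a a q (\<lambda>t. a)"
    and "path_homotopic X a a (\<lambda>t. p (1 - t)) (\<lambda>t. a)" "path_homotopic X a a (\<lambda>t. q (1 - t)) (\<lambda>t. a)"
  shows "path_homotopic X a a (commutator_loop p q) (\<lambda>t. a)"
proof -
  have "path_homotopic X a a (commutator_loop p q) (join_loops (join_loops (\<lambda>t. a) (\<lambda>t. a)) (join_loops (\<lambda>t. a) (\<lambda>t. a)))"
    unfolding commutator_loop_def
    by (rule path_homotopic_join[OF path_homotopic_join[OF assms(2,3)] path_homotopic_join[OF assms(4,5)]])
  moreover have "join_loops (join_loops (\<lambda>t. a) (\<lambda>t. a)) (join_loops (\<lambda>t. a) (\<lambda>t. a)) = (\<lambda>t. a)"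
    by (auto simp: join_loops_def)
  ultimately show ?thesis by simp
qed

lemma earring_circle_null_homotopic:
  assumes p: "path_between earring_space 0 0 p" and m: "m \<ge> 1" "\<And>t. t \<in> {0..1} \<Longrightarrow> p t \<in> earring_circle m"
  shows "griffiths_homotopic (\<lambda>t. earring_to_griffiths (p t)) (\<lambda>t. griffiths_base)"
proof (rule path_homotopic_cong[OF null_homotopic_in_cone[OF p, of "even m"]])
  fix t :: real assume t: "t \<in> {0..1}"
  show "griffiths_point (even m) (p t) 0 = earring_to_griffiths (p t)"
  proof (cases "p t = 0")
    case True
    then show ?thesis by (simp add: griffiths_point_base)
  next
    case False
    have "odd m" if part: "p t \<in> earring_part {m. odd m}"
    proof -
      obtain k where "odd k" "k \<ge> 1" "p t \<in> earring_circle k"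
        using part False by (auto simp: earring_part_def)
      then show ?thesis using earring_circle_Int[OF _ m(1) _ m(2)[OF t] False] by blast
    qed
    moreover have "p t \<in> earring_part {m. odd m}" if "odd m"
      using that m(1) m(2)[OF t] by (auto simp: earring_part_def)
    ultimately have "p t \<in> earring_part {m. odd m} \<longleftrightarrow> odd m"
      by blast
    then show ?thesis by (simp add: earring_to_griffiths_def)
  qed
qed simp

text \<open>In Griffiths' space a block contracts for a stronger reason than being a commutator: each of its
  circles contracts in its cone.\<close>

lemma block_null_homotopic:
  "griffiths_homotopic (\<lambda>t. earring_to_griffiths (block A n t)) (\<lambda>t. griffiths_base)"
proof (cases "n \<in> range (branch A)")
  case True
  have loop: "griffiths_homotopic (\<lambda>t. earring_to_griffiths (earring_loop m t)) (\<lambda>t. griffiths_base)"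
    and reverse: "griffiths_homotopic (\<lambda>t. earring_to_griffiths (earring_loop m (1 - t))) (\<lambda>t. griffiths_base)" if m: "m \<ge> 1" for m
  proof -
    have p: "path_between earring_space 0 0 (earring_loop m)"
      unfolding hawaiian_earring_eq by (rule earring_loop_between) (use m in auto)
    show "griffiths_homotopic (\<lambda>t. earring_to_griffiths (earring_loop m t)) (\<lambda>t. griffiths_base)"
      by (rule earring_circle_null_homotopic[OF p m]) (use earring_loop_in m in auto)
    show "griffiths_homotopic (\<lambda>t. earring_to_griffiths (earring_loop m (1 - t))) (\<lambda>t. griffiths_base)"
      by (rule earring_circle_null_homotopic[OF path_between_reverse[OF p] m]) (use earring_loop_in m in auto)
  qed
  have "(\<lambda>t. earring_to_griffiths (block A n t)) =
      commutator_loop (\<lambda>t. earring_to_griffiths (earring_loop (2 * n + 1) t)) (\<lambda>t. earring_to_griffiths (earring_loop (2 * n + 2) t))"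
    using True by (simp add: block_def commutator_loop_def join_loops_compose)
  moreover have "griffiths_base \<in> topspace griffiths_space"
    unfolding griffiths_base_def by (rule griffiths_point_in) auto
  ultimately show ?thesis
    by (simp only:) (intro commutator_null_homotopic loop reverse; simp)
next
  case False
  have "griffiths_base \<in> topspace griffiths_space"
    unfolding griffiths_base_def by (rule griffiths_point_in) auto
  then show ?thesis using False by (simp add: block_def)
qed

lemma loop_power_compose: "(\<lambda>t. f (loop_power a n p t)) = loop_power (f a) n (\<lambda>t. f (p t))"
  by (induction n) (simp_all add: join_loops_compose)

lemma tower_loop_griffiths:
  "path_between griffiths_space griffiths_base griffiths_base (\<lambda>t. earring_to_griffiths (tower_loop A n t))"
  using path_between_continuous_image[OF tower_loop_earring continuous_earring_to_griffiths] by simp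

lemma tower_loop_root:
  "griffiths_homotopic (\<lambda>t. earring_to_griffiths (tower_loop A n t))
     (loop_power griffiths_base (Suc n) (\<lambda>t. earring_to_griffiths (tower_loop A (Suc n) t)))"
proof -
  let ?P = "loop_power griffiths_base (Suc n) (\<lambda>t. earring_to_griffiths (tower_loop A (Suc n) t))"
  have P: "path_between griffiths_space griffiths_base griffiths_base ?P"
    by (rule path_between_loop_power[OF tower_loop_griffiths])
  have "griffiths_homotopic (join_loops (\<lambda>t. earring_to_griffiths (block A n t)) ?P) (join_loops (\<lambda>t. griffiths_base) ?P)"
    by (rule path_homotopic_join[OF block_null_homotopic path_homotopic_refl[OF P]])
  from homotopic_with_trans[OF this path_homotopic_const_left[OF P]]
  show ?thesis
  proof (rule path_homotopic_cong)
    fix t :: real assume "t \<in> {0..1}"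
    have "join_loops (\<lambda>t. earring_to_griffiths (block A n t)) ?P =
        (\<lambda>t. earring_to_griffiths (join_loops (block A n) (loop_power 0 (Suc n) (tower_loop A (Suc n))) t))"
      unfolding join_loops_compose loop_power_compose by simp
    then show "join_loops (\<lambda>t. earring_to_griffiths (block A n t)) ?P t = earring_to_griffiths (tower_loop A n t)"
      using tower_loop_rec[OF \<open>t \<in> {0..1}\<close>, of A n] by simp
  qed simp
qed

text \<open>The elements are conjugates of the nested loops by a path to the base point. Their powers are detected
  in homology, where conjugation has no effect.\<close>

lemma fundamental_group_contains_rat:
  assumes y: "y \<in> topspace griffiths_space"
  shows "contains_copy_of (fundamental_group griffiths_space y) rat_group"
proof -
  let ?G = "fundamental_group griffiths_space y"
  interpret group ?G using y by (rule group_fundamental_group)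
  obtain l where l: "path_between griffiths_space y griffiths_base l"
    using y by (rule griffiths_path_to_base)
  define p where "p n = (\<lambda>t. earring_to_griffiths (tower_loop {} n t))" for n
  have p: "path_between griffiths_space griffiths_base griffiths_base (p n)" for n
    unfolding p_def by (rule tower_loop_griffiths)
  let ?c = "\<lambda>n. conjugate_loop l (p n)"
  have c: "path_between griffiths_space y y (?c n)" for n
    by (rule path_between_conjugate[OF l p])
  show ?thesis
  proof (rule contains_copy_of_rat_group[where x = "\<lambda>n. loop_class griffiths_space y (?c n)"])
    show "loop_class griffiths_space y (?c n) \<in> carrier ?G" for n
      using c by (auto simp: carrier_fundamental_group)
    show "loop_class griffiths_space y (?c n) = loop_class griffiths_space y (?c (Suc n)) [^]\<^bsub>?G\<^esub> Suc n" for n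
    proof -
      have "path_homotopic griffiths_space y y (?c n) (conjugate_loop l (loop_power griffiths_base (Suc n) (p (Suc n))))"
        by (rule path_homotopic_conjugate[OF l]) (unfold p_def, rule tower_loop_root)
      from homotopic_with_trans[OF this homotopic_with_symD[OF path_homotopic_conjugate_power[OF l p]]]
      show ?thesis
        unfolding loop_class_power[OF c] by (rule loop_class_eq_iff[OF c path_between_loop_power[OF c], THEN iffD2])
    qed
  next
    fix k :: nat
    assume "loop_class griffiths_space y (?c 0) [^]\<^bsub>?G\<^esub> k = \<one>\<^bsub>?G\<^esub>"
    then have "path_homotopic griffiths_space y y (loop_power y k (?c 0)) (\<lambda>t. y)"
      unfolding loop_class_power[OF c] one_fundamental_group
      by (rule loop_class_eq_iff[OF path_between_loop_power[OF c] path_between_const[OF y], THEN iffD1])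
    from homologous_if_homotopic[OF this]
    have "homologous_rel 1 griffiths_space {} (frag_of (path_simplex (loop_power y k (?c 0)))) 0"
      using homologous_const[OF y] homologous_rel_trans by blast
    then have "homologous_rel 1 griffiths_space {} (frag_cmul (int k) (frag_of (path_simplex (?c 0)))) 0"
      using homologous_loop_power[OF c, of k 0] homologous_rel_trans homologous_rel_sym[THEN iffD1] by blast
    moreover have "homologous_rel 1 griffiths_space {} (frag_cmul (int k) (frag_of (path_simplex (?c 0))))
        (frag_cmul (int k) (frag_of (path_simplex (p 0))))"
      using singular_relboundary_cmul[OF homologous_conjugate[OF l p, of 0, unfolded homologous_rel_def], of "int k"]
      by (simp add: homologous_rel_def frag_cmul_diff_right)
    ultimately have "homologous_rel 1 griffiths_space {} (frag_cmul (int k) (frag_of (path_simplex (p 0)))) 0"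
      using homologous_rel_trans homologous_rel_sym[THEN iffD1] by blast
    then have "singular_relboundary 1 griffiths_space {} (\<Sum>A\<in>{{}}. frag_cmul (int k) (tower_chain earring_to_griffiths A 0))"
      by (simp add: homologous_rel_def tower_chain_def p_def)
    from tower_chains_independent[OF _ this] show "k = 0" by simp
  qed
qed

theorem corollary9p2:
  shows "contains_copy_of (homology_group 1 (top_of_set hawaiian_earring)) continuum_sum_rat
    \<and> contains_copy_of (homology_group 1 griffiths_space) continuum_sum_rat
    \<and> (\<forall>y \<in> topspace griffiths_space.
          contains_copy_of (fundamental_group griffiths_space y) rat_group)"
proof (intro conjI ballI)
  show "contains_copy_of (homology_group 1 (top_of_set hawaiian_earring)) continuum_sum_rat"
    by (rule homology_contains_continuum_sum_rat[of _ "\<lambda>z. z" earring_to_griffiths])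
      (use continuous_earring_to_griffiths in auto)
  show "contains_copy_of (homology_group 1 griffiths_space) continuum_sum_rat"
    by (rule homology_contains_continuum_sum_rat[of _ earring_to_griffiths "\<lambda>y. y"])
      (use continuous_earring_to_griffiths in auto)
qed (rule fundamental_group_contains_rat)

end
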